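(* Let $X$ be a paracompact smooth Hausdorff manifold and let $u\in\mathcal G(X)$. Then $u$ is invertible in $\mathcal G(X)$ if and only if the point value $u(\tilde p)$ is invertible in $\mathcal K$ for each compactly supported generalized point $\tilde p\in\widetilde X_c$.
   Context: Let $\mathbb K=\mathbb R$ or $\mathbb C$; functions are $\mathbb K$-valued. $\mathcal G(X):=\mathcal E_M(X)/\mathcal N(X)$, where $\mathcal E_M(X)$ is the set of nets $(u_\varepsilon)_{\varepsilon\in(0,1]}$ in $C^\infty(X)$ such that for every compact $K\subset X$ and every linear differential operator $P$ on $C^\infty(X)$ there is $N\in\mathbb N$ with $\sup_{p\in K}|Pu_\varepsilon(p)|=O(\varepsilon^{-N})$ as $\varepsilon\to0$; $\mathcal N(X)$ is the set of $(u_\varepsilon)_\varepsilon\in\mathcal E_M(X)$ with $\sup_{p\in K}|u_\varepsilon(p)|=O(\varepsilon^m)$ for every compact $K\subset X$ and every $m\in\mathbb N_0$. Operations are $\varepsilon$-wise. $\mathcal K$ (generalized numbers) is the ring of nets $(r_\varepsilon)_\varepsilon\in\mathbb K^{(0,1]}$ with $|r_\varepsilon|=O(\varepsilon^{-N})$ for some $N$, modulo nets with $|r_\varepsilon|=O(\varepsilon^m)$ for every $m$. $\widetilde X_c:=X_c/\sim$ is the set of compactly supported generalized points: $X_c$ is the set of nets $(p_\varepsilon)_\varepsilon\in X^{(0,1]}$ for which there is a compact set $K\subset X$ with $p_\varepsilon\in K$ for all small $\varepsilon$, and $(p_\varepsilon)_\varepsilon\sim(p'_\varepsilon)_\varepsilon$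 iff $d_h(p_\varepsilon,p'_\varepsilon)=O(\varepsilon^m)$ for all $m$, where $d_h$ is the distance function induced by some (equivalently any) Riemannian metric $h$ on $X$. For $u=[(u_\varepsilon)_\varepsilon]\in\mathcal G(X)$ and $\tilde p=[(p_\varepsilon)_\varepsilon]\in\widetilde X_c$, the point value is $u(\tilde p):=[(u_\varepsilon(p_\varepsilon))_\varepsilon]\in\mathcal K$ (this is well defined). *)

theory Defs
  imports "HOL-Analysis.Analysis" "HOL-Algebra.QuotRing" "HOL-Library.Landau_Symbols"
begin

section \<open>Smooth manifolds\<close>

text \<open>
  The model space of a manifold is a type of class \<open>real_inner\<close> and \<open>heine_borel\<close>, i.e. a
  finite-dimensional real inner product space. In contrast to \<open>euclidean_space\<close> this does not
  exclude dimension zero.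

  For an open set \<open>W\<close>, \<open>smooth_on W f\<close> says that \<open>f\<close> is of class \<open>C\<^sup>\<infinity>\<close> on \<open>W\<close>:
  all iterated directional derivatives are (Frechet) differentiable, hence continuous.
\<close>

primrec iter_deriv ::
  "'e::real_normed_vector list \<Rightarrow> ('e \<Rightarrow> 'b::real_normed_vector) \<Rightarrow> 'e \<Rightarrow> 'b" where
  "iter_deriv [] f = f"
| "iter_deriv (v # vs) f = (\<lambda>x. frechet_derivative (iter_deriv vs f) (at x) v)"

definition smooth_on ::
  "'e::real_normed_vector set \<Rightarrow> ('e \<Rightarrow> 'b::real_normed_vector) \<Rightarrow> bool" where
  "smooth_on W f \<longleftrightarrow> (\<forall>vs. \<forall>x\<in>W. iter_deriv vs f differentiable (at x))"

text \<open>A chart is a pair \<open>(U, \<phi>)\<close>; the values of \<open>\<phi>\<close> outside \<open>U\<close> are irrelevant.\<close>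

type_synonym ('a, 'e) chart = "'a set \<times> ('a \<Rightarrow> 'e)"

definition smooth_atlas ::
  "('a::topological_space, 'e::{real_inner,heine_borel}) chart set \<Rightarrow> bool" where
  "smooth_atlas A \<longleftrightarrow>
     (\<Union>(U, \<phi>)\<in>A. U) = UNIV \<and>
     (\<forall>(U, \<phi>)\<in>A. open U \<and> open (\<phi> ` U) \<and> homeomorphism U (\<phi> ` U) \<phi> (inv_into U \<phi>)) \<and>
     (\<forall>(U, \<phi>)\<in>A. \<forall>(V, \<psi>)\<in>A. smooth_on (\<phi> ` (U \<inter> V)) (\<psi> \<circ> inv_into U \<phi>))"

definition paracompact_space :: "'a topology \<Rightarrow> bool" where
  "paracompact_space T \<longleftrightarrow>
     (\<forall>\<U>. (\<forall>U\<in>\<U>. openin T U) \<and> \<Union>\<U> = topspace T \<longrightarrow>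
        (\<exists>\<V>. (\<forall>V\<in>\<V>. openin T V) \<and> \<Union>\<V> = topspace T \<and>
             (\<forall>V\<in>\<V>. \<exists>U\<in>\<U>. V \<subseteq> U) \<and> locally_finite_in T \<V>))"

definition smooth_functions ::
  "('a::topological_space, 'e::{real_inner,heine_borel}) chart set
    \<Rightarrow> ('a \<Rightarrow> 'k::real_normed_vector) set" where
  "smooth_functions A = {f. \<forall>(U, \<phi>)\<in>A. smooth_on (\<phi> ` U) (f \<circ> inv_into U \<phi>)}"

text \<open>
  Linear differential operators (of finite order at most \<open>m\<close>): in each chart, finite sums of
  iterated derivatives with smooth coefficients \<open>a vs\<close>. The multi-index derivatives are given by
  lists \<open>vs\<close> of arbitrary directions; expanding the directions in a basis gives the usual form.
\<close>

definition linear_differential_operator ::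
  "('a::topological_space, 'e::{real_inner,heine_borel}) chart set
    \<Rightarrow> (('a \<Rightarrow> 'k::real_normed_field) \<Rightarrow> ('a \<Rightarrow> 'k)) \<Rightarrow> bool" where
  "linear_differential_operator A P \<longleftrightarrow>
     (\<exists>m::nat. \<forall>(U, \<phi>)\<in>A. \<exists>L a. finite L \<and>
        (\<forall>vs\<in>L. length vs \<le> m \<and> smooth_on (\<phi> ` U) (a vs)) \<and>
        (\<forall>f\<in>smooth_functions A. \<forall>p\<in>U.
           P f p = (\<Sum>vs\<in>L. a vs (\<phi> p) * iter_deriv vs (f \<circ> inv_into U \<phi>) (\<phi> p))))"

section \<open>Riemannian metrics and their distance functions\<close>

text \<open>
  A Riemannian metric is given by its local representatives: \<open>h (U, \<phi>) p\<close> is the bilinear form on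
  the model space that represents the inner product on the tangent space at \<open>p\<close> in the chart
  \<open>(U, \<phi>)\<close>. The last condition is the transformation law under a change of charts.
\<close>

definition riemannian_metric ::
  "('a::topological_space, 'e::{real_inner,heine_borel}) chart set
    \<Rightarrow> (('a, 'e) chart \<Rightarrow> 'a \<Rightarrow> 'e \<Rightarrow> 'e \<Rightarrow> real) \<Rightarrow> bool" where
  "riemannian_metric A h \<longleftrightarrow>
     (\<forall>(U, \<phi>)\<in>A. \<forall>p\<in>U. bilinear (h (U, \<phi>) p) \<and>
        (\<forall>v w. h (U, \<phi>) p v w = h (U, \<phi>) p w v) \<and>
        (\<forall>v. v \<noteq> 0 \<longrightarrow> h (U, \<phi>) p v v > 0)) \<and>
     (\<forall>(U, \<phi>)\<in>A. \<forall>v w. smooth_on (\<phi> ` U) (\<lambda>x. h (U, \<phi>) (inv_into U \<phi> x) v w)) \<and>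
     (\<forall>(U, \<phi>)\<in>A. \<forall>(V, \<psi>)\<in>A. \<forall>p\<in>U \<inter> V. \<forall>v w.
        h (U, \<phi>) p v w =
          (let D = frechet_derivative (\<psi> \<circ> inv_into U \<phi>) (at (\<phi> p))
           in h (V, \<psi>) p (D v) (D w)))"

text \<open>
  Piecewise \<open>C\<^sup>1\<close> curves, in the sense of the library. Like the library notion this does not ask for
  one-sided limits of the derivative at the finitely many break points, which does not affect the
  infimum of the lengths below.
\<close>

definition piecewise_C1_curve ::
  "('a::topological_space, 'e::{real_inner,heine_borel}) chart set \<Rightarrow> (real \<Rightarrow> 'a) \<Rightarrow> bool" where
  "piecewise_C1_curve A \<gamma> \<longleftrightarrow>
     path \<gamma> \<and>
     (\<forall>(U, \<phi>)\<in>A. \<forall>a b. {a..b} \<subseteq> {0..1} \<and> \<gamma> ` {a..b} \<subseteq> U \<longrightarrow>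
        (\<phi> \<circ> \<gamma>) piecewise_C1_differentiable_on {a..b})"

text \<open>By the transformation law the speed does not depend on the chart chosen around \<open>\<gamma> t\<close>.\<close>

definition riemannian_speed ::
  "('a::topological_space, 'e::{real_inner,heine_borel}) chart set
    \<Rightarrow> (('a, 'e) chart \<Rightarrow> 'a \<Rightarrow> 'e \<Rightarrow> 'e \<Rightarrow> real) \<Rightarrow> (real \<Rightarrow> 'a) \<Rightarrow> real \<Rightarrow> real" where
  "riemannian_speed A h \<gamma> t =
     (let c = (SOME c. c \<in> A \<and> \<gamma> t \<in> fst c);
          v = vector_derivative (snd c \<circ> \<gamma>) (at t)
      in sqrt (h c (\<gamma> t) v v))"

definition riemannian_length ::
  "('a::topological_space, 'e::{real_inner,heine_borel}) chart set
    \<Rightarrow> (('a, 'e) chart \<Rightarrow> 'a \<Rightarrow> 'e \<Rightarrow> 'e \<Rightarrow> real) \<Rightarrow> (real \<Rightarrow> 'a) \<Rightarrow> ennreal" where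
  "riemannian_length A h \<gamma> =
     (\<integral>\<^sup>+ t. ennreal (riemannian_speed A h \<gamma> t) * indicator {0..1} t \<partial>lborel)"

text \<open>The distance of points in different components is \<open>\<infinity>\<close>, the infimum of the empty set.\<close>

definition riemannian_dist ::
  "('a::topological_space, 'e::{real_inner,heine_borel}) chart set
    \<Rightarrow> (('a, 'e) chart \<Rightarrow> 'a \<Rightarrow> 'e \<Rightarrow> 'e \<Rightarrow> real) \<Rightarrow> 'a \<Rightarrow> 'a \<Rightarrow> ennreal" where
  "riemannian_dist A h p q =
     (INF \<gamma>\<in>{\<gamma>. piecewise_C1_curve A \<gamma> \<and> pathstart \<gamma> = p \<and> pathfinish \<gamma> = q}.
        riemannian_length A h \<gamma>)"

section \<open>Generalized functions, numbers and points\<close>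

text \<open>
  Nets are functions on \<open>real\<close> of which only the restriction to \<open>{0<..1}\<close> matters. Their values
  at other parameters are unconstrained both in the rings of moderate nets and in the ideals of
  negligible nets, so that they disappear in the quotients. The supremum over the empty set is
  not meaningful in \<open>real\<close>, hence the restriction to nonempty compact sets.
\<close>

definition moderate_nets ::
  "('a::topological_space, 'e::{real_inner,heine_borel}) chart set
    \<Rightarrow> (real \<Rightarrow> 'a \<Rightarrow> 'k::real_normed_field) set" where
  "moderate_nets A =
     {u. (\<forall>\<epsilon>\<in>{0<..1}. u \<epsilon> \<in> smooth_functions A) \<and>
         (\<forall>K P. compact K \<and> K \<noteq> {} \<and> linear_differential_operator A P \<longrightarrow>
            (\<exists>N::nat. (\<lambda>\<epsilon>. SUP p\<in>K. norm (P (u \<epsilon>) p)) \<in> O[at_right 0](\<lambda>\<epsilon>. 1 / \<epsilon> ^ N)))}"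

definition negligible_nets ::
  "('a::topological_space, 'e::{real_inner,heine_borel}) chart set
    \<Rightarrow> (real \<Rightarrow> 'a \<Rightarrow> 'k::real_normed_field) set" where
  "negligible_nets A =
     {u \<in> moderate_nets A. \<forall>K. compact K \<and> K \<noteq> {} \<longrightarrow>
        (\<forall>m::nat. (\<lambda>\<epsilon>. SUP p\<in>K. norm (u \<epsilon> p)) \<in> O[at_right 0](\<lambda>\<epsilon>. \<epsilon> ^ m))}"

definition moderate_ring ::
  "('a::topological_space, 'e::{real_inner,heine_borel}) chart set
    \<Rightarrow> (real \<Rightarrow> 'a \<Rightarrow> 'k::real_normed_field) ring" where
  "moderate_ring A =
     \<lparr>carrier = moderate_nets A,
      mult = (\<lambda>u v \<epsilon> p. u \<epsilon> p * v \<epsilon> p), one = (\<lambda>\<epsilon> p. 1),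
      zero = (\<lambda>\<epsilon> p. 0), add = (\<lambda>u v \<epsilon> p. u \<epsilon> p + v \<epsilon> p)\<rparr>"

definition generalized_functions ::
  "('a::topological_space, 'e::{real_inner,heine_borel}) chart set
    \<Rightarrow> (real \<Rightarrow> 'a \<Rightarrow> 'k::real_normed_field) set ring" where
  "generalized_functions A = moderate_ring A Quot negligible_nets A"

definition moderate_numbers :: "(real \<Rightarrow> 'k::real_normed_field) set" where
  "moderate_numbers =
     {r. \<exists>N::nat. (\<lambda>\<epsilon>. norm (r \<epsilon>)) \<in> O[at_right 0](\<lambda>\<epsilon>. 1 / \<epsilon> ^ N)}"

definition negligible_numbers :: "(real \<Rightarrow> 'k::real_normed_field) set" where
  "negligible_numbers =
     {r \<in> moderate_numbers. \<forall>m::nat. (\<lambda>\<epsilon>. norm (r \<epsilon>)) \<in> O[at_right 0](\<lambda>\<epsilon>. \<epsilon> ^ m)}"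

definition moderate_number_ring :: "(real \<Rightarrow> 'k::real_normed_field) ring" where
  "moderate_number_ring =
     \<lparr>carrier = moderate_numbers,
      mult = (\<lambda>r s \<epsilon>. r \<epsilon> * s \<epsilon>), one = (\<lambda>\<epsilon>. 1),
      zero = (\<lambda>\<epsilon>. 0), add = (\<lambda>r s \<epsilon>. r \<epsilon> + s \<epsilon>)\<rparr>"

definition generalized_numbers :: "(real \<Rightarrow> 'k::real_normed_field) set ring" where
  "generalized_numbers = moderate_number_ring Quot negligible_numbers"

definition compactly_supported_nets :: "(real \<Rightarrow> 'a::topological_space) set" where
  "compactly_supported_nets = {p. \<exists>K. compact K \<and> (\<forall>\<^sub>F \<epsilon> in at_right 0. p \<epsilon> \<in> K)}"

text \<open>
  Which Riemannian metric is used is immaterial; equivalence is with respect to some metric. The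
  condition on the distance reads \<open>d\<^sub>h(p \<epsilon>, q \<epsilon>) = O(\<epsilon>\<^sup>m)\<close> for all \<open>m\<close>, with values in \<open>ennreal\<close>.
\<close>

definition equivalent_nets ::
  "('a::topological_space, 'e::{real_inner,heine_borel}) chart set
    \<Rightarrow> ((real \<Rightarrow> 'a) \<times> (real \<Rightarrow> 'a)) set" where
  "equivalent_nets A =
     {(p, q). p \<in> compactly_supported_nets \<and> q \<in> compactly_supported_nets \<and>
        (\<exists>h. riemannian_metric A h \<and>
           (\<forall>m::nat. \<exists>C. \<forall>\<^sub>F \<epsilon> in at_right 0.
              riemannian_dist A h (p \<epsilon>) (q \<epsilon>) \<le> ennreal (C * \<epsilon> ^ m)))}"

definition generalized_points ::
  "('a::topological_space, 'e::{real_inner,heine_borel}) chart set \<Rightarrow> (real \<Rightarrow> 'a) set set" where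
  "generalized_points A = compactly_supported_nets // equivalent_nets A"

text \<open>
  As usual for operations on quotients, the union ranges over all representatives; all members
  of the union are the same coset.
\<close>

definition point_value ::
  "(real \<Rightarrow> 'a \<Rightarrow> 'k::real_normed_field) set \<Rightarrow> (real \<Rightarrow> 'a) set \<Rightarrow> (real \<Rightarrow> 'k) set" where
  "point_value u p =
     (\<Union>r\<in>u. \<Union>q\<in>p. negligible_numbers +>\<^bsub>moderate_number_ring\<^esub> (\<lambda>\<epsilon>. r \<epsilon> (q \<epsilon>)))"

end

theory Submission
  imports Defs "HOL-Library.Function_Algebras"
begin

text \<open>
  If \<open>u\<close> has an inverse, then the point values of the inverse are inverses of the point values. The
  content of this direction is that a point value is a single coset: equivalent generalized points
  must give the same number. A curve that starts in a small coordinate ball and leaves a larger one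
  has a length bounded from below (\<open>riemannian_dist_controls_chart\<close>), so two points at small
  Riemannian distance lie in a common chart, at a coordinate distance bounded by a multiple of the
  Riemannian one. By the mean value theorem a moderate net varies between them by at most
  \<open>\<epsilon>\<^sup>-\<^sup>N\<close> times this distance, which is negligible for equivalent points
  (\<open>equivalent_nets_point_values\<close>). A point value must also be nonempty: a generalized point has to
  contain its own representative, and as equivalence refers to some Riemannian metric, this is where
  a metric is constructed from paracompactness (\<open>riemannian_metric_exists\<close>).

  For the converse, let \<open>r\<close> represent \<open>u\<close> and let \<open>K\<close> be compact. Choosing for each \<open>\<epsilon>\<close> a point
  of \<open>K\<close> where \<open>\<bar>r \<epsilon>\<bar>\<close> is minimal gives one generalized point, and the invertibility of the point
  value there yields \<open>\<bar>r \<epsilon>\<bar> \<ge> \<epsilon>\<^sup>m\<close> on \<open>K\<close> for small \<open>\<epsilon>\<close>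
  (\<open>lower_bound_of_invertible_point_values\<close>). The bound holds only for \<open>\<epsilon>\<close> below a threshold that
  depends on \<open>K\<close>, so \<open>1 / r \<epsilon>\<close> may be undefined somewhere for every \<open>\<epsilon>\<close>. The net
  \<open>cnj (r \<epsilon>) / (\<bar>r \<epsilon>\<bar>\<^sup>2 + exp (- 1 / \<epsilon>))\<close> is defined everywhere, and the added summand is
  negligible (\<open>inverse_net_exists\<close>).

  That this net is moderate is proved in charts. Moderateness is defined by means of globally defined
  differential operators; multiplying a derivative in a chart by a bump function gives such an
  operator, hence a net is moderate if and only if all its iterated derivatives in all charts are
  locally bounded by powers of \<open>1 / \<epsilon>\<close> (\<open>moderate_nets_imp_moderate_on\<close>,
  \<open>moderate_on_imp_moderate_nets\<close>). In this form moderateness passes to sums, products and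
  inverses by the rules for derivatives.
\<close>

section \<open>Derivatives\<close>

abbreviation \<D> :: "('e::real_normed_vector \<Rightarrow> 'b::real_normed_vector) \<Rightarrow> 'e \<Rightarrow> 'e \<Rightarrow> 'b" where
  "\<D> f x \<equiv> frechet_derivative f (at x)"

text \<open>
  Orthonormal vectors have distance \<open>sqrt 2\<close>, so a ball of radius \<open>1 / 2\<close> contains at most one of
  them. As finitely many such balls cover the unit ball, the size of orthonormal sets is bounded,
  and one of maximal size spans the space.
\<close>

lemma finite_orthonormal_basis_exists:
  obtains B :: "'e::{real_inner,heine_borel} set"
  where "finite B" "\<And>x. (\<Sum>b\<in>B. (x \<bullet> b) *\<^sub>R b) = x"
proof -
  define orth where "orth B \<longleftrightarrow> (\<forall>b\<in>B. norm b = 1) \<and> (\<forall>b\<in>B. \<forall>c\<in>B. b \<noteq> c \<longrightarrow> b \<bullet> c = 0)"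
    for B :: "'e set"
  have "compact (cball (0::'e) 1)" by simp
  moreover have "x \<in> (\<Union>y\<in>UNIV. ball y (1/2))" for x :: 'e
    by (rule UN_I[of x]) simp_all
  ultimately obtain F :: "'e set" where F: "finite F" "cball 0 1 \<subseteq> (\<Union>x\<in>F. ball x (1/2))"
    by (rule_tac compactE_image[of "cball 0 1" UNIV "\<lambda>x. ball x (1/2)"]) blast+
  have bound: "finite B \<and> card B \<le> card F" if B: "orth B" for B
  proof -
    have "\<forall>b\<in>B. \<exists>x\<in>F. b \<in> ball x (1/2)"
    proof
      fix b assume "b \<in> B"
      then have "b \<in> cball 0 1" using B by (simp add: orth_def)
      then show "\<exists>x\<in>F. b \<in> ball x (1/2)" using F(2) by blast
    qed
    then obtain g where g: "\<And>b. b \<in> B \<Longrightarrow> g b \<in> F \<and> b \<in> ball (g b) (1/2)" by metis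
    have "inj_on g B"
    proof (rule inj_onI, rule ccontr)
      fix b c assume bc: "b \<in> B" "c \<in> B" "g b = g c" "b \<noteq> c"
      have "(norm (b - c))\<^sup>2 = 2"
        using B bc by (simp add: orth_def power2_norm_eq_inner inner_diff inner_commute
            norm_eq_1)
      moreover have "dist b c < 1"
        using g[OF bc(1)] g[OF bc(2)] bc(3) by (metis dist_commute dist_triangle_half_r mem_ball)
      then have "(norm (b - c))\<^sup>2 < 1\<^sup>2"
        unfolding dist_norm by (intro power_strict_mono) auto
      ultimately show False by simp
    qed
    moreover have "g ` B \<subseteq> F" using g by auto
    ultimately show ?thesis
      using F(1) by (meson card_inj_on_le inj_on_finite)
  qed
  have "\<exists>B. orth B \<and> (\<forall>C. orth C \<longrightarrow> card C \<le> card B)"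
  proof -
    have "orth {}" by (simp add: orth_def)
    then show ?thesis
      using ex_has_greatest_nat[of orth "{}" card "Suc (card F)"] bound by (simp add: less_Suc_eq_le)
  qed
  then obtain B where B: "orth B" "\<And>C. orth C \<Longrightarrow> card C \<le> card B" by blast
  have finB: "finite B" using bound B by blast
  show ?thesis
  proof (rule that[OF finB], rule ccontr)
    fix x assume ne: "(\<Sum>b\<in>B. (x \<bullet> b) *\<^sub>R b) \<noteq> x"
    define y where "y = x - (\<Sum>b\<in>B. (x \<bullet> b) *\<^sub>R b)"
    have yne: "y \<noteq> 0" using ne by (simp add: y_def)
    have yb: "y \<bullet> b = 0" if "b \<in> B" for b
    proof -
      have "(\<Sum>c\<in>B. (x \<bullet> c) * (c \<bullet> b)) = (\<Sum>c\<in>B. if c = b then x \<bullet> b else 0)"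
        using B(1) that by (intro sum.cong) (auto simp: orth_def norm_eq_1)
      then show ?thesis
        using that finB by (simp add: y_def inner_diff_left inner_sum_left)
    qed
    define z where "z = y /\<^sub>R norm y"
    have z: "norm z = 1" "\<And>b. b \<in> B \<Longrightarrow> z \<bullet> b = 0" "\<And>b. b \<in> B \<Longrightarrow> b \<bullet> z = 0"
      using yne yb by (auto simp: z_def inner_commute)
    have "z \<notin> B" using z norm_eq_1 by fastforce
    moreover have "orth (insert z B)" using B(1) z by (auto simp: orth_def)
    ultimately show False using B(2)[of "insert z B"] finB by simp
  qed
qed

lemma linear_eq_sum_basis:
  assumes "linear D" "\<And>x. (\<Sum>b\<in>B. (x \<bullet> b) *\<^sub>R b) = x"
  shows "D v = (\<Sum>b\<in>B. (v \<bullet> b) *\<^sub>R D b)"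
proof -
  have "D v = D (\<Sum>b\<in>B. (v \<bullet> b) *\<^sub>R b)" by (simp add: assms(2))
  then show ?thesis by (simp add: linear_sum[OF assms(1)] linear_cmul[OF assms(1)])
qed

lemma iter_deriv_append: "iter_deriv (vs @ ws) f = iter_deriv vs (iter_deriv ws f)"
  by (induction vs) auto

text \<open>
  While \<open>iter_deriv\<close> recurs on the outermost derivative, this equivalence splits off the innermost
  one. This is the form that fits the product and chain rules, which turn the first derivative of a
  compound expression into an expression of the same kind.
\<close>

lemma smooth_on_iff_derivative:
  "smooth_on W f \<longleftrightarrow>
     (\<forall>x\<in>W. f differentiable (at x)) \<and> (\<forall>v. smooth_on W (\<lambda>x. \<D> f x v))"
    (is "_ = ?R")
proof
  assume f: "smooth_on W f"
  have "iter_deriv vs (\<lambda>x. \<D> f x v) = iter_deriv (vs @ [v]) f" for v vs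
    by (simp add: iter_deriv_append)
  then have "smooth_on W (\<lambda>x. \<D> f x v)" for v
    using f by (simp add: smooth_on_def)
  moreover have "f differentiable (at x)" if "x \<in> W" for x
    using f that unfolding smooth_on_def by (metis iter_deriv.simps(1))
  ultimately show ?R by simp
next
  assume R: ?R
  have "iter_deriv vs f differentiable (at x)" if "x \<in> W" for vs x
  proof (cases vs rule: rev_cases)
    case Nil then show ?thesis using R that by simp
  next
    case (snoc ws v)
    then show ?thesis using R that unfolding smooth_on_def by (simp add: iter_deriv_append)
  qed
  then show "smooth_on W f" by (simp add: smooth_on_def)
qed

lemma smooth_on_differentiable: "smooth_on W f \<Longrightarrow> x \<in> W \<Longrightarrow> f differentiable (at x)"
  using smooth_on_iff_derivative[THEN iffD1] by blast

lemma smooth_on_derivative: "smooth_on W f \<Longrightarrow> smooth_on W (\<lambda>x. \<D> f x v)"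
  using smooth_on_iff_derivative[THEN iffD1] by blast

lemma smooth_on_iter_deriv: "smooth_on W f \<Longrightarrow> smooth_on W (iter_deriv vs f)"
  by (auto simp: smooth_on_def iter_deriv_append[symmetric])

lemma smooth_on_continuous_on: "smooth_on W f \<Longrightarrow> continuous_on W f"
  by (simp add: continuous_at_imp_continuous_on differentiable_imp_continuous_within
      smooth_on_differentiable)

lemma smooth_on_subset: "smooth_on W f \<Longrightarrow> V \<subseteq> W \<Longrightarrow> smooth_on V f"
  by (auto simp: smooth_on_def)

lemma smooth_on_Un: "smooth_on V f \<Longrightarrow> smooth_on W f \<Longrightarrow> smooth_on (V \<union> W) f"
  by (auto simp: smooth_on_def)

lemma frechet_derivative_cong_open:
  assumes "open W" "x \<in> W" "\<And>y. y \<in> W \<Longrightarrow> f y = g y"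
  shows "\<D> f x = \<D> g x"
proof -
  have "(f has_derivative D) (at x) \<longleftrightarrow> (g has_derivative D) (at x)" for D
    using has_derivative_transform_within_open[OF _ assms(1,2), of f D UNIV g]
      has_derivative_transform_within_open[OF _ assms(1,2), of g D UNIV f] assms(3) by auto
  then show ?thesis by (simp add: frechet_derivative_def)
qed

lemma differentiable_cong_open:
  assumes "open W" "x \<in> W" "\<And>y. y \<in> W \<Longrightarrow> f y = g y" "f differentiable (at x)"
  shows "g differentiable (at x)"
proof -
  obtain D where "(f has_derivative D) (at x)" using assms(4) by (auto simp: differentiable_def)
  then have "(g has_derivative D) (at x)"
    by (rule has_derivative_transform_within_open[OF _ assms(1,2)]) (rule assms(3))
  then show ?thesis by (auto simp: differentiable_def)
qed

lemma iter_deriv_cong_open: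
  assumes "open W" "\<And>y. y \<in> W \<Longrightarrow> f y = g y" "x \<in> W"
  shows "iter_deriv vs f x = iter_deriv vs g x"
  using assms(3)
proof (induction vs arbitrary: x)
  case Nil then show ?case using assms by simp
next
  case (Cons v vs)
  then show ?case using frechet_derivative_cong_open[OF assms(1) Cons.prems Cons.IH] by simp
qed

lemma smooth_on_cong_open:
  assumes "open W" "\<And>y. y \<in> W \<Longrightarrow> f y = g y" "smooth_on W f"
  shows "smooth_on W g"
proof -
  have "iter_deriv vs g differentiable (at x)" if "x \<in> W" for vs x
    using differentiable_cong_open[OF assms(1) that iter_deriv_cong_open[OF assms(1,2)]] assms(3) that
    by (simp add: smooth_on_def)
  then show ?thesis by (simp add: smooth_on_def)
qed

lemma frechet_derivative_bounded_linear_compose: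
  assumes "bounded_linear L" "f differentiable (at x)"
  shows "(\<lambda>x. L (f x)) differentiable (at x)"
    and "\<D> (\<lambda>x. L (f x)) x = (\<lambda>v. L (\<D> f x v))"
proof -
  have "((\<lambda>x. L (f x)) has_derivative (\<lambda>v. L (\<D> f x v))) (at x)"
    using bounded_linear.has_derivative[OF assms(1)] assms(2) by (simp add: frechet_derivative_works)
  then show "(\<lambda>x. L (f x)) differentiable (at x)"
    "\<D> (\<lambda>x. L (f x)) x = (\<lambda>v. L (\<D> f x v))"
    using frechet_derivative_at differentiable_def by metis+
qed

lemma frechet_derivative_add':
  assumes "f differentiable (at x)" "g differentiable (at x)"
  shows "\<D> (\<lambda>x. f x + g x) x =
    (\<lambda>v. \<D> f x v + \<D> g x v)"
  using assms by (intro frechet_derivative_at[symmetric] has_derivative_add)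
    (simp_all add: frechet_derivative_works)

lemma frechet_derivative_bilinear:
  assumes "bounded_bilinear pr" "f differentiable (at x)" "g differentiable (at x)"
  shows "(\<lambda>x. pr (f x) (g x)) differentiable (at x)"
    and "\<D> (\<lambda>x. pr (f x) (g x)) x =
      (\<lambda>v. pr (f x) (\<D> g x v) + pr (\<D> f x v) (g x))"
proof -
  have "((\<lambda>x. pr (f x) (g x)) has_derivative
      (\<lambda>v. pr (f x) (\<D> g x v) + pr (\<D> f x v) (g x))) (at x)"
    using bounded_bilinear.FDERIV[OF assms(1)] assms(2,3) by (simp add: frechet_derivative_works)
  then show "(\<lambda>x. pr (f x) (g x)) differentiable (at x)"
    "\<D> (\<lambda>x. pr (f x) (g x)) x =
      (\<lambda>v. pr (f x) (\<D> g x v) + pr (\<D> f x v) (g x))"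
    using frechet_derivative_at differentiable_def by metis+
qed

lemma frechet_derivative_compose_basis:
  fixes f :: "'d::real_normed_vector \<Rightarrow> 'e::real_inner" and g :: "'e \<Rightarrow> 'b::real_normed_vector"
  assumes "f differentiable (at x)" "g differentiable (at (f x))"
    "\<And>x. (\<Sum>b\<in>B. (x \<bullet> b) *\<^sub>R b) = x"
  shows "\<D> (\<lambda>x. g (f x)) x v =
    (\<Sum>b\<in>B. (\<D> f x v \<bullet> b) *\<^sub>R \<D> g (f x) b)"
proof -
  have "\<D> (g \<circ> f) x v = \<D> g (f x) (\<D> f x v)"
    by (simp add: frechet_derivative_compose assms)
  also have "\<dots> = (\<Sum>b\<in>B. (\<D> f x v \<bullet> b) *\<^sub>R \<D> g (f x) b)"
    by (rule linear_eq_sum_basis[OF linear_frechet_derivative[OF assms(2)] assms(3)])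
  finally show ?thesis by (simp add: o_def)
qed

section \<open>Moderate nets of smooth maps\<close>

abbreviation bounded_by_power :: "'x set \<Rightarrow> (real \<Rightarrow> 'x \<Rightarrow> 'b::real_normed_vector) \<Rightarrow> nat \<Rightarrow> bool" where
  "bounded_by_power S w N \<equiv> \<forall>\<^sub>F \<epsilon> in at_right 0. \<forall>y\<in>S. norm (w \<epsilon> y) \<le> 1 / \<epsilon> ^ N"

text \<open>
  Constant factors are absorbed by increasing the exponent, which is why the bounds come without
  constants.
\<close>

definition locally_moderate ::
    "'x::topological_space set \<Rightarrow> (real \<Rightarrow> 'x \<Rightarrow> 'b::real_normed_vector) \<Rightarrow> bool" where
  "locally_moderate W w \<longleftrightarrow> (\<forall>x\<in>W. \<exists>T N. open T \<and> x \<in> T \<and> bounded_by_power (T \<inter> W) w N)"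

lemma eventually_unit_interval: "\<forall>\<^sub>F \<epsilon> :: real in at_right 0. \<epsilon> \<in> {0<..1}"
  unfolding eventually_at_right_field by (auto intro: exI[of _ 1])

lemma eventually_const_le_inverse_power:
  "\<forall>\<^sub>F \<epsilon> :: real in at_right 0. C / \<epsilon> ^ N \<le> 1 / \<epsilon> ^ Suc N"
proof -
  have "\<forall>\<^sub>F \<epsilon> :: real in at_right 0. 0 < \<epsilon> \<and> \<epsilon> < 1 / (\<bar>C\<bar> + 1)"
    unfolding eventually_at_right_field by (auto intro!: exI[of _ "1 / (\<bar>C\<bar> + 1)"])
  then show ?thesis
  proof eventually_elim
    case (elim \<epsilon>)
    then have "\<epsilon> * \<bar>C\<bar> + \<epsilon> < 1" by (simp add: field_simps)
    moreover have "\<epsilon> * C \<le> \<epsilon> * \<bar>C\<bar>" using elim by (intro mult_left_mono) auto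
    ultimately have "C * \<epsilon> \<le> 1" using elim by (subst mult.commute) linarith
    then show ?case using elim by (simp add: field_simps)
  qed
qed

lemma inverse_power_mono:
  assumes "\<epsilon> \<in> {0<..1::real}" "M \<le> N" shows "1 / \<epsilon> ^ M \<le> 1 / \<epsilon> ^ N"
  using assms by (intro divide_left_mono power_decreasing mult_pos_pos) auto

lemma locally_moderateI:
  assumes "\<And>x. x \<in> W \<Longrightarrow> \<exists>T C N. open T \<and> x \<in> T \<and>
    (\<forall>\<^sub>F \<epsilon> in at_right 0. \<forall>y\<in>T \<inter> W. norm (w \<epsilon> y) \<le> C / \<epsilon> ^ (N :: nat))"
  shows "locally_moderate W w"
  unfolding locally_moderate_def
proof
  fix x assume "x \<in> W"
  from assms[OF this] obtain T C N where T: "open T" "x \<in> T"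
    "\<forall>\<^sub>F \<epsilon> in at_right 0. \<forall>y\<in>T \<inter> W. norm (w \<epsilon> y) \<le> C / \<epsilon> ^ (N :: nat)" by blast
  have "\<forall>\<^sub>F \<epsilon> in at_right 0. \<forall>y\<in>T \<inter> W. norm (w \<epsilon> y) \<le> 1 / \<epsilon> ^ Suc N"
    using T(3) eventually_const_le_inverse_power[of C N]
    by eventually_elim (meson order_trans)
  with T show "\<exists>T N. open T \<and> x \<in> T \<and> bounded_by_power (T \<inter> W) w N"
    by (intro exI[of _ T] exI[of _ "Suc N"] conjI)
qed

lemma locally_moderateE:
  assumes "locally_moderate W w" "x \<in> W"
  obtains T N where "open T" "x \<in> T"
    "bounded_by_power (T \<inter> W) w N"
  using bspec[OF assms(1)[unfolded locally_moderate_def] assms(2)] by blast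

lemma locally_moderate_bound:
  assumes w: "locally_moderate W w"
    and b: "\<forall>\<^sub>F \<epsilon> in at_right 0. \<forall>y\<in>W. norm (z \<epsilon> y) \<le> C * norm (w \<epsilon> y)" and C: "0 \<le> C"
  shows "locally_moderate W z"
proof (rule locally_moderateI, goal_cases)
  case x: (1 x)
  obtain T N where T: "open T" "x \<in> T"
    "bounded_by_power (T \<inter> W) w N"
    by (rule locally_moderateE[OF w x])
  have "\<forall>\<^sub>F \<epsilon> in at_right 0. \<forall>y\<in>T \<inter> W. norm (z \<epsilon> y) \<le> C / \<epsilon> ^ N"
    using T(3) b
  proof eventually_elim
    case (elim \<epsilon>)
    show ?case
    proof
      fix y assume y: "y \<in> T \<inter> W"
      have "norm (z \<epsilon> y) \<le> C * norm (w \<epsilon> y)" using elim(2) y by blast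
      also have "\<dots> \<le> C * (1 / \<epsilon> ^ N)" using elim(1) y C by (intro mult_left_mono) blast+
      finally show "norm (z \<epsilon> y) \<le> C / \<epsilon> ^ N" by simp
    qed
  qed
  with T show ?case
    by (intro exI[of _ T] exI[of _ C] exI[of _ N] conjI)
qed

lemma locally_moderate_cong:
  assumes "locally_moderate W w" "\<forall>\<^sub>F \<epsilon> in at_right 0. \<forall>y\<in>W. z \<epsilon> y = w \<epsilon> y"
  shows "locally_moderate W z"
  by (rule locally_moderate_bound[OF assms(1), where C = 1])
    (use assms(2) in \<open>auto elim: eventually_mono\<close>)

lemma locally_moderate_add:
  assumes "locally_moderate W w" "locally_moderate W z"
  shows "locally_moderate W (\<lambda>\<epsilon> x. w \<epsilon> x + z \<epsilon> x)"
proof (rule locally_moderateI, goal_cases)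
  case x: (1 x)
  obtain T N where T: "open T" "x \<in> T"
    "bounded_by_power (T \<inter> W) w N"
    by (rule locally_moderateE[OF assms(1) x])
  obtain S M where S: "open S" "x \<in> S"
    "bounded_by_power (S \<inter> W) z M"
    by (rule locally_moderateE[OF assms(2) x])
  have "\<forall>\<^sub>F \<epsilon> in at_right 0. \<forall>y\<in>(T \<inter> S) \<inter> W. norm (w \<epsilon> y + z \<epsilon> y) \<le> 2 / \<epsilon> ^ (max N M)"
    using T(3) S(3) eventually_unit_interval
  proof eventually_elim
    case (elim \<epsilon>)
    show ?case
    proof
      fix y assume y: "y \<in> (T \<inter> S) \<inter> W"
      have "norm (w \<epsilon> y + z \<epsilon> y) \<le> norm (w \<epsilon> y) + norm (z \<epsilon> y)" by (rule norm_triangle_ineq)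
      also have "\<dots> \<le> 1 / \<epsilon> ^ N + 1 / \<epsilon> ^ M" using elim y by (intro add_mono) auto
      also have "\<dots> \<le> 1 / \<epsilon> ^ (max N M) + 1 / \<epsilon> ^ (max N M)"
        using elim(3) by (intro add_mono inverse_power_mono) auto
      finally show "norm (w \<epsilon> y + z \<epsilon> y) \<le> 2 / \<epsilon> ^ (max N M)" by simp
    qed
  qed
  with T S show ?case
    by (intro exI[of _ "T \<inter> S"] exI[of _ 2] exI[of _ "max N M"] conjI open_Int IntI)
qed

lemma locally_moderate_bilinear:
  assumes "bounded_bilinear pr" "locally_moderate W w" "locally_moderate W z"
  shows "locally_moderate W (\<lambda>\<epsilon> x. pr (w \<epsilon> x) (z \<epsilon> x))"
proof (rule locally_moderateI, goal_cases)
  case x: (1 x)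
  obtain C where C: "0 < C" "\<And>a b. norm (pr a b) \<le> norm a * norm b * C"
    using bounded_bilinear.pos_bounded[OF assms(1)] by blast
  obtain T N where T: "open T" "x \<in> T"
    "bounded_by_power (T \<inter> W) w N"
    by (rule locally_moderateE[OF assms(2) x])
  obtain S M where S: "open S" "x \<in> S"
    "bounded_by_power (S \<inter> W) z M"
    by (rule locally_moderateE[OF assms(3) x])
  have "\<forall>\<^sub>F \<epsilon> in at_right 0. \<forall>y\<in>(T \<inter> S) \<inter> W. norm (pr (w \<epsilon> y) (z \<epsilon> y)) \<le> C / \<epsilon> ^ (N + M)"
    using T(3) S(3) eventually_unit_interval
  proof eventually_elim
    case (elim \<epsilon>)
    show ?case
    proof
      fix y assume y: "y \<in> (T \<inter> S) \<inter> W"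
      have "norm (pr (w \<epsilon> y) (z \<epsilon> y)) \<le> norm (w \<epsilon> y) * norm (z \<epsilon> y) * C" by (rule C(2))
      also have "\<dots> \<le> (1 / \<epsilon> ^ N) * (1 / \<epsilon> ^ M) * C"
        using elim y C(1) by (intro mult_mono) auto
      finally show "norm (pr (w \<epsilon> y) (z \<epsilon> y)) \<le> C / \<epsilon> ^ (N + M)" by (simp add: power_add)
    qed
  qed
  with T S show ?case
    by (intro exI[of _ "T \<inter> S"] exI[of _ C] exI[of _ "N + M"] conjI open_Int IntI)
qed

lemmas locally_moderate_mult = locally_moderate_bilinear[OF bounded_bilinear_mult]

lemma locally_moderate_bounded_linear:
  assumes "bounded_linear L" "locally_moderate W w"
  shows "locally_moderate W (\<lambda>\<epsilon> x. L (w \<epsilon> x))"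
  by (rule locally_moderate_bound[OF assms(2), where C = "onorm L"])
    (simp_all add: onorm[OF assms(1)] onorm_pos_le[OF assms(1)])

lemma locally_moderate_continuous:
  assumes "continuous_on W f" shows "locally_moderate W (\<lambda>\<epsilon>. f)"
proof (rule locally_moderateI, goal_cases)
  case x: (1 x)
  have "continuous_on W (\<lambda>y. norm (f y))" using assms by (rule continuous_on_norm)
  then obtain T where "open T" "T \<inter> W = (\<lambda>y. norm (f y)) -` {..<norm (f x) + 1} \<inter> W"
    by (meson continuous_on_open_invariant open_lessThan)
  then have "open T \<and> x \<in> T \<and> (\<forall>\<^sub>F \<epsilon> in at_right (0::real). \<forall>y\<in>T \<inter> W. norm (f y) \<le> (norm (f x) + 1) / \<epsilon> ^ 0)"
    using x by auto
  then show ?case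
    by (intro exI)
qed

lemma locally_moderate_sum:
  assumes "\<And>i. i \<in> I \<Longrightarrow> locally_moderate W (w i)"
  shows "locally_moderate W (\<lambda>\<epsilon> x. \<Sum>i\<in>I. w i \<epsilon> x)"
  using assms
proof (induction I rule: infinite_finite_induct)
  case (insert i I)
  then show ?case by (simp add: locally_moderate_add)
qed (simp_all add: locally_moderate_continuous)

lemma locally_moderate_open_cover:
  assumes "\<And>x. x \<in> W \<Longrightarrow> \<exists>V. open V \<and> x \<in> V \<and> locally_moderate V w"
  shows "locally_moderate W w"
  unfolding locally_moderate_def
proof
  fix x assume "x \<in> W"
  from assms[OF this] obtain V where V: "open V" "x \<in> V" "locally_moderate V w" by blast
  obtain T N where T: "open T" "x \<in> T"
    "bounded_by_power (T \<inter> V) w N"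
    by (rule locally_moderateE[OF V(3,2)])
  have "\<forall>\<^sub>F \<epsilon> in at_right 0. \<forall>y\<in>(T \<inter> V) \<inter> W. norm (w \<epsilon> y) \<le> 1 / \<epsilon> ^ (N :: nat)"
    using T(3) by eventually_elim blast
  with T V show "\<exists>T N. open T \<and> x \<in> T \<and> bounded_by_power (T \<inter> W) w N"
    by (intro exI[of _ "T \<inter> V"] exI[of _ N] conjI open_Int IntI)
qed

text \<open>
  This principle turns local estimates with unspecified exponents and radii into estimates on
  compact sets.
\<close>

lemma compact_locally_induct:
  assumes K: "compact K" and loc: "\<And>x. x \<in> K \<Longrightarrow> \<exists>T. open T \<and> x \<in> T \<and> P T"
    and empty: "P {}" and un: "\<And>S T. P S \<Longrightarrow> P T \<Longrightarrow> P (S \<union> T)"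
    and sub: "\<And>S T. P T \<Longrightarrow> S \<subseteq> T \<Longrightarrow> P S"
  shows "P K"
proof -
  have "\<forall>x\<in>K. \<exists>T. open T \<and> x \<in> T \<and> P T" using loc by blast
  from bchoice[OF this] obtain T where T: "\<And>x. x \<in> K \<Longrightarrow> open (T x) \<and> x \<in> T x \<and> P (T x)" by blast
  obtain F where F: "F \<subseteq> K" "finite F" "K \<subseteq> (\<Union>x\<in>F. T x)"
    by (rule compactE_image[OF K, of K T]) (use T in blast)+
  have "P (\<Union>x\<in>F. T x)" using F(2,1)
  proof (induction F rule: finite_induct)
    case empty
    then show ?case using assms(3) by simp
  next
    case (insert x F)
    then show ?case using un[of "T x" "\<Union>x\<in>F. T x"] T[of x] by simp
  qed
  then show ?thesis using F(3) sub by blast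
qed

lemma locally_moderate_compact:
  assumes "locally_moderate W w" "compact K" "K \<subseteq> W"
  obtains N where "bounded_by_power K w N"
proof -
  define P where "P T \<longleftrightarrow> (\<exists>N. bounded_by_power (T \<inter> W) w N)" for T
  have "P K"
  proof (rule compact_locally_induct[OF assms(2)])
    fix x assume "x \<in> K"
    then have "x \<in> W" using assms(3) by blast
    then obtain T N where "open T" "x \<in> T"
      "bounded_by_power (T \<inter> W) w N"
      by (rule locally_moderateE[OF assms(1)])
    then show "\<exists>T. open T \<and> x \<in> T \<and> P T" unfolding P_def by (intro exI[of _ T] conjI exI[of _ N])
  next
    show "P {}" by (simp add: P_def)
  next
    fix S T assume "P S" "P T"
    then obtain N M where NM: "bounded_by_power (S \<inter> W) w N"
      "bounded_by_power (T \<inter> W) w M"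
      unfolding P_def by blast
    have "\<forall>\<^sub>F \<epsilon> in at_right 0. \<forall>y\<in>(S \<union> T) \<inter> W. norm (w \<epsilon> y) \<le> 1 / \<epsilon> ^ (max N M)"
      using NM eventually_unit_interval
    proof eventually_elim
      case (elim \<epsilon>)
      have "1 / \<epsilon> ^ N \<le> 1 / \<epsilon> ^ max N M" "1 / \<epsilon> ^ M \<le> 1 / \<epsilon> ^ max N M"
        using elim(3) by (auto intro: inverse_power_mono)
      then show ?case using elim(1,2) by (auto intro: order_trans)
    qed
    then show "P (S \<union> T)" unfolding P_def by blast
  next
    fix S T assume "P T" and sub: "S \<subseteq> T"
    then obtain N where "bounded_by_power (T \<inter> W) w N"
      unfolding P_def by blast
    then have "bounded_by_power (S \<inter> W) w N"
      by eventually_elim (use sub in blast)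
    then show "P S" unfolding P_def by (rule exI)
  qed
  moreover have "K \<inter> W = K" using assms(3) by blast
  ultimately show thesis using that unfolding P_def by auto
qed

subsection \<open>Derivatives of nets\<close>

text \<open>
  Smoothness and moderateness are preserved by the same operations for the same reason: the first
  derivative of a sum, a product, a composite or an inverse is composed of the given functions and
  their derivatives by such operations again. One induction on the order of differentiation covers
  both notions, because a smooth map is a moderate net that does not depend on \<open>\<epsilon>\<close>.
\<close>

definition tame_on :: "'e::real_normed_vector set \<Rightarrow> (real \<Rightarrow> 'e \<Rightarrow> 'b::real_normed_vector) \<Rightarrow> bool" where
  "tame_on W w \<longleftrightarrow> locally_moderate W w \<and> (\<forall>\<epsilon>\<in>{0<..1}. \<forall>x\<in>W. w \<epsilon> differentiable (at x))"

primrec Mn_on :: "nat \<Rightarrow> 'e::real_normed_vector set \<Rightarrow> (real \<Rightarrow> 'e \<Rightarrow> 'b::real_normed_vector) \<Rightarrow> bool" where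
  "Mn_on 0 W w \<longleftrightarrow> tame_on W w"
| "Mn_on (Suc n) W w \<longleftrightarrow> tame_on W w \<and> (\<forall>v. Mn_on n W (\<lambda>\<epsilon> x. \<D> (w \<epsilon>) x v))"

definition moderate_on :: "'e::real_normed_vector set \<Rightarrow> (real \<Rightarrow> 'e \<Rightarrow> 'b::real_normed_vector) \<Rightarrow> bool" where
  "moderate_on W w \<longleftrightarrow> (\<forall>\<epsilon>\<in>{0<..1}. smooth_on W (w \<epsilon>)) \<and>
     (\<forall>vs. locally_moderate W (\<lambda>\<epsilon>. iter_deriv vs (w \<epsilon>)))"

lemma Mn_on_tame_on: "Mn_on n W w \<Longrightarrow> tame_on W w"
  by (cases n) auto

lemma Mn_on_lower: "Mn_on (Suc n) W w \<Longrightarrow> Mn_on n W w"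
  by (induction n arbitrary: w) auto

lemma tame_on_differentiable: "tame_on W w \<Longrightarrow> \<epsilon> \<in> {0<..1} \<Longrightarrow> x \<in> W \<Longrightarrow> w \<epsilon> differentiable (at x)"
  by (simp add: tame_on_def)

lemma moderate_on_iff_Mn_on: "moderate_on W w \<longleftrightarrow> (\<forall>n. Mn_on n W w)"
proof -
  have "Mn_on n W w" if "\<forall>vs. tame_on W (\<lambda>\<epsilon>. iter_deriv vs (w \<epsilon>))" for n and w :: "real \<Rightarrow> 'a \<Rightarrow> 'b"
    using that
  proof (induction n arbitrary: w)
    case 0
    from this[THEN spec, of "[]"] show ?case by simp
  next
    case (Suc n)
    have "tame_on W (\<lambda>\<epsilon>. iter_deriv vs (\<lambda>x. \<D> (w \<epsilon>) x v))" for vs v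
      using Suc.prems[THEN spec, of "vs @ [v]"] by (simp add: iter_deriv_append)
    then have "Mn_on n W (\<lambda>\<epsilon> x. \<D> (w \<epsilon>) x v)" for v
      using Suc.IH[of "\<lambda>\<epsilon> x. \<D> (w \<epsilon>) x v"] by blast
    then show ?case using Suc.prems[THEN spec, of "[]"] by simp
  qed
  moreover have "tame_on W (\<lambda>\<epsilon>. iter_deriv vs (w \<epsilon>))" if "\<forall>n. Mn_on n W w" for vs and w :: "real \<Rightarrow> 'a \<Rightarrow> 'b"
    using that
  proof (induction vs arbitrary: w rule: rev_induct)
    case Nil
    from this[THEN spec, of 0] show ?case by simp
  next
    case (snoc v vs)
    have "Mn_on n W (\<lambda>\<epsilon> x. \<D> (w \<epsilon>) x v)" for n
      using snoc.prems[THEN spec, of "Suc n"] by simp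
    then show ?case
      using snoc.IH[of "\<lambda>\<epsilon> x. \<D> (w \<epsilon>) x v"] by (simp add: iter_deriv_append)
  qed
  moreover have "moderate_on W w \<longleftrightarrow> (\<forall>vs. tame_on W (\<lambda>\<epsilon>. iter_deriv vs (w \<epsilon>)))"
    by (auto simp: moderate_on_def tame_on_def smooth_on_def)
  ultimately show ?thesis by auto
qed

lemma Mn_on_cong:
  assumes W: "open W" and "Mn_on n W w" "\<And>\<epsilon> x. \<epsilon> \<in> {0<..1} \<Longrightarrow> x \<in> W \<Longrightarrow> w \<epsilon> x = z \<epsilon> x"
  shows "Mn_on n W z"
  using assms(2,3)
proof (induction n arbitrary: w z)
  case (Suc n)
  have "Mn_on n W (\<lambda>\<epsilon> x. \<D> (z \<epsilon>) x v)" for v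
  proof (rule Suc.IH)
    show "Mn_on n W (\<lambda>\<epsilon> x. \<D> (w \<epsilon>) x v)" using Suc.prems(1) by simp
    show "\<D> (w \<epsilon>) x v = \<D> (z \<epsilon>) x v"
      if "\<epsilon> \<in> {0<..1}" "x \<in> W" for \<epsilon> x
      by (rule fun_cong[OF frechet_derivative_cong_open[OF W that(2) Suc.prems(2)[OF that(1)]]])
  qed
  moreover have "Mn_on n W z" by (rule Suc.IH[OF Mn_on_lower[OF Suc.prems(1)] Suc.prems(2)])
  ultimately show ?case using Mn_on_tame_on by simp
next
  case 0
  have "\<forall>\<^sub>F \<epsilon> in at_right 0. \<forall>x\<in>W. z \<epsilon> x = w \<epsilon> x"
    using eventually_unit_interval by eventually_elim (simp add: 0(2))
  then have "locally_moderate W z"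
    using locally_moderate_cong[of W w z] 0(1) by (simp add: tame_on_def)
  moreover have "z \<epsilon> differentiable (at x)" if "\<epsilon> \<in> {0<..1}" "x \<in> W" for \<epsilon> x
    by (rule differentiable_cong_open[OF W that(2) 0(2)[OF that(1)]])
      (use 0(1) that in \<open>simp_all add: tame_on_def\<close>)
  ultimately show ?case by (simp add: tame_on_def)
qed

lemma Mn_on_SucI:
  assumes "open W" "tame_on W w" "\<And>v. Mn_on n W (z v)"
    "\<And>\<epsilon> x v. \<epsilon> \<in> {0<..1} \<Longrightarrow> x \<in> W \<Longrightarrow> \<D> (w \<epsilon>) x v = z v \<epsilon> x"
  shows "Mn_on (Suc n) W w"
  using Mn_on_cong[OF assms(1,3)] assms(2,4) by simp

lemma Mn_on_const:
  fixes r :: "real \<Rightarrow> 'b::real_normed_vector"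
  shows "locally_moderate W (\<lambda>\<epsilon> x. r \<epsilon>) \<Longrightarrow> Mn_on n W (\<lambda>\<epsilon> x. r \<epsilon>)"
proof (induction n arbitrary: r)
  case (Suc n)
  have "locally_moderate W (\<lambda>\<epsilon> x. 0 :: 'b)" by (simp add: locally_moderate_continuous)
  from Suc.IH[of "\<lambda>_. 0", OF this] Suc.prems show ?case by (simp add: tame_on_def)
qed (simp add: tame_on_def)

lemma tame_on_add: "tame_on W w \<Longrightarrow> tame_on W z \<Longrightarrow> tame_on W (\<lambda>\<epsilon> x. w \<epsilon> x + z \<epsilon> x)"
  by (simp add: tame_on_def locally_moderate_add)

lemma Mn_on_add:
  "open W \<Longrightarrow> Mn_on n W w \<Longrightarrow> Mn_on n W z \<Longrightarrow> Mn_on n W (\<lambda>\<epsilon> x. w \<epsilon> x + z \<epsilon> x)"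
proof (induction n arbitrary: w z)
  case (Suc n)
  show ?case
  proof (rule Mn_on_SucI[where z = "\<lambda>v \<epsilon> x. \<D> (w \<epsilon>) x v + \<D> (z \<epsilon>) x v",
        OF Suc.prems(1) tame_on_add])
    show "Mn_on n W (\<lambda>\<epsilon> x. \<D> (w \<epsilon>) x v + \<D> (z \<epsilon>) x v)" for v
      by (rule Suc.IH) (use Suc.prems in simp_all)
  qed (use Suc.prems in \<open>simp_all add: frechet_derivative_add' tame_on_def\<close>)
qed (simp add: tame_on_add)

lemma tame_on_bilinear:
  "bounded_bilinear pr \<Longrightarrow> tame_on W w \<Longrightarrow> tame_on W z \<Longrightarrow> tame_on W (\<lambda>\<epsilon> x. pr (w \<epsilon> x) (z \<epsilon> x))"
  by (simp add: tame_on_def locally_moderate_bilinear frechet_derivative_bilinear(1))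

lemma Mn_on_bilinear:
  assumes "open W" "bounded_bilinear pr" "Mn_on n W w" "Mn_on n W z"
  shows "Mn_on n W (\<lambda>\<epsilon> x. pr (w \<epsilon> x) (z \<epsilon> x))"
  using assms(3,4)
proof (induction n arbitrary: w z)
  case 0
  then show ?case by (simp add: tame_on_bilinear assms(2))
next
  case (Suc n)
  show ?case
  proof (rule Mn_on_SucI[where z = "\<lambda>v \<epsilon> x. pr (w \<epsilon> x) (\<D> (z \<epsilon>) x v) + pr (\<D> (w \<epsilon>) x v) (z \<epsilon> x)",
        OF assms(1) tame_on_bilinear[OF assms(2)]])
    show "Mn_on n W (\<lambda>\<epsilon> x. pr (w \<epsilon> x) (\<D> (z \<epsilon>) x v) + pr (\<D> (w \<epsilon>) x v) (z \<epsilon> x))" for v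
      by (intro Mn_on_add[OF assms(1)] Suc.IH)
        (use Suc.prems Mn_on_lower[OF Suc.prems(1)] Mn_on_lower[OF Suc.prems(2)] in simp_all)
  qed (use Suc.prems in
      \<open>simp_all add: frechet_derivative_bilinear(2)[OF assms(2)] tame_on_def\<close>)
qed

lemma tame_on_bounded_linear: "bounded_linear L \<Longrightarrow> tame_on W w \<Longrightarrow> tame_on W (\<lambda>\<epsilon> x. L (w \<epsilon> x))"
  by (simp add: tame_on_def locally_moderate_bounded_linear frechet_derivative_bounded_linear_compose(1))

lemma Mn_on_bounded_linear:
  assumes "open W" "bounded_linear L" "Mn_on n W w"
  shows "Mn_on n W (\<lambda>\<epsilon> x. L (w \<epsilon> x))"
  using assms(3)
proof (induction n arbitrary: w)
  case 0
  then show ?case by (simp add: tame_on_bounded_linear assms(2))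
next
  case (Suc n)
  show ?case
  proof (rule Mn_on_SucI[where z = "\<lambda>v \<epsilon> x. L (\<D> (w \<epsilon>) x v)",
        OF assms(1) tame_on_bounded_linear[OF assms(2)]])
    show "Mn_on n W (\<lambda>\<epsilon> x. L (\<D> (w \<epsilon>) x v))" for v
      by (rule Suc.IH) (use Suc.prems in simp)
  qed (use Suc.prems in
      \<open>simp_all add: frechet_derivative_bounded_linear_compose(2)[OF assms(2)] tame_on_def\<close>)
qed

text \<open>
  The derivatives of \<open>1 / w\<close> are polynomials in \<open>1 / w\<close> and the derivatives of \<open>w\<close>, so that beyond
  the moderateness of \<open>w\<close> only \<open>1 / w\<close> itself has to be estimated.
\<close>

lemma Mn_on_inverse:
  fixes w :: "real \<Rightarrow> 'e::real_normed_vector \<Rightarrow> 'k::real_normed_field"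
  assumes W: "open W" and "Mn_on n W w"
    and nz: "\<And>\<epsilon> x. \<epsilon> \<in> {0<..1} \<Longrightarrow> x \<in> W \<Longrightarrow> w \<epsilon> x \<noteq> 0"
    and inv: "locally_moderate W (\<lambda>\<epsilon> x. inverse (w \<epsilon> x))"
  shows "Mn_on n W (\<lambda>\<epsilon> x. inverse (w \<epsilon> x))"
proof -
  have D: "((\<lambda>x. inverse (w \<epsilon> x)) has_derivative
      (\<lambda>v. - (inverse (w \<epsilon> x) * \<D> (w \<epsilon>) x v * inverse (w \<epsilon> x)))) (at x)"
    if "\<epsilon> \<in> {0<..1}" "x \<in> W" for \<epsilon> x
    using nz[OF that] tame_on_differentiable[OF Mn_on_tame_on[OF assms(2)] that]
    by (intro Deriv.has_derivative_inverse) (auto simp: frechet_derivative_works)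
  have tame: "tame_on W (\<lambda>\<epsilon> x. inverse (w \<epsilon> x))"
    using inv D unfolding tame_on_def differentiable_def by blast
  show ?thesis
    using assms(2)
  proof (induction n)
    case 0
    then show ?case using tame by simp
  next
    case (Suc n)
    note i = Suc.IH[OF Mn_on_lower[OF Suc.prems]]
    show ?case
    proof (rule Mn_on_SucI[where z = "\<lambda>v \<epsilon> x. - (inverse (w \<epsilon> x) * \<D> (w \<epsilon>) x v * inverse (w \<epsilon> x))",
        OF W tame])
      show "Mn_on n W (\<lambda>\<epsilon> x. - (inverse (w \<epsilon> x) * \<D> (w \<epsilon>) x v * inverse (w \<epsilon> x)))" for v
        by (intro Mn_on_bounded_linear[OF W bounded_linear_minus[OF bounded_linear_ident]]
            Mn_on_bilinear[OF W bounded_bilinear_mult] i) (use Suc.prems in simp)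
    qed (use frechet_derivative_at[OF D, symmetric] in simp)
  qed
qed

lemma smooth_on_iff_moderate_on: "smooth_on W f \<longleftrightarrow> moderate_on W (\<lambda>\<epsilon>. f)"
proof
  assume "smooth_on W f"
  then show "moderate_on W (\<lambda>\<epsilon>. f)"
    by (simp add: moderate_on_def locally_moderate_continuous smooth_on_continuous_on smooth_on_iter_deriv)
next
  assume "moderate_on W (\<lambda>\<epsilon>. f)"
  moreover have "(1::real) \<in> {0<..1}" by simp
  ultimately show "smooth_on W f" unfolding moderate_on_def by blast
qed

lemma moderate_on_const: "locally_moderate W (\<lambda>\<epsilon> x. r \<epsilon>) \<Longrightarrow> moderate_on W (\<lambda>\<epsilon> x. r \<epsilon>)"
  by (simp add: moderate_on_iff_Mn_on Mn_on_const)

lemma moderate_on_add: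
  "open W \<Longrightarrow> moderate_on W w \<Longrightarrow> moderate_on W z \<Longrightarrow> moderate_on W (\<lambda>\<epsilon> x. w \<epsilon> x + z \<epsilon> x)"
  by (simp add: moderate_on_iff_Mn_on Mn_on_add)

lemma moderate_on_bilinear:
  "open W \<Longrightarrow> bounded_bilinear pr \<Longrightarrow> moderate_on W w \<Longrightarrow> moderate_on W z \<Longrightarrow>
    moderate_on W (\<lambda>\<epsilon> x. pr (w \<epsilon> x) (z \<epsilon> x))"
  by (simp add: moderate_on_iff_Mn_on Mn_on_bilinear)

lemmas moderate_on_mult = moderate_on_bilinear[OF _ bounded_bilinear_mult]

lemma moderate_on_bounded_linear:
  "open W \<Longrightarrow> bounded_linear L \<Longrightarrow> moderate_on W w \<Longrightarrow> moderate_on W (\<lambda>\<epsilon> x. L (w \<epsilon> x))"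
  by (simp add: moderate_on_iff_Mn_on Mn_on_bounded_linear)

lemma moderate_on_inverse:
  fixes w :: "real \<Rightarrow> 'e::real_normed_vector \<Rightarrow> 'k::real_normed_field"
  assumes "open W" "moderate_on W w" "\<And>\<epsilon> x. \<epsilon> \<in> {0<..1} \<Longrightarrow> x \<in> W \<Longrightarrow> w \<epsilon> x \<noteq> 0"
    "locally_moderate W (\<lambda>\<epsilon> x. inverse (w \<epsilon> x))"
  shows "moderate_on W (\<lambda>\<epsilon> x. inverse (w \<epsilon> x))"
  using assms(2) Mn_on_inverse[OF assms(1) _ assms(3,4)] by (simp add: moderate_on_iff_Mn_on)

subsection \<open>Constructions of smooth maps\<close>

lemma smooth_on_const [simp]: "smooth_on W (\<lambda>x. c)"
  by (simp add: smooth_on_iff_moderate_on moderate_on_const locally_moderate_continuous)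

lemma smooth_on_add: "open W \<Longrightarrow> smooth_on W f \<Longrightarrow> smooth_on W g \<Longrightarrow> smooth_on W (\<lambda>x. f x + g x)"
  by (simp add: smooth_on_iff_moderate_on moderate_on_add)

lemma smooth_on_sum:
  assumes "open W" "\<And>i. i \<in> I \<Longrightarrow> smooth_on W (f i)"
  shows "smooth_on W (\<lambda>x. \<Sum>i\<in>I. f i x)"
  using assms(2)
  by (induction I rule: infinite_finite_induct) (auto intro: smooth_on_add[OF assms(1)])

lemma smooth_on_bounded_linear:
  "open W \<Longrightarrow> bounded_linear L \<Longrightarrow> smooth_on W f \<Longrightarrow> smooth_on W (\<lambda>x. L (f x))"
  unfolding smooth_on_iff_moderate_on by (rule moderate_on_bounded_linear)

lemma smooth_on_bilinear:
  "open W \<Longrightarrow> bounded_bilinear pr \<Longrightarrow> smooth_on W f \<Longrightarrow> smooth_on W g \<Longrightarrow>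
    smooth_on W (\<lambda>x. pr (f x) (g x))"
  unfolding smooth_on_iff_moderate_on by (rule moderate_on_bilinear)

lemmas smooth_on_mult = smooth_on_bilinear[OF _ bounded_bilinear_mult]
lemmas smooth_on_inner = smooth_on_bilinear[OF _ bounded_bilinear_inner]

text \<open>
  The direction in which the outer map is differentiated depends on the point. Expanding it in a
  basis leaves finitely many derivatives of the outer map in constant directions, to which the
  induction hypothesis applies.
\<close>

lemma smooth_on_compose:
  fixes f :: "'d::real_normed_vector \<Rightarrow> 'e::{real_inner,heine_borel}"
    and g :: "'e \<Rightarrow> 'b::real_normed_vector"
  assumes W: "open W" and g: "smooth_on V g" and f: "smooth_on W f" and sub: "f ` W \<subseteq> V"
  shows "smooth_on W (\<lambda>x. g (f x))"
proof -
  obtain B :: "'e set" where B: "finite B" "\<And>x. (\<Sum>b\<in>B. (x \<bullet> b) *\<^sub>R b) = x"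
    using finite_orthonormal_basis_exists by blast
  have sums: "Mn_on n W (\<lambda>\<epsilon> x. \<Sum>b\<in>I. F b x)" if "\<And>b. Mn_on n W (\<lambda>\<epsilon>. F b)" for n and I :: "'e set" and F :: "'e \<Rightarrow> 'd \<Rightarrow> 'b"
    using that by (induction I rule: infinite_finite_induct)
      (simp_all add: Mn_on_add[OF W] Mn_on_const locally_moderate_continuous)
  have df: "f differentiable (at x)" if "x \<in> W" for x
    by (rule smooth_on_differentiable[OF f that])
  have "Mn_on n W (\<lambda>\<epsilon> x. g (f x))" if "smooth_on V g" for n and g :: "'e \<Rightarrow> 'b"
    using that
  proof (induction n arbitrary: g)
    case (0 g)
    have "continuous_on W (\<lambda>x. g (f x))"
      by (rule continuous_on_compose2[OF smooth_on_continuous_on[OF 0] smooth_on_continuous_on[OF f] sub])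
    moreover have "(\<lambda>x. g (f x)) differentiable (at x)" if "x \<in> W" for x
      using differentiable_chain_at[OF df[OF that], of g] smooth_on_differentiable[OF 0, of "f x"] sub that
      by (auto simp: o_def)
    ultimately show ?case by (simp add: tame_on_def locally_moderate_continuous)
  next
    case (Suc n g)
    show ?case
    proof (rule Mn_on_SucI[where z = "\<lambda>v \<epsilon> x.
            \<Sum>b\<in>B. (\<D> f x v \<bullet> b) *\<^sub>R \<D> g (f x) b",
          OF W Mn_on_tame_on[OF Suc.IH[OF Suc.prems]] sums])
      show "Mn_on n W (\<lambda>\<epsilon> x. (\<D> f x v \<bullet> b) *\<^sub>R \<D> g (f x) b)" for v b
        using smooth_on_derivative[OF f]
        by (intro Mn_on_bilinear[OF W bounded_bilinear_scaleR]
            Mn_on_bounded_linear[OF W bounded_linear_inner_left] Suc.IH[OF smooth_on_derivative[OF Suc.prems]])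
          (simp add: smooth_on_iff_moderate_on moderate_on_iff_Mn_on)
      show "\<D> (\<lambda>x. g (f x)) x v =
          (\<Sum>b\<in>B. (\<D> f x v \<bullet> b) *\<^sub>R \<D> g (f x) b)" if "x \<in> W" for x v
        by (rule frechet_derivative_compose_basis[OF df[OF that] smooth_on_differentiable[OF Suc.prems] B(2)])
          (use sub that in blast)
    qed
  qed
  from this[OF g] show ?thesis by (simp add: smooth_on_iff_moderate_on moderate_on_iff_Mn_on)
qed

section \<open>Bump functions on manifolds\<close>

text \<open>
  The functions \<open>t\<^sup>-\<^sup>k e\<^sup>-\<^sup>1\<^sup>/\<^sup>t\<close>, extended by zero. The exponent \<open>k\<close> makes the span of the family
  closed under differentiation.
\<close>

definition flat :: "nat \<Rightarrow> real \<Rightarrow> real" where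
  "flat k t = (if t \<le> 0 then 0 else inverse t ^ k * exp (- inverse t))"

lemma flat_tendsto_0: "flat k \<midarrow>0\<rightarrow> 0"
proof -
  have "((\<lambda>s. s ^ k / exp s) \<longlongrightarrow> 0) (at_top :: real filter)"
    by (rule tendsto_power_div_exp_0)
  then have "((\<lambda>t::real. inverse t ^ k / exp (inverse t)) \<longlongrightarrow> 0) (at_right 0)"
    by (rule filterlim_compose) (rule filterlim_inverse_at_top_right)
  then have "(flat k \<longlongrightarrow> 0) (at_right 0)"
    by (rule Lim_transform_eventually)
      (auto simp: flat_def eventually_at_filter exp_minus divide_inverse)
  moreover have "(flat k \<longlongrightarrow> 0) (at_left 0)"
    by (rule Lim_transform_eventually[OF tendsto_const])
      (auto simp: flat_def eventually_at_filter)
  ultimately show ?thesis by (rule filterlim_split_at[rotated])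
qed

lemma flat_has_real_derivative:
  "(flat k has_real_derivative (flat (k + 2) t - real k * flat (k + 1) t)) (at t)"
proof -
  consider "t < 0" | "t = 0" | "t > 0" by linarith
  then show ?thesis
  proof cases
    case 1
    have "((\<lambda>t. 0) has_real_derivative 0) (at t)" by simp
    then have "(flat k has_real_derivative 0) (at t)"
      by (rule has_field_derivative_transform_within_open[where S = "{..<0}"])
        (use 1 in \<open>auto simp: flat_def\<close>)
    then show ?thesis using 1 by (simp add: flat_def)
  next
    case 2
    \<comment> \<open>The difference quotient of \<open>flat k\<close> at \<open>0\<close> is \<open>flat (k + 1)\<close>.\<close>
    have "(\<lambda>h. (flat k (0 + h) - flat k 0) / h) \<midarrow>0\<rightarrow> 0"
      by (rule Lim_transform_eventually[OF flat_tendsto_0[of "k + 1"]])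
        (auto simp: flat_def eventually_at_filter divide_inverse)
    then show ?thesis using 2 by (simp add: DERIV_def flat_def)
  next
    case 3
    have "((\<lambda>t. inverse t ^ k * exp (- inverse t)) has_real_derivative
        real k * inverse t ^ (k - 1) * (- (inverse t)\<^sup>2) * exp (- inverse t) +
        inverse t ^ k * (exp (- inverse t) * (inverse t)\<^sup>2)) (at t)"
      using 3 by (auto intro!: derivative_eq_intros simp: power2_eq_square)
    also have "real k * inverse t ^ (k - 1) * (- (inverse t)\<^sup>2) * exp (- inverse t) +
        inverse t ^ k * (exp (- inverse t) * (inverse t)\<^sup>2) = flat (k + 2) t - real k * flat (k + 1) t"
      using 3 by (cases k) (auto simp: flat_def power2_eq_square)
    finally have "((\<lambda>t. inverse t ^ k * exp (- inverse t)) has_real_derivative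
        (flat (k + 2) t - real k * flat (k + 1) t)) (at t)" .
    then show ?thesis
      by (rule has_field_derivative_transform_within_open[where S = "{0<..}"])
        (use 3 in \<open>auto simp: flat_def\<close>)
  qed
qed

lemma Mn_on_flat: "Mn_on n UNIV (\<lambda>\<epsilon>. flat k)"
proof (induction n arbitrary: k)
  case 0
  have "continuous_on UNIV (flat k)"
    using flat_has_real_derivative DERIV_isCont by (blast intro: continuous_at_imp_continuous_on)
  moreover have "flat k differentiable (at t)" for t
    using flat_has_real_derivative real_differentiable_def by blast
  ultimately show ?case by (simp add: tame_on_def locally_moderate_continuous)
next
  case (Suc n)
  show ?case
  proof (rule Mn_on_SucI[where z = "\<lambda>v \<epsilon> t. (flat (k + 2) t + (- real k) * flat (k + 1) t) * v",
        OF open_UNIV Mn_on_tame_on[OF Suc.IH]])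
    show "Mn_on n UNIV (\<lambda>\<epsilon> t. (flat (k + 2) t + (- real k) * flat (k + 1) t) * v)" for v
      by (intro Mn_on_bounded_linear[OF open_UNIV bounded_linear_mult_left] Mn_on_add[OF open_UNIV] Suc.IH
          Mn_on_bounded_linear[OF open_UNIV bounded_linear_mult_right])
    show "\<D> (flat k) t v = (flat (k + 2) t + (- real k) * flat (k + 1) t) * v" for t v
      using frechet_derivative_at[OF flat_has_real_derivative[of k t, unfolded has_field_derivative_def]]
      by (metis (no_types) add_uminus_conv_diff mult_minus_left)
  qed
qed

lemma smooth_on_flat: "smooth_on W (flat k)"
  by (rule smooth_on_subset[OF _ subset_UNIV])
    (simp add: smooth_on_iff_moderate_on moderate_on_iff_Mn_on Mn_on_flat)

locale smooth_manifold =
  fixes A :: "('a::t2_space, 'e::{real_inner,heine_borel}) chart set"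
  assumes atlas: "smooth_atlas A"
begin

lemma chart_exists: obtains U \<phi> where "(U, \<phi>) \<in> A" "p \<in> U"
proof -
  have "p \<in> (\<Union>(U, \<phi>)\<in>A. U)" using atlas by (simp add: smooth_atlas_def)
  then show thesis using that by blast
qed

lemma chart:
  assumes "(U, \<phi>) \<in> A"
  shows chart_open: "open U" and chart_image_open: "open (\<phi> ` U)"
    and chart_homeomorphism: "homeomorphism U (\<phi> ` U) \<phi> (inv_into U \<phi>)"
  using bspec[OF conjunct1[OF conjunct2[OF atlas[unfolded smooth_atlas_def]]] assms] by auto

lemma chart_inverse: "(U, \<phi>) \<in> A \<Longrightarrow> p \<in> U \<Longrightarrow> inv_into U \<phi> (\<phi> p) = p"
  using chart_homeomorphism by (auto simp: homeomorphism_def)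

lemma chart_inverse_mem: "x \<in> \<phi> ` U \<Longrightarrow> inv_into U \<phi> x \<in> U"
  by (rule inv_into_into)

lemma chart_inverse_right: "x \<in> \<phi> ` U \<Longrightarrow> \<phi> (inv_into U \<phi> x) = x"
  by (rule f_inv_into_f)

lemma chart_continuous_on: "(U, \<phi>) \<in> A \<Longrightarrow> continuous_on U \<phi>"
  using chart_homeomorphism by (auto simp: homeomorphism_def)

lemma chart_inverse_continuous_on: "(U, \<phi>) \<in> A \<Longrightarrow> continuous_on (\<phi> ` U) (inv_into U \<phi>)"
  using chart_homeomorphism by (auto simp: homeomorphism_def)

lemma open_chart_image:
  assumes c: "(U, \<phi>) \<in> A" and V: "open V" "V \<subseteq> U"
  shows "open (\<phi> ` V)"
proof -
  have "openin (top_of_set (\<phi> ` U)) (\<phi> ` V)"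
    by (rule homeomorphism_imp_open_map[OF chart_homeomorphism[OF c]])
      (use V in \<open>auto simp: openin_open\<close>)
  then show ?thesis using chart_image_open[OF c] openin_open_eq by blast
qed

lemma open_chart_preimage:
  assumes c: "(U, \<phi>) \<in> A" and V: "open V" "V \<subseteq> \<phi> ` U"
  shows "open (inv_into U \<phi> ` V)"
proof -
  have "openin (top_of_set U) (inv_into U \<phi> ` V)"
    by (rule homeomorphism_imp_open_map[OF homeomorphism_symD[OF chart_homeomorphism[OF c]]])
      (use V in \<open>auto simp: openin_open\<close>)
  then show ?thesis using chart_open[OF c] openin_open_eq by blast
qed

lemma compact_chart_preimage:
  assumes c: "(U, \<phi>) \<in> A" and "compact K" "K \<subseteq> \<phi> ` U"
  shows "compact (inv_into U \<phi> ` K)"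
  using assms by (meson chart_inverse_continuous_on compact_continuous_image continuous_on_subset)

lemma mem_chart_preimage_iff:
  assumes "(U, \<phi>) \<in> A" "V \<subseteq> \<phi> ` U"
  shows "p \<in> inv_into U \<phi> ` V \<longleftrightarrow> p \<in> U \<and> \<phi> p \<in> V"
proof
  assume "p \<in> inv_into U \<phi> ` V"
  then obtain x where "x \<in> V" "p = inv_into U \<phi> x" by auto
  then show "p \<in> U \<and> \<phi> p \<in> V"
    using assms(2) chart_inverse_mem chart_inverse_right by (metis subsetD)
next
  assume "p \<in> U \<and> \<phi> p \<in> V"
  then show "p \<in> inv_into U \<phi> ` V" using chart_inverse[OF assms(1)] by (metis imageI)
qed

lemma transition_smooth:
  assumes "(U, \<phi>) \<in> A" "(V, \<psi>) \<in> A"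
  shows "smooth_on (\<phi> ` (U \<inter> V)) (\<psi> \<circ> inv_into U \<phi>)"
  using bspec[OF bspec[OF conjunct2[OF conjunct2[OF atlas[unfolded smooth_atlas_def]]] assms(1),
        unfolded split_conv] assms(2)] by auto

lemma chart_cball:
  assumes c: "(U, \<phi>) \<in> A" and V: "open V" "p \<in> U" "p \<in> V"
  obtains r where "0 < r" "cball (\<phi> p) r \<subseteq> \<phi> ` (U \<inter> V)"
proof -
  have "open (\<phi> ` (U \<inter> V))"
    using open_chart_image[OF c, of "U \<inter> V"] chart_open[OF c] V(1) by auto
  then show thesis using that V by (metis IntI imageI open_contains_cball)
qed

lemma smooth_functionsD:
  "f \<in> smooth_functions A \<Longrightarrow> (U, \<phi>) \<in> A \<Longrightarrow> smooth_on (\<phi> ` U) (f \<circ> inv_into U \<phi>)"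
  by (auto simp: smooth_functions_def)

lemma smooth_functionsI:
  "(\<And>U \<phi>. (U, \<phi>) \<in> A \<Longrightarrow> smooth_on (\<phi> ` U) (f \<circ> inv_into U \<phi>)) \<Longrightarrow> f \<in> smooth_functions A"
  by (auto simp: smooth_functions_def)

lemma continuous_on_chart_compose:
  assumes c: "(U, \<phi>) \<in> A" and "continuous_on (\<phi> ` U) g"
  shows "continuous_on U (\<lambda>p. g (\<phi> p))"
  by (rule continuous_on_compose2[OF assms(2) chart_continuous_on[OF c]]) auto

lemma smooth_function_continuous:
  assumes "f \<in> smooth_functions A" shows "continuous_on UNIV f"
proof -
  have "isCont f p" for p
  proof -
    obtain U \<phi> where c: "(U, \<phi>) \<in> A" "p \<in> U" by (rule chart_exists)
    have "continuous_on U (\<lambda>p. (f \<circ> inv_into U \<phi>) (\<phi> p))"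
      using smooth_functionsD[OF assms c(1)]
      by (intro continuous_on_chart_compose[OF c(1)] smooth_on_continuous_on)
    then have "continuous_on U f"
      by (rule continuous_on_eq) (simp add: chart_inverse[OF c(1)])
    then show ?thesis using c chart_open continuous_on_eq_continuous_at by blast
  qed
  then show ?thesis by (simp add: continuous_at_imp_continuous_on)
qed

text \<open>
  Cutoff constructions on a chart domain \<open>U\<close> are smooth in every chart for this reason: the domain of
  the chart is covered by the open sets \<open>V \<inter> U\<close>, where a smooth formula applies, and \<open>V - C\<close>.
\<close>

lemma smooth_on_zero_extension:
  assumes c: "(V, \<psi>) \<in> A" and "open U" "closed C" "C \<subseteq> U"
    and g: "smooth_on (\<psi> ` (V \<inter> U)) g" "\<And>p. p \<in> V - C \<Longrightarrow> g (\<psi> p) = 0"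
  shows "smooth_on (\<psi> ` V) g"
proof -
  have "open (\<psi> ` (V - C))"
    using assms(3) chart_open[OF c] by (intro open_chart_image[OF c]) auto
  then have "smooth_on (\<psi> ` (V - C)) g"
    by (rule smooth_on_cong_open[where f = "\<lambda>_. 0"]) (use g(2) in auto)
  moreover have "\<psi> ` V = \<psi> ` (V \<inter> U) \<union> \<psi> ` (V - C)" using assms(4) by auto
  ultimately show ?thesis using smooth_on_Un[OF g(1)] by simp
qed

text \<open>
  In a chart the bump function is \<open>flat 0 (r\<^sup>2 - \<bar>x - x\<^sub>0\<bar>\<^sup>2)\<close>, which is positive exactly on a ball.
\<close>

lemma bump_function_exists:
  assumes V: "open V" "p \<in> V"
  obtains \<beta> :: "'a \<Rightarrow> real" and C where "\<beta> \<in> smooth_functions A" "\<And>q. 0 \<le> \<beta> q" "0 < \<beta> p"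
    "compact C" "C \<subseteq> V" "\<And>q. q \<notin> C \<Longrightarrow> \<beta> q = 0"
proof -
  obtain U \<phi> where c: "(U, \<phi>) \<in> A" "p \<in> U" by (rule chart_exists)
  obtain r where r: "0 < r" "cball (\<phi> p) r \<subseteq> \<phi> ` (U \<inter> V)"
    using chart_cball[OF c(1) V(1) c(2) V(2)] .
  define \<beta> where "\<beta> q = (if q \<in> U then flat 0 (r\<^sup>2 - (\<phi> q - \<phi> p) \<bullet> (\<phi> q - \<phi> p)) else 0)" for q
  define C where "C = inv_into U \<phi> ` cball (\<phi> p) r"
  have rU: "cball (\<phi> p) r \<subseteq> \<phi> ` U" using r(2) by auto
  have C: "compact C" using compact_chart_preimage[OF c(1) _ rU] by (simp add: C_def)
  have CV: "C \<subseteq> U \<inter> V"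
    using r(2) chart_inverse[OF c(1)] by (auto simp: C_def)
  have zero: "\<beta> q = 0" if "q \<notin> C" for q
  proof (cases "q \<in> U")
    case True
    then have "r < norm (\<phi> q - \<phi> p)"
      using that mem_chart_preimage_iff[OF c(1) rU] by (auto simp: C_def dist_norm norm_minus_commute)
    then have "r\<^sup>2 < (norm (\<phi> q - \<phi> p))\<^sup>2" using r(1) by (intro power_strict_mono) auto
    then show ?thesis by (simp add: \<beta>_def flat_def power2_norm_eq_inner)
  qed (simp add: \<beta>_def)
  have "smooth_on (\<psi> ` W) (\<beta> \<circ> inv_into W \<psi>)" if d: "(W, \<psi>) \<in> A" for W \<psi>
  proof (rule smooth_on_zero_extension[OF d chart_open[OF c(1)] compact_imp_closed[OF C]])
    show "C \<subseteq> U" using CV by auto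
    show "(\<beta> \<circ> inv_into W \<psi>) (\<psi> q) = 0" if "q \<in> W - C" for q
      using that zero by (simp add: chart_inverse[OF d])
    have op: "open (\<psi> ` (W \<inter> U))"
      using chart_open[OF d] chart_open[OF c(1)] by (intro open_chart_image[OF d]) auto
    define \<tau> where "\<tau> = \<phi> \<circ> inv_into W \<psi>"
    have d\<tau>: "smooth_on (\<psi> ` (W \<inter> U)) (\<lambda>x. \<tau> x + - \<phi> p)"
      using transition_smooth[OF d c(1)] op by (intro smooth_on_add) (auto simp: \<tau>_def o_def)
    have "smooth_on (\<psi> ` (W \<inter> U)) (\<lambda>x. flat 0 (r\<^sup>2 + - ((\<tau> x + - \<phi> p) \<bullet> (\<tau> x + - \<phi> p))))"
      by (intro smooth_on_compose[OF op smooth_on_flat[of UNIV]] smooth_on_add[OF op] smooth_on_const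
          smooth_on_bounded_linear[OF op bounded_linear_minus[OF bounded_linear_ident]]
          smooth_on_inner[OF op] d\<tau> subset_UNIV)
    then show "smooth_on (\<psi> ` (W \<inter> U)) (\<beta> \<circ> inv_into W \<psi>)"
      by (rule smooth_on_cong_open[OF op, rotated])
        (auto simp: \<beta>_def \<tau>_def chart_inverse[OF d])
  qed
  then have "\<beta> \<in> smooth_functions A" by (rule smooth_functionsI)
  moreover have "0 \<le> \<beta> q" for q by (simp add: \<beta>_def flat_def)
  moreover have "0 < \<beta> p" using c r by (simp add: \<beta>_def flat_def)
  ultimately show thesis using that C CV zero by auto
qed

end

section \<open>Existence of Riemannian metrics\<close>

lemma locally_finite_compact:
  assumes "locally_finite_in euclidean \<W>" "compact K"
  shows "finite {W \<in> \<W>. W \<inter> K \<noteq> {}}"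
proof -
  have "\<forall>x. \<exists>V. open V \<and> x \<in> V \<and> finite {U \<in> \<W>. U \<inter> V \<noteq> {}}"
    using assms(1) by (simp add: locally_finite_in_def)
  from choice[OF this] obtain V
    where V: "\<And>x. open (V x)" "\<And>x. x \<in> V x" "\<And>x. finite {U \<in> \<W>. U \<inter> V x \<noteq> {}}"
    by blast
  obtain F where F: "finite F" "K \<subseteq> (\<Union>x\<in>F. V x)"
    by (rule compactE_image[OF assms(2), of UNIV V]) (use V in blast)+
  have "{W \<in> \<W>. W \<inter> K \<noteq> {}} \<subseteq> (\<Union>x\<in>F. {U \<in> \<W>. U \<inter> V x \<noteq> {}})"
    using F(2) by blast
  then show ?thesis by (rule finite_subset) (use F(1) V(3) in blast)
qed

lemma paracompact_refinement:
  assumes "paracompact_space (euclidean :: 'a::topological_space topology)"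
    and "\<And>U. U \<in> \<U> \<Longrightarrow> open U" "\<And>x. \<exists>U\<in>\<U>. x \<in> (U :: 'a set)"
  obtains \<V> where "\<And>V. V \<in> \<V> \<Longrightarrow> open V" "\<And>x. \<exists>V\<in>\<V>. x \<in> V"
    "\<And>V. V \<in> \<V> \<Longrightarrow> \<exists>U\<in>\<U>. V \<subseteq> U" "locally_finite_in euclidean \<V>"
proof -
  have "(\<forall>U\<in>\<U>. openin euclidean U) \<and> \<Union>\<U> = topspace euclidean"
    using assms(2,3) by (auto simp: open_openin[symmetric])
  from assms(1)[unfolded paracompact_space_def, THEN spec, THEN mp, OF this] obtain \<V>
    where "\<forall>V\<in>\<V>. openin euclidean V" "\<Union>\<V> = topspace euclidean"
      "\<forall>V\<in>\<V>. \<exists>U\<in>\<U>. V \<subseteq> U" "locally_finite_in euclidean \<V>"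
    by (elim exE conjE)
  then show thesis by (intro that[of \<V>]) auto
qed

context smooth_manifold
begin

lemma open_positive: 
  assumes "\<beta> \<in> smooth_functions A" shows "open {q. 0 < (\<beta> q :: real)}"
  using smooth_function_continuous[OF assms] by (intro open_Collect_less) auto

text \<open>
  A partition of unity up to normalization. The supports of the bump functions around all points
  need not be locally finite, even after passing to a refinement of the cover by the sets where
  they are positive. Therefore two refinements are used: the supports are chosen inside the
  members \<open>V\<close> of a first locally finite cover by relatively compact sets, and of the second
  cover only finitely many members are assigned to each \<open>V\<close>.
\<close>

lemma locally_finite_bump_functions:
  assumes "paracompact_space (euclidean :: 'a topology)"
  obtains \<W> :: "'a set set" and \<beta> c C where
    "\<And>W. W \<in> \<W> \<Longrightarrow> c W \<in> A"
    "\<And>W. W \<in> \<W> \<Longrightarrow> \<beta> W \<in> smooth_functions A"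
    "\<And>W q. W \<in> \<W> \<Longrightarrow> 0 \<le> (\<beta> W q :: real)"
    "\<And>W. W \<in> \<W> \<Longrightarrow> compact (C W)"
    "\<And>W. W \<in> \<W> \<Longrightarrow> C W \<subseteq> fst (c W)"
    "\<And>W q. W \<in> \<W> \<Longrightarrow> q \<notin> C W \<Longrightarrow> \<beta> W q = 0"
    "\<And>p. \<exists>W\<in>\<W>. 0 < \<beta> W p"
    "\<And>p. \<exists>N. open N \<and> p \<in> N \<and> finite {W \<in> \<W>. \<exists>q\<in>N. \<beta> W q \<noteq> 0}"
proof -
  define small where "small V \<longleftrightarrow> (\<exists>c\<in>A. V \<subseteq> fst c) \<and> (\<exists>K. compact K \<and> V \<subseteq> K)" for V :: "'a set"
  have "\<exists>V\<in>{V. open V \<and> small V}. p \<in> V" for p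
  proof -
    obtain U \<phi> where c: "(U, \<phi>) \<in> A" "p \<in> U" by (rule chart_exists)
    obtain \<beta> :: "'a \<Rightarrow> real" and C where \<beta>: "\<beta> \<in> smooth_functions A" "\<And>q. 0 \<le> \<beta> q" "0 < \<beta> p"
      "compact C" "C \<subseteq> U" "\<And>q. q \<notin> C \<Longrightarrow> \<beta> q = 0"
      by (rule bump_function_exists[OF chart_open[OF c(1)] c(2)]) blast
    have sub: "{q. 0 < \<beta> q} \<subseteq> C" using \<beta>(6) by force
    then have "small {q. 0 < \<beta> q}"
      using c(1) \<beta>(4,5) unfolding small_def by force
    then show ?thesis
      using open_positive[OF \<beta>(1)] \<beta>(3) by (intro bexI[of _ "{q. 0 < \<beta> q}"]) simp_all
  qed
  then obtain \<V> where \<V>: "\<And>V. V \<in> \<V> \<Longrightarrow> open V" "\<And>x. \<exists>V\<in>\<V>. x \<in> V"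
    "\<And>V. V \<in> \<V> \<Longrightarrow> \<exists>U\<in>{V. open V \<and> small V}. V \<subseteq> U" "locally_finite_in euclidean \<V>"
    by (rule paracompact_refinement[OF assms, rotated]) auto
  have "\<exists>c K. c \<in> A \<and> V \<subseteq> fst c \<and> compact K \<and> V \<subseteq> K" if V: "V \<in> \<V>" for V
  proof -
    obtain U where "small U" "V \<subseteq> U" using \<V>(3)[OF V] by auto
    then show ?thesis unfolding small_def by (meson order_trans)
  qed
  then obtain cV KV where cV: "\<And>V. V \<in> \<V> \<Longrightarrow> cV V \<in> A \<and> V \<subseteq> fst (cV V) \<and> compact (KV V) \<and> V \<subseteq> KV V"
    by metis
  define bump where "bump \<beta> C V W \<longleftrightarrow> \<beta> \<in> smooth_functions A \<and> (\<forall>q. 0 \<le> (\<beta> q :: real)) \<and> compact C \<and>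
    C \<subseteq> V \<and> (\<forall>q. q \<notin> C \<longrightarrow> \<beta> q = 0) \<and> (\<forall>q\<in>W. 0 < \<beta> q)" for \<beta> C V W
  have "\<exists>W\<in>{W. open W \<and> (\<exists>V\<in>\<V>. \<exists>\<beta> C. bump \<beta> C V W)}. p \<in> W" for p
  proof -
    obtain V where V: "V \<in> \<V>" "p \<in> V" using \<V>(2) by blast
    obtain \<beta> :: "'a \<Rightarrow> real" and C where \<beta>: "\<beta> \<in> smooth_functions A" "\<And>q. 0 \<le> \<beta> q" "0 < \<beta> p"
      "compact C" "C \<subseteq> V" "\<And>q. q \<notin> C \<Longrightarrow> \<beta> q = 0"
      by (rule bump_function_exists[OF \<V>(1)[OF V(1)] V(2)]) blast
    then have "bump \<beta> C V {q. 0 < \<beta> q}" by (auto simp: bump_def)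
    with V(1) have "\<exists>V\<in>\<V>. \<exists>\<beta>' C. bump \<beta>' C V {q. 0 < \<beta> q}" by blast
    then show ?thesis
      using open_positive[OF \<beta>(1)] \<beta>(3) by (intro bexI[of _ "{q. 0 < \<beta> q}"]) simp_all
  qed
  then obtain \<W> where \<W>: "\<And>x. \<exists>V\<in>\<W>. x \<in> V"
    "\<And>W. W \<in> \<W> \<Longrightarrow> \<exists>U\<in>{W. open W \<and> (\<exists>V\<in>\<V>. \<exists>\<beta> C. bump \<beta> C V W)}. W \<subseteq> U"
    "locally_finite_in euclidean \<W>"
    by (rule paracompact_refinement[OF assms, rotated]) auto
  have "\<exists>V \<beta> C. V \<in> \<V> \<and> bump \<beta> C V W" if W: "W \<in> \<W>" for W
  proof -
    obtain U V \<beta> C where "V \<in> \<V>" "bump \<beta> C V U" "W \<subseteq> U" using \<W>(2)[OF W] by blast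
    then have "bump \<beta> C V W" unfolding bump_def by blast
    then show ?thesis using \<open>V \<in> \<V>\<close> by blast
  qed
  then obtain v \<beta> C where v: "\<And>W. W \<in> \<W> \<Longrightarrow> v W \<in> \<V>"
    and b: "\<And>W. W \<in> \<W> \<Longrightarrow> bump (\<beta> W) (C W) (v W) W" by metis
  have sub: "W \<subseteq> v W" if "W \<in> \<W>" for W
    using b[OF that] unfolding bump_def by (metis less_irrefl subsetD subsetI)
  define \<W>' where "\<W>' = \<W> - {{}}"
  have fin: "finite {W \<in> \<W>'. v W = V}" if V: "V \<in> \<V>" for V
  proof (rule finite_subset)
    show "{W \<in> \<W>'. v W = V} \<subseteq> {W \<in> \<W>. W \<inter> KV V \<noteq> {}}"
      using sub cV[OF V] unfolding \<W>'_def by blast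
    show "finite {W \<in> \<W>. W \<inter> KV V \<noteq> {}}"
      using locally_finite_compact[OF \<W>(3)] cV[OF V] by blast
  qed
  have "\<exists>N. open N \<and> p \<in> N \<and> finite {W \<in> \<W>'. \<exists>q\<in>N. \<beta> W q \<noteq> 0}" for p
  proof -
    obtain N where N: "open N" "p \<in> N" "finite {V \<in> \<V>. V \<inter> N \<noteq> {}}"
      using \<V>(4) by (auto simp: locally_finite_in_def)
    have "{W \<in> \<W>'. \<exists>q\<in>N. \<beta> W q \<noteq> 0} \<subseteq> (\<Union>V\<in>{V \<in> \<V>. V \<inter> N \<noteq> {}}. {W \<in> \<W>'. v W = V})"
    proof
      fix W assume "W \<in> {W \<in> \<W>'. \<exists>q\<in>N. \<beta> W q \<noteq> 0}"
      then obtain q where q: "W \<in> \<W>'" "q \<in> N" "\<beta> W q \<noteq> 0" by blast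
      then have "q \<in> v W" using b[of W] unfolding bump_def \<W>'_def by blast
      then show "W \<in> (\<Union>V\<in>{V \<in> \<V>. V \<inter> N \<noteq> {}}. {W \<in> \<W>'. v W = V})"
        using q v[of W] unfolding \<W>'_def by blast
    qed
    moreover have "finite (\<Union>V\<in>{V \<in> \<V>. V \<inter> N \<noteq> {}}. {W \<in> \<W>'. v W = V})"
      using N(3) fin by blast
    ultimately have "finite {W \<in> \<W>'. \<exists>q\<in>N. \<beta> W q \<noteq> 0}" by (rule finite_subset)
    then show ?thesis using N(1,2) by blast
  qed
  moreover have "\<exists>W\<in>\<W>'. 0 < \<beta> W p" for p
  proof -
    obtain W where "W \<in> \<W>" "p \<in> W" using \<W>(1) by blast
    then show ?thesis using b[of W] unfolding bump_def \<W>'_def by blast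
  qed
  moreover have "cV (v W) \<in> A" "C W \<subseteq> fst (cV (v W))" "\<beta> W \<in> smooth_functions A" "0 \<le> \<beta> W q"
    "compact (C W)" "q \<notin> C W \<Longrightarrow> \<beta> W q = 0" if "W \<in> \<W>'" for W q
    using b[of W] v[of W] cV[of "v W"] that unfolding bump_def \<W>'_def by blast+
  ultimately show thesis using that[of \<W>' "\<lambda>W. cV (v W)" \<beta> C] by blast
qed

lemma transition_differentiable:
  assumes "(U, \<phi>) \<in> A" "(V, \<psi>) \<in> A" "p \<in> U" "p \<in> V"
  shows "(\<psi> \<circ> inv_into U \<phi>) differentiable (at (\<phi> p))"
  using smooth_on_differentiable[OF transition_smooth[OF assms(1,2)]] assms(3,4) by blast

lemma transition_derivative_chain:
  assumes c: "(U, \<phi>) \<in> A" "(V, \<psi>) \<in> A" "(W, \<theta>) \<in> A" and p: "p \<in> U" "p \<in> V" "p \<in> W"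
  shows "\<D> (\<theta> \<circ> inv_into U \<phi>) (\<phi> p) v =
    \<D> (\<theta> \<circ> inv_into V \<psi>) (\<psi> p) (\<D> (\<psi> \<circ> inv_into U \<phi>) (\<phi> p) v)"
proof -
  have op: "open (\<phi> ` (U \<inter> V))"
    using chart_open c by (intro open_chart_image[OF c(1)]) auto
  have inv: "(\<psi> \<circ> inv_into U \<phi>) (\<phi> p) = \<psi> p" using p chart_inverse[OF c(1)] by simp
  have "\<D> (\<theta> \<circ> inv_into U \<phi>) (\<phi> p) =
      \<D> ((\<theta> \<circ> inv_into V \<psi>) \<circ> (\<psi> \<circ> inv_into U \<phi>)) (\<phi> p)"
    by (rule frechet_derivative_cong_open[OF op])
      (use p chart_inverse[OF c(1)] chart_inverse[OF c(2)] in auto)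
  also have "\<dots> = \<D> (\<theta> \<circ> inv_into V \<psi>) (\<psi> p) \<circ> \<D> (\<psi> \<circ> inv_into U \<phi>) (\<phi> p)"
    using frechet_derivative_compose[of "\<psi> \<circ> inv_into U \<phi>" "\<phi> p" "\<theta> \<circ> inv_into V \<psi>", unfolded inv]
      transition_differentiable[OF c(1,2) p(1,2)] transition_differentiable[OF c(2,3) p(2,3)] by blast
  finally show ?thesis by simp
qed

text \<open>
  This makes the derivative of a change of charts injective, which makes the pullback of an inner
  product positive definite.
\<close>

lemma transition_derivative_inverse:
  assumes c: "(U, \<phi>) \<in> A" "(V, \<psi>) \<in> A" and p: "p \<in> U" "p \<in> V"
  shows "\<D> (\<phi> \<circ> inv_into V \<psi>) (\<psi> p) (\<D> (\<psi> \<circ> inv_into U \<phi>) (\<phi> p) v) = v"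
proof -
  have "\<D> (\<phi> \<circ> inv_into U \<phi>) (\<phi> p) = \<D> (\<lambda>x. x) (\<phi> p)"
    by (rule frechet_derivative_cong_open[OF chart_image_open[OF c(1)]])
      (use p in \<open>auto simp: chart_inverse[OF c(1)]\<close>)
  then show ?thesis
    using transition_derivative_chain[OF c(1,2,1) p p(1), of v] by simp
qed

text \<open>
  The metric is \<open>\<Sum>\<^sub>W \<beta>\<^sub>W \<theta>\<^sub>W\<^sup>*\<langle>_, _\<rangle>\<close>, a locally finite sum of pullbacks of the inner product of the
  model space under charts \<open>\<theta>\<^sub>W\<close>. It is positive definite because the \<open>\<beta>\<^sub>W\<close> are nonnegative and one of
  them is positive at the given point. In a chart \<open>(U, \<phi>)\<close> the differential of \<open>\<theta>\<^sub>W\<close> is the derivative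
  of the transition map \<open>\<theta>\<^sub>W \<circ> \<phi>\<^sup>-\<^sup>1\<close>, and the transformation law is the chain rule.
\<close>

lemma riemannian_metric_exists:
  assumes "paracompact_space (euclidean :: 'a topology)"
  obtains h where "riemannian_metric A h"
proof -
  obtain \<W> :: "'a set set" and \<beta> c C where
    c: "\<And>W. W \<in> \<W> \<Longrightarrow> c W \<in> A" and
    \<beta>: "\<And>W. W \<in> \<W> \<Longrightarrow> \<beta> W \<in> smooth_functions A"
    "\<And>W q. W \<in> \<W> \<Longrightarrow> 0 \<le> (\<beta> W q :: real)" and
    C: "\<And>W. W \<in> \<W> \<Longrightarrow> compact (C W)"
    "\<And>W. W \<in> \<W> \<Longrightarrow> C W \<subseteq> fst (c W)" and
    zero: "\<And>W q. W \<in> \<W> \<Longrightarrow> q \<notin> C W \<Longrightarrow> \<beta> W q = 0" and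
    pos: "\<And>p. \<exists>W\<in>\<W>. 0 < \<beta> W p" and
    fin: "\<And>p. \<exists>N. open N \<and> p \<in> N \<and> finite {W \<in> \<W>. \<exists>q\<in>N. \<beta> W q \<noteq> 0}"
    by (rule locally_finite_bump_functions[OF assms]) blast
  define T where "T W p = {W \<in> \<W>. \<beta> W p \<noteq> 0}" for W :: "'a set" and p
  define S where "S p = {W \<in> \<W>. \<beta> W p \<noteq> 0}" for p
  have finS: "finite (S p)" for p
    using fin[of p] by (auto simp: S_def elim!: rev_finite_subset)
  have mem: "p \<in> fst (c W)" if "W \<in> S p" for W p
    using that zero C(2) unfolding S_def by blast
  have SA: "(fst (c W), snd (c W)) \<in> A" if "W \<in> S p" for W p
    using that c by (simp add: S_def)
  define D where "D W d p = \<D> (snd (c W) \<circ> inv_into (fst d) (snd d)) (snd d p)"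
    for W and d :: "('a, 'e) chart" and p
  define h where "h d p v w = (\<Sum>W\<in>S p. \<beta> W p * (D W d p v \<bullet> D W d p w))" for d p v w
  have lin: "linear (D W (U, \<phi>) p)" if "(U, \<phi>) \<in> A" "p \<in> U" "W \<in> S p" for W U \<phi> p
    using transition_differentiable[OF that(1) SA[OF that(3)] that(2) mem[OF that(3)]]
    by (simp add: D_def linear_frechet_derivative)
  have bil: "bilinear (h (U, \<phi>) p)" if "(U, \<phi>) \<in> A" "p \<in> U" for U \<phi> p
    unfolding bilinear_def linear_iff h_def
    by (auto simp: linear_add[OF lin[OF that]] linear_cmul[OF lin[OF that]] inner_add_left inner_add_right
        algebra_simps sum.distrib sum_distrib_left)
  have symm: "h d p v w = h d p w v" for d p v w
    by (simp add: h_def inner_commute)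
  have pos_def: "0 < h (U, \<phi>) p v v" if d: "(U, \<phi>) \<in> A" "p \<in> U" and v: "v \<noteq> 0" for U \<phi> p v
  proof -
    have "D W (U, \<phi>) p v \<noteq> 0" if W: "W \<in> S p" for W
    proof
      assume "D W (U, \<phi>) p v = 0"
      then have "\<D> (\<phi> \<circ> inv_into (fst (c W)) (snd (c W))) (snd (c W) p) 0 = v"
        using transition_derivative_inverse[OF d(1) SA[OF W] d(2) mem[OF W], of v] by (simp add: D_def)
      moreover have "\<D> (\<phi> \<circ> inv_into (fst (c W)) (snd (c W))) (snd (c W) p) 0 = 0"
        by (intro linear_0 linear_frechet_derivative transition_differentiable[OF SA[OF W] d(1) mem[OF W] d(2)])
      ultimately show False using v by simp
    qed
    then have "0 < \<beta> W p * (D W (U, \<phi>) p v \<bullet> D W (U, \<phi>) p v)" if "W \<in> S p" for W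
      using that \<beta>(2)[of W p] by (simp add: S_def order.strict_iff_order)
    moreover have "S p \<noteq> {}" using pos[of p] by (force simp: S_def)
    ultimately show ?thesis unfolding h_def using finS by (intro sum_pos) auto
  qed
  have smooth_h: "smooth_on (\<phi> ` U) (\<lambda>x. h (U, \<phi>) (inv_into U \<phi> x) v w)" if d: "(U, \<phi>) \<in> A" for U \<phi> v w
  proof -
    define t where "t W x = \<beta> W (inv_into U \<phi> x) *
      (\<D> (snd (c W) \<circ> inv_into U \<phi>) x v \<bullet>
        \<D> (snd (c W) \<circ> inv_into U \<phi>) x w)" for W x
    have h: "h (U, \<phi>) (inv_into U \<phi> x) v w = (\<Sum>W\<in>S (inv_into U \<phi> x). t W x)" if "x \<in> \<phi> ` U" for x
      using that by (auto simp: h_def t_def D_def chart_inverse[OF d])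
    have smooth: "smooth_on (\<phi> ` U) (t W)" if W: "W \<in> \<W>" for W
    proof (rule smooth_on_zero_extension[OF d _ compact_imp_closed[OF C(1)[OF W]] C(2)[OF W]])
      have cW: "(fst (c W), snd (c W)) \<in> A" using c[OF W] by simp
      show "open (fst (c W))" using chart_open[OF cW] .
      show "t W (\<phi> q) = 0" if "q \<in> U - C W" for q
        using that zero[OF W] by (simp add: t_def chart_inverse[OF d])
      have op: "open (\<phi> ` (U \<inter> fst (c W)))"
        using chart_open[OF d] chart_open[OF cW] by (intro open_chart_image[OF d]) auto
      have "smooth_on (\<phi> ` (U \<inter> fst (c W))) (\<lambda>x. \<beta> W (inv_into U \<phi> x))"
        using smooth_on_subset[OF smooth_functionsD[OF \<beta>(1)[OF W] d], of "\<phi> ` (U \<inter> fst (c W))"] by (auto simp: o_def)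
      then show "smooth_on (\<phi> ` (U \<inter> fst (c W))) (t W)"
        unfolding t_def[abs_def] using transition_smooth[OF d cW]
        by (intro smooth_on_mult[OF op] smooth_on_inner[OF op] smooth_on_derivative)
    qed
    have "\<exists>V. x \<in> V \<and> smooth_on V (\<lambda>x. h (U, \<phi>) (inv_into U \<phi> x) v w)" if x: "x \<in> \<phi> ` U" for x
    proof -
      obtain N where N: "open N" "inv_into U \<phi> x \<in> N" "finite {W \<in> \<W>. \<exists>q\<in>N. \<beta> W q \<noteq> 0}"
        using fin by blast
      let ?F = "{W \<in> \<W>. \<exists>q\<in>N. \<beta> W q \<noteq> 0}"
      have op: "open (\<phi> ` (U \<inter> N))"
        using chart_open[OF d] N(1) by (intro open_chart_image[OF d]) auto
      have "smooth_on (\<phi> ` (U \<inter> N)) (\<lambda>x. \<Sum>W\<in>?F. t W x)"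
        by (intro smooth_on_sum[OF op] smooth_on_subset[OF smooth]) auto
      moreover have "(\<Sum>W\<in>?F. t W y) = h (U, \<phi>) (inv_into U \<phi> y) v w" if y: "y \<in> \<phi> ` (U \<inter> N)" for y
      proof -
        have "inv_into U \<phi> y \<in> N" using y chart_inverse[OF d] by auto
        then have "(\<Sum>W\<in>?F. t W y) = (\<Sum>W\<in>S (inv_into U \<phi> y). t W y)"
          by (intro sum.mono_neutral_right) (auto simp: N(3) S_def t_def)
        then show ?thesis using h y by auto
      qed
      ultimately have "smooth_on (\<phi> ` (U \<inter> N)) (\<lambda>x. h (U, \<phi>) (inv_into U \<phi> x) v w)"
        by (rule smooth_on_cong_open[OF op, rotated])
      moreover have "x \<in> \<phi> ` (U \<inter> N)"
        using x N(2) chart_inverse[OF d] by auto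
      ultimately show ?thesis by (intro exI[of _ "\<phi> ` (U \<inter> N)"] conjI)
    qed
    then show ?thesis by (auto simp: smooth_on_def)
  qed
  have trans: "h (U, \<phi>) p v w = (let D = \<D> (\<psi> \<circ> inv_into U \<phi>) (\<phi> p)
           in h (V, \<psi>) p (D v) (D w))"
    if "(U, \<phi>) \<in> A" "(V, \<psi>) \<in> A" "p \<in> U" "p \<in> V" for U \<phi> V \<psi> p v w
    unfolding h_def Let_def
  proof (rule sum.cong[OF refl])
    fix W assume W: "W \<in> S p"
    show "\<beta> W p * (D W (U, \<phi>) p v \<bullet> D W (U, \<phi>) p w) = \<beta> W p *
      (D W (V, \<psi>) p (\<D> (\<psi> \<circ> inv_into U \<phi>) (\<phi> p) v) \<bullet>
       D W (V, \<psi>) p (\<D> (\<psi> \<circ> inv_into U \<phi>) (\<phi> p) w))"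
      using transition_derivative_chain[OF that(1,2) SA[OF W] that(3,4) mem[OF W]] by (simp add: D_def)
  qed
  show thesis
  proof (rule that[of h], unfold riemannian_metric_def, intro conjI ballI, goal_cases)
    case (1 d)
    then show ?case using bil pos_def symm by (cases d) simp
  next
    case (2 d)
    then show ?case using smooth_h by (cases d) simp
  next
    case (3 d)
    obtain U \<phi> where d: "d = (U, \<phi>)" by (cases d)
    show ?case unfolding d split_conv
    proof (intro ballI, clarsimp)
      fix V \<psi> p v w
      assume "(V, \<psi>) \<in> A" "p \<in> U" "p \<in> V"
      then show "h (U, \<phi>) p v w = (let D = \<D> (\<psi> \<circ> inv_into U \<phi>) (\<phi> p)
           in h (V, \<psi>) p (D v) (D w))"
        using trans 3 d by blast
    qed
  qed
qed

end

section \<open>Moderate nets in charts\<close>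

text \<open>
  Along a smooth map \<open>\<tau>\<close>, an iterated derivative of \<open>g \<circ> \<tau>\<close> is a combination of derivatives of
  \<open>g\<close> with smooth coefficients that do not depend on \<open>g\<close>. Instead of computing the coefficients, the
  proof shows that the operators \<open>Q\<close> of this form (\<open>E n Q\<close>, with \<open>n\<close> the order) are closed under sums;
  the product and chain rules turn the derivative of one term into a sum of such terms.
\<close>

lemma iter_deriv_compose_expansion:
  fixes \<tau> :: "'d::real_normed_vector \<Rightarrow> 'e::{real_inner,heine_borel}"
  assumes W: "open W" and \<tau>: "smooth_on W \<tau>" and sub: "\<tau> ` W \<subseteq> V"
  obtains L \<alpha> where "finite L" "\<And>ws. ws \<in> L \<Longrightarrow> length ws \<le> length vs"
    "\<And>ws. ws \<in> L \<Longrightarrow> smooth_on W (\<alpha> ws)"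
    "\<And>(g :: 'e \<Rightarrow> 'b::real_normed_vector) x. smooth_on V g \<Longrightarrow> x \<in> W \<Longrightarrow>
      iter_deriv vs (\<lambda>x. g (\<tau> x)) x = (\<Sum>ws\<in>L. \<alpha> ws x *\<^sub>R iter_deriv ws g (\<tau> x))"
proof -
  define E where "E n Q \<longleftrightarrow> (\<exists>L \<alpha>. finite L \<and> (\<forall>ws\<in>L. length ws \<le> n \<and> smooth_on W (\<alpha> ws)) \<and>
    (\<forall>g x. smooth_on V g \<longrightarrow> x \<in> W \<longrightarrow> Q g x = (\<Sum>ws\<in>L. \<alpha> ws x *\<^sub>R iter_deriv ws g (\<tau> x))))"
    for n :: nat and Q :: "('e \<Rightarrow> 'b) \<Rightarrow> 'd \<Rightarrow> 'b"
  have E_single: "E n (\<lambda>g x. a x *\<^sub>R iter_deriv ws g (\<tau> x))" if "smooth_on W a" "length ws \<le> n" for a ws n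
    unfolding E_def by (rule exI[of _ "{ws}"], rule exI[of _ "\<lambda>_. a"]) (use that in simp)
  have E_add: "E n (\<lambda>g x. Q g x + R g x)" if Q: "E n Q" and R: "E n R" for n Q R
  proof -
    from Q[unfolded E_def] obtain L \<alpha> where "finite L"
      "\<forall>ws\<in>L. length ws \<le> n \<and> smooth_on W (\<alpha> ws)"
      "\<forall>g x. smooth_on V g \<longrightarrow> x \<in> W \<longrightarrow> Q g x = (\<Sum>ws\<in>L. \<alpha> ws x *\<^sub>R iter_deriv ws g (\<tau> x))"
      by (elim exE conjE)
    then have L: "finite L" "\<And>ws. ws \<in> L \<Longrightarrow> length ws \<le> n"
      "\<And>ws. ws \<in> L \<Longrightarrow> smooth_on W (\<alpha> ws)"
      "\<And>g x. smooth_on V g \<Longrightarrow> x \<in> W \<Longrightarrow> Q g x = (\<Sum>ws\<in>L. \<alpha> ws x *\<^sub>R iter_deriv ws g (\<tau> x))"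
      by simp_all
    from R[unfolded E_def] obtain M \<beta> where "finite M"
      "\<forall>ws\<in>M. length ws \<le> n \<and> smooth_on W (\<beta> ws)"
      "\<forall>g x. smooth_on V g \<longrightarrow> x \<in> W \<longrightarrow> R g x = (\<Sum>ws\<in>M. \<beta> ws x *\<^sub>R iter_deriv ws g (\<tau> x))"
      by (elim exE conjE)
    then have M: "finite M" "\<And>ws. ws \<in> M \<Longrightarrow> length ws \<le> n"
      "\<And>ws. ws \<in> M \<Longrightarrow> smooth_on W (\<beta> ws)"
      "\<And>g x. smooth_on V g \<Longrightarrow> x \<in> W \<Longrightarrow> R g x = (\<Sum>ws\<in>M. \<beta> ws x *\<^sub>R iter_deriv ws g (\<tau> x))"
      by simp_all
    define \<alpha>' where "\<alpha>' ws = (if ws \<in> L then \<alpha> ws else (\<lambda>x. 0))" for ws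
    define \<beta>' where "\<beta>' ws = (if ws \<in> M then \<beta> ws else (\<lambda>x. 0))" for ws
    have "smooth_on W (\<alpha>' ws)" "smooth_on W (\<beta>' ws)" for ws
      using L(3) M(3) by (auto simp: \<alpha>'_def \<beta>'_def)
    then have "smooth_on W (\<lambda>x. \<alpha>' ws x + \<beta>' ws x)" for ws
      by (intro smooth_on_add[OF W])
    moreover have "Q g x + R g x = (\<Sum>ws\<in>L \<union> M. (\<alpha>' ws x + \<beta>' ws x) *\<^sub>R iter_deriv ws g (\<tau> x))"
      if gx: "smooth_on V g" "x \<in> W" for g x
    proof -
      have "Q g x = (\<Sum>ws\<in>L \<union> M. \<alpha>' ws x *\<^sub>R iter_deriv ws g (\<tau> x))"
        unfolding L(4)[OF gx] using L(1) M(1) by (intro sum.mono_neutral_cong_left) (auto simp: \<alpha>'_def)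
      moreover have "R g x = (\<Sum>ws\<in>L \<union> M. \<beta>' ws x *\<^sub>R iter_deriv ws g (\<tau> x))"
        unfolding M(4)[OF gx] using L(1) M(1) by (intro sum.mono_neutral_cong_left) (auto simp: \<beta>'_def)
      ultimately show ?thesis by (simp add: scaleR_add_left sum.distrib)
    qed
    ultimately show ?thesis
      unfolding E_def using L(1,2) M(1,2)
      by (intro exI[of _ "L \<union> M"] exI[of _ "\<lambda>ws x. \<alpha>' ws x + \<beta>' ws x"]) auto
  qed
  have E_sum: "E n (\<lambda>g x. \<Sum>i\<in>I. Q i g x)" if "\<And>i. i \<in> I \<Longrightarrow> E n (Q i)" for n and I :: "'c set" and Q
    using that
  proof (induction I rule: infinite_finite_induct)
    case (insert i I)
    then show ?case using E_add by simp
  qed (simp_all add: E_def exI[of _ "{}"])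
  obtain B :: "'e set" where B: "finite B" "\<And>x. (\<Sum>b\<in>B. (x \<bullet> b) *\<^sub>R b) = x"
    using finite_orthonormal_basis_exists by blast
  have "E (length vs) (\<lambda>g. iter_deriv vs (\<lambda>x. g (\<tau> x)))"
  proof (induction vs)
    case Nil
    have "E 0 (\<lambda>g x. 1 *\<^sub>R iter_deriv [] g (\<tau> x))" by (rule E_single) auto
    then show ?case by simp
  next
    case (Cons v vs)
    from Cons.IH[unfolded E_def] obtain L \<alpha> where "finite L"
      "\<forall>ws\<in>L. length ws \<le> length vs \<and> smooth_on W (\<alpha> ws)"
      "\<forall>(g :: 'e \<Rightarrow> 'b) x. smooth_on V g \<longrightarrow> x \<in> W \<longrightarrow> iter_deriv vs (\<lambda>x. g (\<tau> x)) x = (\<Sum>ws\<in>L. \<alpha> ws x *\<^sub>R iter_deriv ws g (\<tau> x))"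
      by (elim exE conjE)
    then have L: "finite L" "\<And>ws. ws \<in> L \<Longrightarrow> length ws \<le> length vs"
      "\<And>ws. ws \<in> L \<Longrightarrow> smooth_on W (\<alpha> ws)"
      "\<And>(g :: 'e \<Rightarrow> 'b) x. smooth_on V g \<Longrightarrow> x \<in> W \<Longrightarrow> iter_deriv vs (\<lambda>x. g (\<tau> x)) x = (\<Sum>ws\<in>L. \<alpha> ws x *\<^sub>R iter_deriv ws g (\<tau> x))"
      by simp_all
    define Q where "Q g x = (\<Sum>ws\<in>L.
        (\<Sum>b\<in>B. (\<alpha> ws x * (\<D> \<tau> x v \<bullet> b)) *\<^sub>R iter_deriv (b # ws) g (\<tau> x)) +
        \<D> (\<alpha> ws) x v *\<^sub>R iter_deriv ws g (\<tau> x))" for g :: "'e \<Rightarrow> 'b" and x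
    have "iter_deriv (v # vs) (\<lambda>x. g (\<tau> x)) x = Q g x" if g: "smooth_on V g" and x: "x \<in> W" for x and g :: "'e \<Rightarrow> 'b"
    proof -
      have d\<tau>: "\<tau> differentiable (at x)" using smooth_on_differentiable[OF \<tau> x] .
      have dg: "iter_deriv ws g differentiable (at (\<tau> x))" for ws
        using g x sub by (auto simp: smooth_on_def)
      have dg\<tau>: "(\<lambda>x. iter_deriv ws g (\<tau> x)) differentiable (at x)" for ws
        using differentiable_chain_at[OF d\<tau> dg] by (simp add: o_def)
      have d\<alpha>: "\<alpha> ws differentiable (at x)" if "ws \<in> L" for ws
        using smooth_on_differentiable[OF L(3)[OF that] x] .
      note prodD = frechet_derivative_bilinear[OF bounded_bilinear_scaleR d\<alpha> dg\<tau>]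
      have "((\<lambda>x. \<Sum>ws\<in>L. \<alpha> ws x *\<^sub>R iter_deriv ws g (\<tau> x)) has_derivative
          (\<lambda>v. \<Sum>ws\<in>L. \<D> (\<lambda>x. \<alpha> ws x *\<^sub>R iter_deriv ws g (\<tau> x)) x v)) (at x)"
        by (intro has_derivative_sum) (use prodD(1) in \<open>simp add: frechet_derivative_works\<close>)
      from frechet_derivative_at[OF this]
      have "\<D> (\<lambda>x. \<Sum>ws\<in>L. \<alpha> ws x *\<^sub>R iter_deriv ws g (\<tau> x)) x v =
          (\<Sum>ws\<in>L. \<D> (\<lambda>x. \<alpha> ws x *\<^sub>R iter_deriv ws g (\<tau> x)) x v)"
        by (rule fun_cong[OF sym])
      also have "\<dots> = Q g x"
        unfolding Q_def
      proof (rule sum.cong[OF refl])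
        fix ws assume ws: "ws \<in> L"
        show "\<D> (\<lambda>x. \<alpha> ws x *\<^sub>R iter_deriv ws g (\<tau> x)) x v =
          (\<Sum>b\<in>B. (\<alpha> ws x * (\<D> \<tau> x v \<bullet> b)) *\<^sub>R iter_deriv (b # ws) g (\<tau> x)) +
          \<D> (\<alpha> ws) x v *\<^sub>R iter_deriv ws g (\<tau> x)"
          by (simp add: prodD(2)[OF ws] frechet_derivative_compose_basis[OF d\<tau> dg B(2)] scaleR_sum_right)
      qed
      finally show ?thesis
        using frechet_derivative_cong_open[OF W x L(4)[OF g]] by simp
    qed
    moreover have "E (Suc (length vs)) Q"
      unfolding Q_def[abs_def]
    proof (intro E_sum E_add E_single)
      fix ws assume ws: "ws \<in> L"
      show "smooth_on W (\<lambda>x. \<alpha> ws x * (\<D> \<tau> x v \<bullet> b))" for b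
        by (intro smooth_on_mult[OF W] L(3)[OF ws] smooth_on_bounded_linear[OF W bounded_linear_inner_left]
            smooth_on_derivative[OF \<tau>])
      show "smooth_on W (\<lambda>x. \<D> (\<alpha> ws) x v)"
        by (rule smooth_on_derivative[OF L(3)[OF ws]])
      show "length ws \<le> Suc (length vs)" "length (b # ws) \<le> Suc (length vs)" for b
        using L(2)[OF ws] by auto
    qed
    ultimately show ?case unfolding E_def by simp
  qed
  from this[unfolded E_def] show thesis by (elim exE conjE) (rule that, simp_all)
qed

lemma eventually_unit_intervalI:
  assumes "\<And>\<epsilon> x. \<epsilon> \<in> {0<..1} \<Longrightarrow> x \<in> W \<Longrightarrow> P \<epsilon> x"
  shows "\<forall>\<^sub>F \<epsilon> :: real in at_right 0. \<forall>x\<in>W. P \<epsilon> x"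
  using eventually_unit_interval by eventually_elim (use assms in blast)

text \<open>
  The next two lemmas translate between growth conditions on suprema and pointwise estimates. For
  the converse direction the suprema have to exist.
\<close>

lemma SUP_bigo:
  fixes f :: "real \<Rightarrow> 'x \<Rightarrow> 'b::real_normed_vector"
  assumes "K \<noteq> {}" "\<forall>\<^sub>F \<epsilon> in at_right 0. \<forall>p\<in>K. norm (f \<epsilon> p) \<le> C * norm (g \<epsilon>)"
  shows "(\<lambda>\<epsilon>. SUP p\<in>K. norm (f \<epsilon> p)) \<in> O[at_right 0](g :: real \<Rightarrow> real)"
proof (rule bigoI[where c = C])
  show "\<forall>\<^sub>F \<epsilon> in at_right 0. norm (SUP p\<in>K. norm (f \<epsilon> p)) \<le> C * norm (g \<epsilon>)"
    using assms(2)
  proof eventually_elim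
    case (elim \<epsilon>)
    obtain p where p: "p \<in> K" using assms(1) by blast
    have "bdd_above ((\<lambda>p. norm (f \<epsilon> p)) ` K)" using elim by (auto intro: bdd_aboveI2)
    from cSUP_upper[OF p this] have "0 \<le> (SUP p\<in>K. norm (f \<epsilon> p))"
      by (meson norm_ge_zero order_trans)
    moreover have "(SUP p\<in>K. norm (f \<epsilon> p)) \<le> C * norm (g \<epsilon>)"
      by (rule cSUP_least) (use elim assms(1) in auto)
    ultimately show ?case by simp
  qed
qed

lemma bigo_SUP_bound:
  fixes f :: "real \<Rightarrow> 'x \<Rightarrow> 'b::real_normed_vector"
  assumes "(\<lambda>\<epsilon>. SUP p\<in>K. norm (f \<epsilon> p)) \<in> O[at_right 0](g :: real \<Rightarrow> real)"
    and bdd: "\<And>\<epsilon>. \<epsilon> \<in> {0<..1} \<Longrightarrow> bdd_above ((\<lambda>p. norm (f \<epsilon> p)) ` K)"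
  obtains C where "0 < C" "\<forall>\<^sub>F \<epsilon> in at_right 0. \<forall>p\<in>K. norm (f \<epsilon> p) \<le> C * norm (g \<epsilon>)"
proof -
  obtain C where C: "C > 0" "\<forall>\<^sub>F \<epsilon> in at_right 0. norm (SUP p\<in>K. norm (f \<epsilon> p)) \<le> C * norm (g \<epsilon>)"
    using landau_o.bigE[OF assms(1)] by blast
  have "\<forall>\<^sub>F \<epsilon> in at_right 0. \<forall>p\<in>K. norm (f \<epsilon> p) \<le> C * norm (g \<epsilon>)"
    using C(2) eventually_unit_interval
  proof eventually_elim
    case (elim \<epsilon>)
    show ?case
    proof
      fix p assume "p \<in> K"
      from cSUP_upper[OF this bdd[OF elim(2)]] elim(1)
      show "norm (f \<epsilon> p) \<le> C * norm (g \<epsilon>)" by simp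
    qed
  qed
  with C(1) show thesis by (rule that)
qed

context smooth_manifold
begin

text \<open>
  The hypothesis of moderateness concerns globally defined operators. This one sees a derivative
  in the chart \<open>(U, \<phi>)\<close>, cut off to the compact set \<open>C\<close>. In another chart it is expanded by
  \<open>iter_deriv_compose_expansion\<close> for the transition map, on the overlap of the domains, and the
  coefficients extend by zero.
\<close>

lemma cutoff_differential_operator:
  assumes c: "(U, \<phi>) \<in> A" and \<beta>: "\<beta> \<in> smooth_functions A" and C: "compact C" "C \<subseteq> U"
    and zero: "\<And>q. q \<notin> C \<Longrightarrow> \<beta> q = (0 :: real)"
  shows "linear_differential_operator A (\<lambda>f q. if q \<in> U
    then of_real (\<beta> q) * iter_deriv vs (f \<circ> inv_into U \<phi>) (\<phi> q) else (0 :: 'k::real_normed_field))"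
    (is "linear_differential_operator A ?P")
  unfolding linear_differential_operator_def
proof (intro exI[of _ "length vs"] ballI)
  fix d assume "d \<in> A"
  then obtain V \<psi> where dV: "d = (V, \<psi>)" and d: "(V, \<psi>) \<in> A" by (cases d) auto
  have op: "open (\<phi> ` (U \<inter> V))" "open (\<psi> ` (V \<inter> U))"
    using chart_open[OF c] chart_open[OF d] by (intro open_chart_image[OF c] open_chart_image[OF d]; auto)+
  have im: "(\<psi> \<circ> inv_into U \<phi>) ` \<phi> ` (U \<inter> V) \<subseteq> \<psi> ` V"
    using chart_inverse[OF c] by auto
  obtain L \<alpha> where L: "finite L" "\<And>ws. ws \<in> L \<Longrightarrow> length ws \<le> length vs"
    "\<And>ws. ws \<in> L \<Longrightarrow> smooth_on (\<phi> ` (U \<inter> V)) (\<alpha> ws)"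
    "\<And>(g :: 'e \<Rightarrow> 'k) x. smooth_on (\<psi> ` V) g \<Longrightarrow> x \<in> \<phi> ` (U \<inter> V) \<Longrightarrow>
      iter_deriv vs (\<lambda>x. g ((\<psi> \<circ> inv_into U \<phi>) x)) x = (\<Sum>ws\<in>L. \<alpha> ws x *\<^sub>R iter_deriv ws g ((\<psi> \<circ> inv_into U \<phi>) x))"
    by (rule iter_deriv_compose_expansion[OF op(1) transition_smooth[OF c d] im, of vs], rule that, assumption+)
  define a where "a ws y = (let q = inv_into V \<psi> y in if q \<in> U then of_real (\<beta> q * \<alpha> ws (\<phi> q)) else (0 :: 'k))" for ws y
  have smooth: "smooth_on (\<psi> ` V) (a ws)" if ws: "ws \<in> L" for ws
  proof (rule smooth_on_zero_extension[OF d chart_open[OF c] compact_imp_closed[OF C(1)] C(2)])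
    show "a ws (\<psi> p) = 0" if "p \<in> V - C" for p
      using that zero by (simp add: a_def chart_inverse[OF d])
    have "smooth_on (\<psi> ` (V \<inter> U)) (\<lambda>y. of_real ((\<beta> \<circ> inv_into V \<psi>) y * \<alpha> ws ((\<phi> \<circ> inv_into V \<psi>) y)) :: 'k)"
    proof (intro smooth_on_bounded_linear[OF op(2) bounded_linear_of_real] smooth_on_mult[OF op(2)])
      show "smooth_on (\<psi> ` (V \<inter> U)) (\<beta> \<circ> inv_into V \<psi>)"
        by (rule smooth_on_subset[OF smooth_functionsD[OF \<beta> d]]) auto
      show "smooth_on (\<psi> ` (V \<inter> U)) (\<lambda>x. \<alpha> ws ((\<phi> \<circ> inv_into V \<psi>) x))"
        by (rule smooth_on_compose[OF op(2) L(3)[OF ws] transition_smooth[OF d c]])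
          (auto simp: chart_inverse[OF d])
    qed
    then show "smooth_on (\<psi> ` (V \<inter> U)) (a ws)"
      by (rule smooth_on_cong_open[OF op(2), rotated]) (auto simp: a_def chart_inverse[OF d])
  qed
  have eq: "?P f p = (\<Sum>ws\<in>L. a ws (\<psi> p) * iter_deriv ws (f \<circ> inv_into V \<psi>) (\<psi> p))"
    if f: "f \<in> smooth_functions A" and p: "p \<in> V" for f :: "'a \<Rightarrow> 'k" and p
  proof (cases "p \<in> U")
    case True
    have "iter_deriv vs (f \<circ> inv_into U \<phi>) (\<phi> p) =
      iter_deriv vs (\<lambda>x. (f \<circ> inv_into V \<psi>) ((\<psi> \<circ> inv_into U \<phi>) x)) (\<phi> p)"
      by (rule iter_deriv_cong_open[OF op(1)])
        (use True p in \<open>auto simp: chart_inverse[OF c] chart_inverse[OF d]\<close>)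
    also have "\<dots> = (\<Sum>ws\<in>L. \<alpha> ws (\<phi> p) *\<^sub>R iter_deriv ws (f \<circ> inv_into V \<psi>) ((\<psi> \<circ> inv_into U \<phi>) (\<phi> p)))"
      by (rule L(4)[OF smooth_functionsD[OF f d]]) (use True p in auto)
    finally show ?thesis
      using True p by (simp add: a_def chart_inverse[OF c] chart_inverse[OF d] sum_distrib_left
          scaleR_conv_of_real mult.assoc)
  qed (use p in \<open>simp add: a_def chart_inverse[OF d]\<close>)
  show "case d of (U', \<phi>') \<Rightarrow> \<exists>L a. finite L \<and> (\<forall>ws\<in>L. length ws \<le> length vs \<and> smooth_on (\<phi>' ` U') (a ws)) \<and>
     (\<forall>f\<in>smooth_functions A. \<forall>p\<in>U'. ?P f p = (\<Sum>ws\<in>L. a ws (\<phi>' p) * iter_deriv ws (f \<circ> inv_into U' \<phi>') (\<phi>' p)))"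
    unfolding dV split_conv
    by (intro exI[of _ L] exI[of _ a] conjI ballI) (simp_all only: L(1,2) smooth eq)
qed

lemma moderate_nets_smooth: "u \<in> moderate_nets A \<Longrightarrow> \<epsilon> \<in> {0<..1} \<Longrightarrow> u \<epsilon> \<in> smooth_functions A"
  by (auto simp: moderate_nets_def)

text \<open>
  Near a given point the cutoff function is at least half of its value at that point, so that the
  cut off derivative controls the derivative itself.
\<close>

lemma moderate_nets_imp_moderate_on:
  fixes u :: "real \<Rightarrow> 'a \<Rightarrow> 'k::real_normed_field"
  assumes u: "u \<in> moderate_nets A" and c: "(U, \<phi>) \<in> A"
  shows "moderate_on (\<phi> ` U) (\<lambda>\<epsilon>. u \<epsilon> \<circ> inv_into U \<phi>)"
proof -
  have smooth: "smooth_on (\<phi> ` U) (u \<epsilon> \<circ> inv_into U \<phi>)" if "\<epsilon> \<in> {0<..1}" for \<epsilon>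
    by (rule smooth_functionsD[OF moderate_nets_smooth[OF u that] c])
  have "locally_moderate (\<phi> ` U) (\<lambda>\<epsilon>. iter_deriv vs (u \<epsilon> \<circ> inv_into U \<phi>))" for vs
  proof (rule locally_moderateI, goal_cases)
    case (1 x)
    then obtain p where p: "p \<in> U" "x = \<phi> p" by blast
    obtain \<beta> :: "'a \<Rightarrow> real" and C where \<beta>: "\<beta> \<in> smooth_functions A" "\<And>q. 0 \<le> \<beta> q" "0 < \<beta> p"
      and C: "compact C" "C \<subseteq> U" "\<And>q. q \<notin> C \<Longrightarrow> \<beta> q = 0"
      by (rule bump_function_exists[OF chart_open[OF c] p(1)]) blast
    define P where "P f q = (if q \<in> U
      then of_real (\<beta> q) * iter_deriv vs (f \<circ> inv_into U \<phi>) (\<phi> q) else (0 :: 'k))" for f q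
    have P: "linear_differential_operator A P"
      unfolding P_def[abs_def] by (rule cutoff_differential_operator[OF c \<beta>(1) C])
    have "open {q. \<beta> p / 2 < \<beta> q}"
      using smooth_function_continuous[OF \<beta>(1)] by (intro open_Collect_less) auto
    then obtain r where r: "0 < r" "cball (\<phi> p) r \<subseteq> \<phi> ` (U \<inter> {q. \<beta> p / 2 < \<beta> q})"
      by (rule chart_cball[OF c _ p(1)]) (use \<beta>(3) in auto)
    have rU: "cball (\<phi> p) r \<subseteq> \<phi> ` U" using r(2) by blast
    define K where "K = inv_into U \<phi> ` cball (\<phi> p) r"
    have K: "compact K" unfolding K_def by (rule compact_chart_preimage[OF c _ rU]) simp
    have "K \<noteq> {}" using r(1) by (simp add: K_def)
    with u K P obtain N :: nat where N: "(\<lambda>\<epsilon>. SUP p\<in>K. norm (P (u \<epsilon>) p)) \<in> O[at_right 0](\<lambda>\<epsilon>. 1 / \<epsilon> ^ N)"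
      unfolding moderate_nets_def by blast
    have "bdd_above ((\<lambda>q. norm (P (u \<epsilon>) q)) ` K)" if e: "\<epsilon> \<in> {0<..1}" for \<epsilon>
    proof -
      have "continuous_on (\<phi> ` U) (\<lambda>y. norm (of_real ((\<beta> \<circ> inv_into U \<phi>) y) * iter_deriv vs (u \<epsilon> \<circ> inv_into U \<phi>) y))"
        by (intro continuous_intros smooth_on_continuous_on smooth_on_iter_deriv smooth smooth_functionsD[OF \<beta>(1) c] e)
      then have "continuous_on (cball (\<phi> p) r) (\<lambda>y. norm (of_real ((\<beta> \<circ> inv_into U \<phi>) y) * iter_deriv vs (u \<epsilon> \<circ> inv_into U \<phi>) y))"
        using rU by (rule continuous_on_subset)
      then have "bdd_above ((\<lambda>y. norm (of_real ((\<beta> \<circ> inv_into U \<phi>) y) * iter_deriv vs (u \<epsilon> \<circ> inv_into U \<phi>) y)) ` cball (\<phi> p) r)"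
        by (intro bounded_imp_bdd_above compact_imp_bounded compact_continuous_image) simp_all
      moreover have "(\<lambda>q. norm (P (u \<epsilon>) q)) ` K =
        (\<lambda>y. norm (of_real ((\<beta> \<circ> inv_into U \<phi>) y) * iter_deriv vs (u \<epsilon> \<circ> inv_into U \<phi>) y)) ` cball (\<phi> p) r"
        unfolding K_def image_image using rU
        by (intro image_cong refl) (auto simp: P_def chart_inverse_mem chart_inverse_right subset_iff)
      ultimately show ?thesis by simp
    qed
    then obtain D where D: "0 < D" "\<forall>\<^sub>F \<epsilon> in at_right 0. \<forall>q\<in>K. norm (P (u \<epsilon>) q) \<le> D * norm (1 / \<epsilon> ^ N)"
      by (rule bigo_SUP_bound[OF N])
    have "\<forall>\<^sub>F \<epsilon> in at_right 0. \<forall>y\<in>ball x r \<inter> \<phi> ` U. norm (iter_deriv vs (u \<epsilon> \<circ> inv_into U \<phi>) y) \<le> (2 * D / \<beta> p) / \<epsilon> ^ N"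
      using D(2) eventually_unit_interval
    proof eventually_elim
      case (elim \<epsilon>)
      show ?case
      proof
        fix y assume y: "y \<in> ball x r \<inter> \<phi> ` U"
        let ?n = "norm (iter_deriv vs (u \<epsilon> \<circ> inv_into U \<phi>) y)"
        define q where "q = inv_into U \<phi> y"
        have q: "q \<in> K" "q \<in> U" "\<phi> q = y"
          using y p(2) by (auto simp: q_def K_def chart_inverse[OF c])
        have "\<phi> q \<in> \<phi> ` (U \<inter> {q. \<beta> p / 2 < \<beta> q})" using y r(2) p q(3) by auto
        then obtain q' where "q' \<in> U" "\<phi> q' = \<phi> q" "\<beta> p / 2 < \<beta> q'" by auto
        then have "\<beta> p / 2 < \<beta> q" using chart_inverse[OF c] q(2) by metis
        then have "\<beta> p / 2 * ?n \<le> \<beta> q * ?n" by (intro mult_right_mono) auto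
        also have "\<dots> = norm (P (u \<epsilon>) q)" using q \<beta>(2)[of q] by (simp add: P_def norm_mult)
        also have "\<dots> \<le> D * norm (1 / \<epsilon> ^ N)" using elim(1) q(1) by blast
        also have "\<dots> = D / \<epsilon> ^ N" using elim(2) by simp
        finally show "?n \<le> (2 * D / \<beta> p) / \<epsilon> ^ N"
          using \<beta>(3) elim(2) by (simp add: field_simps)
      qed
    qed
    moreover have "x \<in> ball x r" using r(1) by simp
    ultimately show ?case
      by (intro exI[of _ "ball x r"] exI[of _ "2 * D / \<beta> p"] exI[of _ N] conjI open_ball)
  qed
  then show ?thesis using smooth by (simp add: moderate_on_def)
qed

lemma locally_moderate_chart_compose:
  assumes c: "(U, \<phi>) \<in> A" and w: "locally_moderate (\<phi> ` U) w"
  shows "locally_moderate U (\<lambda>\<epsilon> p. w \<epsilon> (\<phi> p))"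
  unfolding locally_moderate_def
proof
  fix p assume p: "p \<in> U"
  then obtain T N where T: "open T" "\<phi> p \<in> T"
    "bounded_by_power (T \<inter> \<phi> ` U) w N"
    using locally_moderateE[OF w, of "\<phi> p"] by blast
  have "open (\<phi> -` T \<inter> U)"
    using continuous_on_open_vimage[OF chart_open[OF c]] chart_continuous_on[OF c] T(1) by blast
  moreover have "\<forall>\<^sub>F \<epsilon> in at_right 0. \<forall>q\<in>(\<phi> -` T \<inter> U) \<inter> U. norm (w \<epsilon> (\<phi> q)) \<le> 1 / \<epsilon> ^ N"
    using T(3) by eventually_elim auto
  ultimately show "\<exists>T N. open T \<and> p \<in> T \<and> (\<forall>\<^sub>F \<epsilon> in at_right 0. \<forall>y\<in>T \<inter> U. norm (w \<epsilon> (\<phi> y)) \<le> 1 / \<epsilon> ^ N)"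
    using p T(2) by (intro exI[of _ "\<phi> -` T \<inter> U"] exI[of _ N] conjI) auto
qed

text \<open>
  In a chart a differential operator is a sum of iterated derivatives with smooth, hence locally
  bounded coefficients; compactness then passes from local bounds to bounds on \<open>K\<close>.
\<close>

lemma moderate_on_imp_moderate_nets:
  fixes u :: "real \<Rightarrow> 'a \<Rightarrow> 'k::real_normed_field"
  assumes u: "\<And>U \<phi>. (U, \<phi>) \<in> A \<Longrightarrow> moderate_on (\<phi> ` U) (\<lambda>\<epsilon>. u \<epsilon> \<circ> inv_into U \<phi>)"
  shows "u \<in> moderate_nets A"
proof -
  have smooth: "u \<epsilon> \<in> smooth_functions A" if "\<epsilon> \<in> {0<..1}" for \<epsilon>
    by (rule smooth_functionsI) (use u that in \<open>auto simp: moderate_on_def\<close>)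
  have "\<exists>N::nat. (\<lambda>\<epsilon>. SUP p\<in>K. norm (P (u \<epsilon>) p)) \<in> O[at_right 0](\<lambda>\<epsilon>. 1 / \<epsilon> ^ N)"
    if K: "compact K" "K \<noteq> {}" and P: "linear_differential_operator A P" for K P
  proof -
    have "locally_moderate UNIV (\<lambda>\<epsilon>. P (u \<epsilon>))"
    proof (rule locally_moderate_open_cover)
      fix p :: 'a
      obtain U \<phi> where c: "(U, \<phi>) \<in> A" "p \<in> U" by (rule chart_exists)
      from P[unfolded linear_differential_operator_def] obtain m where
        "\<forall>(U, \<phi>)\<in>A. \<exists>L a. finite L \<and> (\<forall>vs\<in>L. length vs \<le> m \<and> smooth_on (\<phi> ` U) (a vs)) \<and>
        (\<forall>f\<in>smooth_functions A. \<forall>p\<in>U. P f p = (\<Sum>vs\<in>L. a vs (\<phi> p) * iter_deriv vs (f \<circ> inv_into U \<phi>) (\<phi> p)))"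
        by (rule exE)
      from bspec[OF this c(1), unfolded split_conv] obtain L a where L: "finite L"
        "\<forall>vs\<in>L. length vs \<le> m \<and> smooth_on (\<phi> ` U) (a vs)"
        "\<forall>f\<in>smooth_functions A. \<forall>p\<in>U. P f p = (\<Sum>vs\<in>L. a vs (\<phi> p) * iter_deriv vs (f \<circ> inv_into U \<phi>) (\<phi> p))"
        by (elim exE conjE)
      have "locally_moderate (\<phi> ` U) (\<lambda>\<epsilon> x. \<Sum>vs\<in>L. a vs x * iter_deriv vs (u \<epsilon> \<circ> inv_into U \<phi>) x)"
      proof (intro locally_moderate_sum locally_moderate_mult)
        fix vs assume "vs \<in> L"
        then show "locally_moderate (\<phi> ` U) (\<lambda>\<epsilon>. a vs)"
          using L(2) by (intro locally_moderate_continuous smooth_on_continuous_on) blast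
        show "locally_moderate (\<phi> ` U) (\<lambda>\<epsilon>. iter_deriv vs (u \<epsilon> \<circ> inv_into U \<phi>))"
          using u[OF c(1)] by (simp add: moderate_on_def)
      qed
      from locally_moderate_chart_compose[OF c(1) this] have "locally_moderate U (\<lambda>\<epsilon>. P (u \<epsilon>))"
      proof (rule locally_moderate_cong)
        show "\<forall>\<^sub>F \<epsilon> in at_right 0. \<forall>p\<in>U. P (u \<epsilon>) p = (\<Sum>vs\<in>L. a vs (\<phi> p) * iter_deriv vs (u \<epsilon> \<circ> inv_into U \<phi>) (\<phi> p))"
          by (rule eventually_unit_intervalI) (use L(3) smooth in blast)
      qed
      then show "\<exists>V. open V \<and> p \<in> V \<and> locally_moderate V (\<lambda>\<epsilon>. P (u \<epsilon>))"
        using c chart_open by blast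
    qed
    then obtain N where N: "\<forall>\<^sub>F \<epsilon> in at_right 0. \<forall>p\<in>K. norm (P (u \<epsilon>) p) \<le> 1 / \<epsilon> ^ (N :: nat)"
      by (rule locally_moderate_compact[OF _ K(1)]) auto
    have "(\<lambda>\<epsilon>. SUP p\<in>K. norm (P (u \<epsilon>) p)) \<in> O[at_right 0](\<lambda>\<epsilon>. 1 / \<epsilon> ^ N)"
    proof (rule SUP_bigo[OF K(2), where C = 1])
      show "\<forall>\<^sub>F \<epsilon> in at_right 0. \<forall>p\<in>K. norm (P (u \<epsilon>) p) \<le> 1 * norm (1 / \<epsilon> ^ N)"
        using N eventually_unit_interval by eventually_elim simp
    qed
    then show ?thesis by (rule exI)
  qed
  with smooth show ?thesis unfolding moderate_nets_def by blast
qed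

end

section \<open>Rings of nets and their quotients\<close>

text \<open>
  Both quotients are formed from sets of functions with pointwise operations, that is, from
  subsets of the commutative ring of all functions, with an ideal of such a subring.
\<close>

locale subring_ideal =
  fixes M I :: "'r::comm_ring_1 set"
  assumes one_mem: "1 \<in> M"
    and add_mem: "x \<in> M \<Longrightarrow> y \<in> M \<Longrightarrow> x + y \<in> M"
    and uminus_mem: "x \<in> M \<Longrightarrow> - x \<in> M"
    and mult_mem: "x \<in> M \<Longrightarrow> y \<in> M \<Longrightarrow> x * y \<in> M"
    and ideal_subset: "I \<subseteq> M"
    and ideal_zero: "0 \<in> I"
    and ideal_add: "x \<in> I \<Longrightarrow> y \<in> I \<Longrightarrow> x + y \<in> I"
    and ideal_mult: "x \<in> I \<Longrightarrow> y \<in> M \<Longrightarrow> x * y \<in> I"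
begin

definition R :: "'r ring" where
  "R = \<lparr>carrier = M, mult = (*), one = 1, zero = 0, add = (+)\<rparr>"

lemma R_simps [simp]: "carrier R = M" "mult R = (*)" "one R = 1" "zero R = 0" "add R = (+)"
  by (simp_all add: R_def)

lemma ideal_uminus: "x \<in> I \<Longrightarrow> - x \<in> I"
  using ideal_mult[of x "- 1"] uminus_mem[OF one_mem] by simp

lemma ideal_diff: "x \<in> I \<Longrightarrow> y \<in> I \<Longrightarrow> x - y \<in> I"
  using ideal_add[of x "- y"] ideal_uminus by simp

lemma cring_R: "cring R"
proof (rule cringI)
  show "abelian_group R"
  proof (rule abelian_groupI)
    fix x assume "x \<in> carrier R"
    then show "\<exists>y\<in>carrier R. y \<oplus>\<^bsub>R\<^esub> x = \<zero>\<^bsub>R\<^esub>" by (intro bexI[of _ "- x"]) (simp_all add: uminus_mem)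
  qed (use add_mem ideal_zero ideal_subset in \<open>auto simp: add.assoc add.commute\<close>)
  show "comm_monoid R"
    by (rule comm_monoidI) (auto simp: mult_mem one_mem mult.assoc mult.commute)
qed (simp add: distrib_right)

lemma ideal_R: "ideal I R"
proof (rule idealI)
  interpret cring R by (rule cring_R)
  show "ring R" by (rule ring_axioms)
  show "subgroup I (add_monoid R)"
  proof (rule group.subgroupI[OF a_group])
    fix x assume x: "x \<in> I"
    have "\<ominus>\<^bsub>R\<^esub> x = - x"
      by (rule minus_equality) (use x ideal_subset uminus_mem in auto)
    then show "inv\<^bsub>add_monoid R\<^esub> x \<in> I"
      using ideal_uminus[OF x] by (simp add: a_inv_def)
  qed (use ideal_subset ideal_zero ideal_add in auto)
qed (use ideal_mult in \<open>auto simp: mult.commute\<close>)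

lemma coset_eq: "I +>\<^bsub>R\<^esub> r = {n + r | n. n \<in> I}"
  by (auto simp: a_r_coset_def')

lemma coset_eq_iff: "I +>\<^bsub>R\<^esub> r = I +>\<^bsub>R\<^esub> s \<longleftrightarrow> r - s \<in> I"
proof
  assume "I +>\<^bsub>R\<^esub> r = I +>\<^bsub>R\<^esub> s"
  moreover have "0 + r \<in> I +>\<^bsub>R\<^esub> r" unfolding coset_eq using ideal_zero by blast
  ultimately show "r - s \<in> I" by (auto simp: coset_eq)
next
  assume d: "r - s \<in> I"
  show "I +>\<^bsub>R\<^esub> r = I +>\<^bsub>R\<^esub> s"
    unfolding coset_eq
  proof (intro subset_antisym subsetI)
    fix x assume "x \<in> {n + r | n. n \<in> I}"
    then obtain n where "n \<in> I" "x = n + (r - s) + s" by auto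
    then show "x \<in> {n + s | n. n \<in> I}" using ideal_add[OF _ d] by blast
  next
    fix x assume "x \<in> {n + s | n. n \<in> I}"
    then obtain n where "n \<in> I" "x = n - (r - s) + r" by auto
    then show "x \<in> {n + r | n. n \<in> I}" using ideal_diff[OF _ d] by blast
  qed
qed

lemma carrier_Quot: "carrier (R Quot I) = {I +>\<^bsub>R\<^esub> r | r. r \<in> M}"
  by (auto simp: FactRing_def A_RCOSETS_def')

lemma coset_mem_Units_iff:
  assumes r: "r \<in> M"
  shows "I +>\<^bsub>R\<^esub> r \<in> Units (R Quot I) \<longleftrightarrow> (\<exists>s\<in>M. r * s - 1 \<in> I)"
proof -
  interpret ideal I R by (rule ideal_R)
  have mult: "(I +>\<^bsub>R\<^esub> x) \<otimes>\<^bsub>R Quot I\<^esub> (I +>\<^bsub>R\<^esub> y) = I +>\<^bsub>R\<^esub> (x * y)" if "x \<in> M" "y \<in> M" for x y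
    using rcoset_mult_add[of x y] that by (simp add: FactRing_def)
  have one: "\<one>\<^bsub>R Quot I\<^esub> = I +>\<^bsub>R\<^esub> 1" by (simp add: FactRing_def)
  have "I +>\<^bsub>R\<^esub> r \<in> Units (R Quot I) \<longleftrightarrow> (\<exists>s\<in>M. I +>\<^bsub>R\<^esub> (r * s) = I +>\<^bsub>R\<^esub> 1)"
  proof -
    have r': "I +>\<^bsub>R\<^esub> r \<in> carrier (R Quot I)" using r unfolding carrier_Quot by blast
    have "I +>\<^bsub>R\<^esub> r \<in> Units (R Quot I) \<longleftrightarrow> (\<exists>S\<in>carrier (R Quot I).
        (I +>\<^bsub>R\<^esub> r) \<otimes>\<^bsub>R Quot I\<^esub> S = I +>\<^bsub>R\<^esub> 1 \<and> S \<otimes>\<^bsub>R Quot I\<^esub> (I +>\<^bsub>R\<^esub> r) = I +>\<^bsub>R\<^esub> 1)"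
      using r' by (auto simp: Units_def one)
    also have "\<dots> \<longleftrightarrow> (\<exists>s\<in>M. I +>\<^bsub>R\<^esub> (r * s) = I +>\<^bsub>R\<^esub> 1 \<and> I +>\<^bsub>R\<^esub> (s * r) = I +>\<^bsub>R\<^esub> 1)"
    proof -
      have "(\<exists>S\<in>carrier (R Quot I). P S) \<longleftrightarrow> (\<exists>s\<in>M. P (I +>\<^bsub>R\<^esub> s))" for P
        by (auto simp: carrier_Quot)
      then show ?thesis by (simp add: mult[OF r] mult[OF _ r] cong: bex_cong)
    qed
    finally show ?thesis by (simp add: mult.commute[of r])
  qed
  then show ?thesis by (simp add: coset_eq_iff)
qed

end

subsection \<open>Negligible nets\<close>

definition negligible_on :: "'x set \<Rightarrow> (real \<Rightarrow> 'x \<Rightarrow> 'b::real_normed_vector) \<Rightarrow> bool" where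
  "negligible_on K w \<longleftrightarrow> (\<forall>m::nat. \<forall>\<^sub>F \<epsilon> in at_right 0. \<forall>p\<in>K. norm (w \<epsilon> p) \<le> \<epsilon> ^ m)"

lemma eventually_const_mult_power_le:
  "\<forall>\<^sub>F \<epsilon> :: real in at_right 0. C * \<epsilon> ^ Suc m \<le> \<epsilon> ^ m"
  using eventually_const_le_inverse_power[of C 0] eventually_unit_interval
proof eventually_elim
  case (elim \<epsilon>)
  then have "C * \<epsilon> * \<epsilon> ^ m \<le> 1 * \<epsilon> ^ m" by (intro mult_right_mono) (auto simp: field_simps)
  then show ?case by (simp add: mult.assoc)
qed

lemma negligible_onI:
  assumes "\<And>m::nat. \<exists>C. \<forall>\<^sub>F \<epsilon> in at_right 0. \<forall>p\<in>K. norm (w \<epsilon> p) \<le> C * \<epsilon> ^ m"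
  shows "negligible_on K w"
  unfolding negligible_on_def
proof
  fix m :: nat
  from assms[of "Suc m"] obtain C where C: "\<forall>\<^sub>F \<epsilon> in at_right 0. \<forall>p\<in>K. norm (w \<epsilon> p) \<le> C * \<epsilon> ^ Suc m" by blast
  show "\<forall>\<^sub>F \<epsilon> in at_right 0. \<forall>p\<in>K. norm (w \<epsilon> p) \<le> \<epsilon> ^ m"
    using C eventually_const_mult_power_le[of C m] by eventually_elim (blast intro: order_trans)
qed

lemma negligible_on_add:
  assumes "negligible_on K w" "negligible_on K z"
  shows "negligible_on K (\<lambda>\<epsilon> p. w \<epsilon> p + z \<epsilon> p)"
proof (rule negligible_onI, rule exI)
  fix m
  show "\<forall>\<^sub>F \<epsilon> in at_right 0. \<forall>p\<in>K. norm (w \<epsilon> p + z \<epsilon> p) \<le> 2 * \<epsilon> ^ m"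
    using assms(1)[unfolded negligible_on_def, THEN spec, of m] assms(2)[unfolded negligible_on_def, THEN spec, of m]
  proof eventually_elim
    case (elim \<epsilon>)
    show ?case
    proof
      fix p assume "p \<in> K"
      with elim have "norm (w \<epsilon> p) + norm (z \<epsilon> p) \<le> \<epsilon> ^ m + \<epsilon> ^ m" by (intro add_mono) blast+
      then show "norm (w \<epsilon> p + z \<epsilon> p) \<le> 2 * \<epsilon> ^ m"
        using norm_triangle_ineq[of "w \<epsilon> p" "z \<epsilon> p"] by linarith
    qed
  qed
qed

lemma negligible_on_mult:
  fixes w z :: "real \<Rightarrow> 'x \<Rightarrow> 'k::real_normed_algebra"
  assumes "negligible_on K w" and z: "bounded_by_power K z N"
  shows "negligible_on K (\<lambda>\<epsilon> p. w \<epsilon> p * z \<epsilon> p)"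
  unfolding negligible_on_def
proof
  fix m
  show "\<forall>\<^sub>F \<epsilon> in at_right 0. \<forall>p\<in>K. norm (w \<epsilon> p * z \<epsilon> p) \<le> \<epsilon> ^ m"
    using assms(1)[unfolded negligible_on_def, THEN spec, of "m + N"] z eventually_unit_interval
  proof eventually_elim
    case (elim \<epsilon>)
    show ?case
    proof
      fix p assume p: "p \<in> K"
      have "norm (w \<epsilon> p * z \<epsilon> p) \<le> norm (w \<epsilon> p) * norm (z \<epsilon> p)" by (rule norm_mult_ineq)
      also have "\<dots> \<le> \<epsilon> ^ (m + N) * (1 / \<epsilon> ^ N)" using elim p by (intro mult_mono) auto
      also have "\<dots> = \<epsilon> ^ m" using elim(3) by (simp add: power_add)
      finally show "norm (w \<epsilon> p * z \<epsilon> p) \<le> \<epsilon> ^ m" .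
    qed
  qed
qed

subsection \<open>Generalized numbers\<close>

lemma bigo_power_iff:
  fixes r :: "real \<Rightarrow> 'k::real_normed_vector"
  shows "(\<lambda>\<epsilon>. norm (r \<epsilon>)) \<in> O[at_right 0](g :: real \<Rightarrow> real) \<longleftrightarrow>
    (\<exists>C. \<forall>\<^sub>F \<epsilon> in at_right 0. norm (r \<epsilon>) \<le> C * norm (g \<epsilon>))"
proof
  assume "(\<lambda>\<epsilon>. norm (r \<epsilon>)) \<in> O[at_right 0](g)"
  then obtain C where "\<forall>\<^sub>F \<epsilon> in at_right 0. norm (norm (r \<epsilon>)) \<le> C * norm (g \<epsilon>)"
    by (rule landau_o.bigE)
  then show "\<exists>C. \<forall>\<^sub>F \<epsilon> in at_right 0. norm (r \<epsilon>) \<le> C * norm (g \<epsilon>)" by (intro exI[of _ C]) simp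
next
  assume "\<exists>C. \<forall>\<^sub>F \<epsilon> in at_right 0. norm (r \<epsilon>) \<le> C * norm (g \<epsilon>)"
  then obtain C where "\<forall>\<^sub>F \<epsilon> in at_right 0. norm (r \<epsilon>) \<le> C * norm (g \<epsilon>)" by blast
  then show "(\<lambda>\<epsilon>. norm (r \<epsilon>)) \<in> O[at_right 0](g)" by (intro bigoI[where c = C]) simp
qed

lemma moderate_numbers_iff:
  "r \<in> moderate_numbers \<longleftrightarrow> (\<exists>N::nat. \<forall>\<^sub>F \<epsilon> in at_right 0. norm (r \<epsilon>) \<le> 1 / \<epsilon> ^ N)"
proof
  assume "r \<in> moderate_numbers"
  then obtain N :: nat and C where N: "\<forall>\<^sub>F \<epsilon> in at_right 0. norm (r \<epsilon>) \<le> C * norm (1 / \<epsilon> ^ N)"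
    by (auto simp: moderate_numbers_def bigo_power_iff)
  have "\<forall>\<^sub>F \<epsilon> in at_right 0. norm (r \<epsilon>) \<le> 1 / \<epsilon> ^ Suc N"
    using N eventually_const_le_inverse_power[of C N] eventually_unit_interval by eventually_elim simp
  then show "\<exists>N::nat. \<forall>\<^sub>F \<epsilon> in at_right 0. norm (r \<epsilon>) \<le> 1 / \<epsilon> ^ N" by (rule exI)
next
  assume "\<exists>N::nat. \<forall>\<^sub>F \<epsilon> in at_right 0. norm (r \<epsilon>) \<le> 1 / \<epsilon> ^ N"
  then obtain N :: nat where N: "\<forall>\<^sub>F \<epsilon> in at_right 0. norm (r \<epsilon>) \<le> 1 / \<epsilon> ^ N" by blast
  have "\<forall>\<^sub>F \<epsilon> in at_right 0. norm (r \<epsilon>) \<le> 1 * norm (1 / \<epsilon> ^ N)"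
    using N eventually_unit_interval by eventually_elim simp
  then show "r \<in> moderate_numbers" unfolding moderate_numbers_def bigo_power_iff by blast
qed

text \<open>
  Numbers are nets of constant functions, so the closure properties of local moderateness carry over.
\<close>

lemma moderate_numbers_iff_locally_moderate:
  "r \<in> moderate_numbers \<longleftrightarrow> locally_moderate UNIV (\<lambda>\<epsilon> (_::real). r \<epsilon>)"
proof
  assume "r \<in> moderate_numbers"
  then obtain N :: nat where "\<forall>\<^sub>F \<epsilon> in at_right 0. norm (r \<epsilon>) \<le> 1 / \<epsilon> ^ N"
    unfolding moderate_numbers_iff by (rule exE)
  then show "locally_moderate UNIV (\<lambda>\<epsilon> (_::real). r \<epsilon>)"
    unfolding locally_moderate_def by (intro ballI exI[of _ UNIV] exI[of _ N]) simp
next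
  assume r: "locally_moderate UNIV (\<lambda>\<epsilon> (_::real). r \<epsilon>)"
  obtain N :: nat where "\<forall>\<^sub>F \<epsilon> in at_right 0. \<forall>y\<in>{0::real}. norm (r \<epsilon>) \<le> 1 / \<epsilon> ^ N"
    by (rule locally_moderate_compact[OF r, of "{0::real}"]) auto
  then show "r \<in> moderate_numbers" unfolding moderate_numbers_iff by (intro exI[of _ N]) simp
qed

lemma negligible_numbers_iff:
  "r \<in> negligible_numbers \<longleftrightarrow> negligible_on UNIV (\<lambda>\<epsilon> (_::unit). r \<epsilon>)"
proof
  assume "r \<in> negligible_numbers"
  then have *: "\<exists>C. \<forall>\<^sub>F \<epsilon> in at_right 0. norm (r \<epsilon>) \<le> C * norm (\<epsilon> ^ m)" for m
    by (simp add: negligible_numbers_def bigo_power_iff)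
  show "negligible_on UNIV (\<lambda>\<epsilon> (_::unit). r \<epsilon>)"
  proof (rule negligible_onI)
    fix m
    from *[of m] obtain C where C: "\<forall>\<^sub>F \<epsilon> in at_right 0. norm (r \<epsilon>) \<le> C * norm (\<epsilon> ^ m)" by blast
    have "\<forall>\<^sub>F \<epsilon> in at_right 0. \<forall>p\<in>(UNIV :: unit set). norm (r \<epsilon>) \<le> C * \<epsilon> ^ m"
      using C eventually_unit_interval by eventually_elim simp
    then show "\<exists>C. \<forall>\<^sub>F \<epsilon> in at_right 0. \<forall>p\<in>(UNIV :: unit set). norm (r \<epsilon>) \<le> C * \<epsilon> ^ m" by (rule exI)
  qed
next
  assume "negligible_on UNIV (\<lambda>\<epsilon> (_::unit). r \<epsilon>)"
  then have *: "\<forall>\<^sub>F \<epsilon> in at_right 0. norm (r \<epsilon>) \<le> \<epsilon> ^ m" for m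
    by (simp add: negligible_on_def)
  have "\<forall>\<^sub>F \<epsilon> in at_right 0. norm (r \<epsilon>) \<le> 1 / \<epsilon> ^ 0"
    using *[of 0] by simp
  then have "r \<in> moderate_numbers" unfolding moderate_numbers_iff by (rule exI)
  moreover have "\<forall>\<^sub>F \<epsilon> in at_right 0. norm (r \<epsilon>) \<le> 1 * norm (\<epsilon> ^ m)" for m
    using *[of m] eventually_unit_interval by eventually_elim simp
  ultimately show "r \<in> negligible_numbers" unfolding negligible_numbers_def bigo_power_iff by blast
qed

interpretation numbers: subring_ideal moderate_numbers "negligible_numbers :: (real \<Rightarrow> 'k::real_normed_field) set"
proof
  show "1 \<in> (moderate_numbers :: (real \<Rightarrow> 'k) set)"
    by (simp add: moderate_numbers_iff_locally_moderate one_fun_def locally_moderate_continuous)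
  fix x y :: "real \<Rightarrow> 'k"
  show "- x \<in> moderate_numbers" if "x \<in> moderate_numbers"
    using that by (simp add: moderate_numbers_iff)
  show "x + y \<in> moderate_numbers" "x * y \<in> moderate_numbers"
    if "x \<in> moderate_numbers" "y \<in> moderate_numbers"
    using that locally_moderate_add locally_moderate_mult
    by (auto simp: moderate_numbers_iff_locally_moderate plus_fun_def times_fun_def)
  show "0 \<in> (negligible_numbers :: (real \<Rightarrow> 'k) set)"
    using eventually_unit_interval by (auto simp: negligible_numbers_iff negligible_on_def zero_fun_def elim: eventually_mono)
  show "x + y \<in> negligible_numbers" if "x \<in> negligible_numbers" "y \<in> negligible_numbers"
    using that negligible_on_add by (auto simp: negligible_numbers_iff plus_fun_def)
  show "x * y \<in> negligible_numbers" if x: "x \<in> negligible_numbers" and y: "y \<in> moderate_numbers"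
  proof -
    obtain N :: nat where "\<forall>\<^sub>F \<epsilon> in at_right 0. norm (y \<epsilon>) \<le> 1 / \<epsilon> ^ N"
      using y unfolding moderate_numbers_iff by (rule exE)
    then show ?thesis
      using x negligible_on_mult[of UNIV "\<lambda>\<epsilon> (_::unit). x \<epsilon>" "\<lambda>\<epsilon> _. y \<epsilon>" N]
      by (simp add: negligible_numbers_iff times_fun_def)
  qed
qed (auto simp: negligible_numbers_def)

lemma moderate_number_ring_eq: "moderate_number_ring = numbers.R"
  by (simp add: moderate_number_ring_def numbers.R_def plus_fun_def times_fun_def zero_fun_def one_fun_def fun_eq_iff)

subsection \<open>Generalized functions\<close>

context smooth_manifold
begin

lemma negligible_nets_iff:
  fixes u :: "real \<Rightarrow> 'a \<Rightarrow> 'k::real_normed_field"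
  shows "u \<in> negligible_nets A \<longleftrightarrow> u \<in> moderate_nets A \<and> (\<forall>K. compact K \<longrightarrow> negligible_on K u)"
proof (intro iffI conjI allI impI)
  fix K :: "'a set" assume u: "u \<in> negligible_nets A" and K: "compact K"
  then have mod: "u \<in> moderate_nets A" by (simp add: negligible_nets_def)
  show "negligible_on K u"
  proof (cases "K = {}")
    case False
    show ?thesis
    proof (rule negligible_onI)
      fix m
      have O: "(\<lambda>\<epsilon>. SUP p\<in>K. norm (u \<epsilon> p)) \<in> O[at_right 0](\<lambda>\<epsilon>. \<epsilon> ^ m)"
        using u K False by (simp add: negligible_nets_def)
      have "bdd_above ((\<lambda>p. norm (u \<epsilon> p)) ` K)" if "\<epsilon> \<in> {0<..1}" for \<epsilon>
        using continuous_on_subset[OF smooth_function_continuous[OF moderate_nets_smooth[OF mod that]], of K] K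
        by (intro bounded_imp_bdd_above compact_imp_bounded compact_continuous_image continuous_on_norm) simp_all
      then obtain C where C: "0 < C" "\<forall>\<^sub>F \<epsilon> in at_right 0. \<forall>p\<in>K. norm (u \<epsilon> p) \<le> C * norm (\<epsilon> ^ m)"
        by (rule bigo_SUP_bound[OF O])
      have "\<forall>\<^sub>F \<epsilon> in at_right 0. \<forall>p\<in>K. norm (u \<epsilon> p) \<le> C * \<epsilon> ^ m"
        using C(2) eventually_unit_interval by eventually_elim simp
      then show "\<exists>C. \<forall>\<^sub>F \<epsilon> in at_right 0. \<forall>p\<in>K. norm (u \<epsilon> p) \<le> C * \<epsilon> ^ m" by (rule exI)
    qed
  qed (simp add: negligible_on_def)
next
  assume u: "u \<in> moderate_nets A \<and> (\<forall>K. compact K \<longrightarrow> negligible_on K u)"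
  have "(\<lambda>\<epsilon>. SUP p\<in>K. norm (u \<epsilon> p)) \<in> O[at_right 0](\<lambda>\<epsilon>. \<epsilon> ^ m)" if K: "compact K" "K \<noteq> {}" for K m
  proof (rule SUP_bigo[OF K(2), where C = 1])
    have "\<forall>\<^sub>F \<epsilon> in at_right 0. \<forall>p\<in>K. norm (u \<epsilon> p) \<le> \<epsilon> ^ m"
      using u K(1) by (simp add: negligible_on_def)
    then show "\<forall>\<^sub>F \<epsilon> in at_right 0. \<forall>p\<in>K. norm (u \<epsilon> p) \<le> 1 * norm (\<epsilon> ^ m)"
      using eventually_unit_interval by eventually_elim simp
  qed
  then show "u \<in> negligible_nets A" using u by (simp add: negligible_nets_def)
qed (simp add: negligible_nets_def)

lemma moderate_nets_locally_moderate:
  assumes u: "u \<in> moderate_nets A" shows "locally_moderate UNIV u"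
proof (rule locally_moderate_open_cover)
  fix p :: 'a
  obtain U \<phi> where c: "(U, \<phi>) \<in> A" "p \<in> U" by (rule chart_exists)
  have "locally_moderate (\<phi> ` U) (\<lambda>\<epsilon>. iter_deriv [] (u \<epsilon> \<circ> inv_into U \<phi>))"
    using moderate_nets_imp_moderate_on[OF u c(1)] unfolding moderate_on_def by blast
  then have "locally_moderate (\<phi> ` U) (\<lambda>\<epsilon>. u \<epsilon> \<circ> inv_into U \<phi>)" by simp
  from locally_moderate_chart_compose[OF c(1) this] have "locally_moderate U u"
    by (rule locally_moderate_cong) (simp add: chart_inverse[OF c(1)])
  then show "\<exists>V. open V \<and> p \<in> V \<and> locally_moderate V u"
    using c chart_open by blast
qed

lemma moderate_nets_compact_bound:
  assumes u: "u \<in> moderate_nets A" and K: "compact K"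
  obtains N where "bounded_by_power K u N"
  by (rule locally_moderate_compact[OF moderate_nets_locally_moderate[OF u] K]) auto

lemma moderate_nets_const:
  assumes "locally_moderate UNIV (\<lambda>\<epsilon> (_::real). r \<epsilon>)"
  shows "(\<lambda>\<epsilon> p. r \<epsilon>) \<in> moderate_nets A"
proof (rule moderate_on_imp_moderate_nets)
  fix U \<phi> assume c: "(U, \<phi>) \<in> A"
  obtain N :: nat where "\<forall>\<^sub>F \<epsilon> in at_right 0. \<forall>y\<in>{0::real}. norm (r \<epsilon>) \<le> 1 / \<epsilon> ^ N"
    by (rule locally_moderate_compact[OF assms, of "{0::real}"]) auto
  then have "locally_moderate (\<phi> ` U) (\<lambda>\<epsilon> x. r \<epsilon>)"
    unfolding locally_moderate_def by (intro ballI exI[of _ UNIV] exI[of _ N]) (auto elim: eventually_mono)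
  then show "moderate_on (\<phi> ` U) (\<lambda>\<epsilon>. (\<lambda>p. r \<epsilon>) \<circ> inv_into U \<phi>)"
    using moderate_on_const by (simp add: o_def)
qed

lemma moderate_nets_add:
  assumes "u \<in> moderate_nets A" "v \<in> moderate_nets A"
  shows "(\<lambda>\<epsilon> p. u \<epsilon> p + v \<epsilon> p) \<in> moderate_nets A"
proof (rule moderate_on_imp_moderate_nets)
  fix U \<phi> assume c: "(U, \<phi>) \<in> A"
  show "moderate_on (\<phi> ` U) (\<lambda>\<epsilon>. (\<lambda>p. u \<epsilon> p + v \<epsilon> p) \<circ> inv_into U \<phi>)"
    using moderate_on_add[OF chart_image_open[OF c] assms[THEN moderate_nets_imp_moderate_on, OF c]]
    by (simp add: o_def)
qed

lemma moderate_nets_mult: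
  assumes "u \<in> moderate_nets A" "v \<in> moderate_nets A"
  shows "(\<lambda>\<epsilon> p. u \<epsilon> p * v \<epsilon> p) \<in> moderate_nets A"
proof (rule moderate_on_imp_moderate_nets)
  fix U \<phi> assume c: "(U, \<phi>) \<in> A"
  show "moderate_on (\<phi> ` U) (\<lambda>\<epsilon>. (\<lambda>p. u \<epsilon> p * v \<epsilon> p) \<circ> inv_into U \<phi>)"
    using moderate_on_mult[OF chart_image_open[OF c] assms[THEN moderate_nets_imp_moderate_on, OF c]]
    by (simp add: o_def)
qed

lemma moderate_nets_bounded_linear:
  assumes "bounded_linear L" "u \<in> moderate_nets A"
  shows "(\<lambda>\<epsilon> p. L (u \<epsilon> p)) \<in> moderate_nets A"
proof (rule moderate_on_imp_moderate_nets)
  fix U \<phi> assume c: "(U, \<phi>) \<in> A"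
  show "moderate_on (\<phi> ` U) (\<lambda>\<epsilon>. (\<lambda>p. L (u \<epsilon> p)) \<circ> inv_into U \<phi>)"
    using moderate_on_bounded_linear[OF chart_image_open[OF c] assms(1) moderate_nets_imp_moderate_on[OF assms(2) c]]
    by (simp add: o_def)
qed

lemma nets_subring_ideal:
  "subring_ideal (moderate_nets A) (negligible_nets A :: (real \<Rightarrow> 'a \<Rightarrow> 'k::real_normed_field) set)"
proof
  show one: "1 \<in> (moderate_nets A :: (real \<Rightarrow> 'a \<Rightarrow> 'k) set)"
    using moderate_nets_const[of "\<lambda>_. 1 :: 'k"] by (simp add: one_fun_def locally_moderate_continuous)
  fix x y :: "real \<Rightarrow> 'a \<Rightarrow> 'k"
  show "- x \<in> moderate_nets A" if "x \<in> moderate_nets A"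
    using moderate_nets_bounded_linear[OF bounded_linear_minus[OF bounded_linear_ident] that]
    by (simp add: fun_Compl_def)
  show "x + y \<in> moderate_nets A" "x * y \<in> moderate_nets A"
    if "x \<in> moderate_nets A" "y \<in> moderate_nets A"
    using moderate_nets_add[OF that] moderate_nets_mult[OF that] by (simp_all add: plus_fun_def times_fun_def)
  have "(0 :: real \<Rightarrow> 'a \<Rightarrow> 'k) \<in> moderate_nets A"
    using moderate_nets_const[of "\<lambda>_. 0 :: 'k"] by (simp add: zero_fun_def locally_moderate_continuous)
  then show "0 \<in> (negligible_nets A :: (real \<Rightarrow> 'a \<Rightarrow> 'k) set)"
    using eventually_unit_interval
    by (auto simp: negligible_nets_iff negligible_on_def zero_fun_def elim: eventually_mono)
  show "x + y \<in> negligible_nets A" if "x \<in> negligible_nets A" "y \<in> negligible_nets A"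
    using that moderate_nets_add[of x y]
    by (auto simp: negligible_nets_iff plus_fun_def intro!: negligible_on_add)
  show "x * y \<in> negligible_nets A" if x: "x \<in> negligible_nets A" and y: "y \<in> moderate_nets A"
  proof -
    have "negligible_on K (\<lambda>\<epsilon> p. x \<epsilon> p * y \<epsilon> p)" if K: "compact K" for K
    proof -
      obtain N :: nat where "bounded_by_power K y N"
        by (rule moderate_nets_compact_bound[OF y K])
      then show ?thesis using x K by (intro negligible_on_mult) (simp_all add: negligible_nets_iff)
    qed
    then show ?thesis using x y moderate_nets_mult[of x y] by (simp add: negligible_nets_iff times_fun_def)
  qed
qed (auto simp: negligible_nets_def)

lemma moderate_ring_eq:
  "moderate_ring A = subring_ideal.R (moderate_nets A :: (real \<Rightarrow> 'a \<Rightarrow> 'k::real_normed_field) set)"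
  by (simp add: moderate_ring_def subring_ideal.R_def[OF nets_subring_ideal]
      plus_fun_def times_fun_def zero_fun_def one_fun_def fun_eq_iff)

end

section \<open>Lengths of curves and point values\<close>

text \<open>
  The fundamental theorem of calculus is applied to the component of the curve in the direction of
  \<open>\<sigma> b - \<sigma> a\<close>. The set \<open>E\<close> omits the break points and the endpoints; there the derivative is
  continuous, so that the integrand is measurable. Any larger integrand, measurable or not, then has
  an integral of at least the distance of the endpoints.
\<close>

lemma dist_endpoints_le_nn_integral_speed:
  fixes \<sigma> :: "real \<Rightarrow> 'e::real_inner"
  assumes ab: "a \<le> b" and "\<sigma> piecewise_C1_differentiable_on {a..b}"
  obtains E where "E \<subseteq> {a<..<b}"
    "\<And>t. t \<in> E \<Longrightarrow> (\<sigma> has_vector_derivative vector_derivative \<sigma> (at t)) (at t)"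
    "(\<lambda>t. indicator E t * norm (vector_derivative \<sigma> (at t))) \<in> borel_measurable borel"
    "ennreal (norm (\<sigma> b - \<sigma> a)) \<le> (\<integral>\<^sup>+ t. ennreal (indicator E t * norm (vector_derivative \<sigma> (at t))) \<partial>lborel)"
proof -
  from assms(2) obtain S where cont: "continuous_on {a..b} \<sigma>" and S: "finite S"
    and "\<sigma> C1_differentiable_on {a..b} - S"
    unfolding piecewise_C1_differentiable_on_def by blast
  then have diff: "\<And>t. t \<in> {a..b} - S \<Longrightarrow> (\<sigma> has_vector_derivative vector_derivative \<sigma> (at t)) (at t)"
    and cD: "continuous_on ({a..b} - S) (\<lambda>t. vector_derivative \<sigma> (at t))"
    unfolding C1_differentiable_on_eq by (auto simp: vector_derivative_works)
  define E where "E = {a<..<b} - S"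
  define F where "F t = indicator E t * norm (vector_derivative \<sigma> (at t))" for t
  have E: "E \<subseteq> {a<..<b}" "E \<subseteq> {a..b} - S" by (auto simp: E_def)
  have "E \<in> sets borel" unfolding E_def using borel_closed[OF finite_imp_closed[OF S]] by auto
  then have meas: "F \<in> borel_measurable borel"
    using borel_measurable_continuous_on_indicator[of E "\<lambda>t. norm (vector_derivative \<sigma> (at t))"]
      continuous_on_norm[OF continuous_on_subset[OF cD E(2)]] by (simp add: F_def[abs_def])
  have "ennreal (norm (\<sigma> b - \<sigma> a)) \<le> (\<integral>\<^sup>+ t. ennreal (F t) \<partial>lborel)"
  proof (cases "(\<integral>\<^sup>+ t. ennreal (F t) \<partial>lborel) < \<infinity>")
    case True
    have F0: "0 \<le> F t" for t by (simp add: F_def)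
    have int: "integrable lborel F"
      by (rule integrableI_nonneg) (use meas True F0 in auto)
    have nn: "(\<integral>\<^sup>+ t. ennreal (F t) \<partial>lborel) = ennreal (integral\<^sup>L lborel F)"
      by (rule nn_integral_eq_integral[OF int]) (use F0 in auto)
    \<comment> \<open>A unit vector, or zero if the endpoints coincide.\<close>
    define e where "e = (\<sigma> b - \<sigma> a) /\<^sub>R norm (\<sigma> b - \<sigma> a)"
    have e1: "norm e \<le> 1" by (cases "\<sigma> b = \<sigma> a") (simp_all add: e_def)
    have "((\<lambda>t. vector_derivative \<sigma> (at t) \<bullet> e) has_integral (\<sigma> b \<bullet> e - \<sigma> a \<bullet> e)) {a..b}"
    proof (rule fundamental_theorem_of_calculus_interior_strong[OF S ab])
      fix t assume "t \<in> {a<..<b} - S"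
      then have "t \<in> {a..b} - S" by auto
      from bounded_linear.has_vector_derivative[OF bounded_linear_inner_left diff[OF this]]
      show "((\<lambda>t. \<sigma> t \<bullet> e) has_vector_derivative vector_derivative \<sigma> (at t) \<bullet> e) (at t)" .
    qed (intro continuous_intros cont)
    moreover have "\<sigma> b \<bullet> e - \<sigma> a \<bullet> e = norm (\<sigma> b - \<sigma> a)"
    proof -
      have "\<sigma> b \<bullet> e - \<sigma> a \<bullet> e = inverse (norm (\<sigma> b - \<sigma> a)) * ((\<sigma> b - \<sigma> a) \<bullet> (\<sigma> b - \<sigma> a))"
        unfolding inner_diff_left[symmetric] by (simp add: e_def)
      also have "\<dots> = inverse (norm (\<sigma> b - \<sigma> a)) * (norm (\<sigma> b - \<sigma> a) * norm (\<sigma> b - \<sigma> a))"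
        by (simp only: power2_norm_eq_inner[symmetric] power2_eq_square)
      finally show ?thesis by (cases "\<sigma> b = \<sigma> a") simp_all
    qed
    ultimately have 1: "((\<lambda>t. vector_derivative \<sigma> (at t) \<bullet> e) has_integral norm (\<sigma> b - \<sigma> a)) {a..b}" by simp
    have "((\<lambda>t. indicator E t * (vector_derivative \<sigma> (at t) \<bullet> e)) has_integral norm (\<sigma> b - \<sigma> a)) {a..b}"
      by (rule has_integral_spike_finite[OF _ _ 1, of "insert a (insert b S)"])
        (use S in \<open>auto simp: E_def indicator_def\<close>)
    then have 2: "((\<lambda>t. indicator E t * (vector_derivative \<sigma> (at t) \<bullet> e)) has_integral norm (\<sigma> b - \<sigma> a)) UNIV"
      by (rule has_integral_on_superset) (auto simp: E_def indicator_def)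
    have "norm (\<sigma> b - \<sigma> a) \<le> integral\<^sup>L lborel F"
    proof (rule has_integral_le[OF 2 has_integral_integral_lborel[OF int]])
      fix t
      have "vector_derivative \<sigma> (at t) \<bullet> e \<le> norm (vector_derivative \<sigma> (at t)) * norm e"
        by (rule norm_cauchy_schwarz)
      also have "\<dots> \<le> norm (vector_derivative \<sigma> (at t)) * 1" by (rule mult_left_mono[OF e1]) simp
      finally show "indicator E t * (vector_derivative \<sigma> (at t) \<bullet> e) \<le> F t"
        by (auto simp: F_def indicator_def)
    qed
    then show ?thesis unfolding nn by (rule ennreal_leI)
  qed (simp add: not_less top_unique)
  then show thesis
    using that[of E] E meas diff unfolding F_def[abs_def] by blast
qed

context smooth_manifold
begin

lemma riemannian_metricD:
  assumes "riemannian_metric A h" "(U, \<phi>) \<in> A"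
  shows "p \<in> U \<Longrightarrow> bilinear (h (U, \<phi>) p)"
    and "p \<in> U \<Longrightarrow> v \<noteq> 0 \<Longrightarrow> 0 < h (U, \<phi>) p v v"
    and "smooth_on (\<phi> ` U) (\<lambda>x. h (U, \<phi>) (inv_into U \<phi> x) v w)"
    and "(V, \<psi>) \<in> A \<Longrightarrow> p \<in> U \<Longrightarrow> p \<in> V \<Longrightarrow> h (U, \<phi>) p v w =
      h (V, \<psi>) p (\<D> (\<psi> \<circ> inv_into U \<phi>) (\<phi> p) v)
        (\<D> (\<psi> \<circ> inv_into U \<phi>) (\<phi> p) w)"
proof -
  note h = assms(1)[unfolded riemannian_metric_def Let_def]
  note h1 = bspec[OF conjunct1[OF h] assms(2), unfolded split_conv]
    and h2 = bspec[OF conjunct1[OF conjunct2[OF h]] assms(2), unfolded split_conv]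
    and h3 = bspec[OF conjunct2[OF conjunct2[OF h]] assms(2), unfolded split_conv]
  show "bilinear (h (U, \<phi>) p)" if "p \<in> U" using bspec[OF h1 that] by blast
  show "0 < h (U, \<phi>) p v v" if "p \<in> U" "v \<noteq> 0" using bspec[OF h1 that(1)] that(2) by blast
  show "smooth_on (\<phi> ` U) (\<lambda>x. h (U, \<phi>) (inv_into U \<phi> x) v w)" using h2 by blast
  show "h (U, \<phi>) p v w = h (V, \<psi>) p (\<D> (\<psi> \<circ> inv_into U \<phi>) (\<phi> p) v)
        (\<D> (\<psi> \<circ> inv_into U \<phi>) (\<phi> p) w)"
    if "(V, \<psi>) \<in> A" "p \<in> U" "p \<in> V"
    using bspec[OF bspec[OF h3 that(1), unfolded split_conv], of p] that(2,3) by blast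
qed

text \<open>
  The speed is defined through an arbitrarily chosen chart; by the transformation law of the metric
  and the chain rule any other chart gives the same value.
\<close>

lemma riemannian_speed_chart:
  assumes h: "riemannian_metric A h" and c: "(U, \<phi>) \<in> A" and t: "\<gamma> t \<in> U" "isCont \<gamma> t"
    and v: "((\<phi> \<circ> \<gamma>) has_vector_derivative v) (at t)"
  shows "riemannian_speed A h \<gamma> t = sqrt (h (U, \<phi>) (\<gamma> t) v v)"
proof -
  obtain V \<psi> where V: "(SOME c. c \<in> A \<and> \<gamma> t \<in> fst c) = (V, \<psi>)" by fastforce
  have "(U, \<phi>) \<in> A \<and> \<gamma> t \<in> fst (U, \<phi>)" using c t by simp
  then have "(V, \<psi>) \<in> A \<and> \<gamma> t \<in> fst (V, \<psi>)" unfolding V[symmetric] by (rule someI)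
  then have d: "(V, \<psi>) \<in> A" "\<gamma> t \<in> V" by auto
  let ?D = "\<D> (\<psi> \<circ> inv_into U \<phi>) (\<phi> (\<gamma> t))"
  have "((\<psi> \<circ> inv_into U \<phi>) has_derivative ?D) (at ((\<phi> \<circ> \<gamma>) t))"
    using transition_differentiable[OF c d(1) t(1) d(2)] by (simp add: frechet_derivative_works)
  then have D: "((\<psi> \<circ> inv_into U \<phi> \<circ> (\<phi> \<circ> \<gamma>)) has_vector_derivative ?D v) (at t)"
    using vector_derivative_diff_chain_within[OF v, of "\<psi> \<circ> inv_into U \<phi>" ?D] has_derivative_at_withinI by blast
  obtain N where N: "open N" "t \<in> N" "\<And>s. s \<in> N \<Longrightarrow> \<gamma> s \<in> U"
    using t(2)[unfolded continuous_at_open, THEN spec, of U, THEN mp, OF conjI, OF chart_open[OF c] t(1)]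
    by blast
  have "((\<psi> \<circ> \<gamma>) has_vector_derivative ?D v) (at t)"
    by (rule has_vector_derivative_transform_within_open[OF D N(1,2)]) (simp add: chart_inverse[OF c] N(3))
  then have "vector_derivative (\<psi> \<circ> \<gamma>) (at t) = ?D v" by (rule vector_derivative_at)
  then show ?thesis
    using riemannian_metricD(4)[OF h c d(1) t(1) d(2), of v v]
    by (simp add: riemannian_speed_def V Let_def)
qed

lemma riemannian_length_ge_chart_dist:
  assumes h: "riemannian_metric A h" and c: "(U, \<phi>) \<in> A" and \<gamma>: "piecewise_C1_curve A \<gamma>"
    and T: "0 \<le> T" "T \<le> 1" and S: "\<gamma> ` {0..T} \<subseteq> S" "S \<subseteq> U"
    and low: "\<And>p v. p \<in> S \<Longrightarrow> C * norm v \<le> sqrt (h (U, \<phi>) p v v)" and C: "0 \<le> C"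
  shows "ennreal (C * norm (\<phi> (\<gamma> T) - \<phi> (\<gamma> 0))) \<le> riemannian_length A h \<gamma>"
proof -
  have "{0..T} \<subseteq> {0..1} \<and> \<gamma> ` {0..T} \<subseteq> U" using T S by auto
  then have pw: "(\<phi> \<circ> \<gamma>) piecewise_C1_differentiable_on {0..T}"
    using bspec[OF conjunct2[OF \<gamma>[unfolded piecewise_C1_curve_def]] c, unfolded split_conv] by blast
  have path: "continuous_on {0..1} \<gamma>" using \<gamma> by (simp add: piecewise_C1_curve_def path_def)
  obtain E where E: "E \<subseteq> {0<..<T}"
    "\<And>t. t \<in> E \<Longrightarrow> ((\<phi> \<circ> \<gamma>) has_vector_derivative vector_derivative (\<phi> \<circ> \<gamma>) (at t)) (at t)"
    "(\<lambda>t. indicator E t * norm (vector_derivative (\<phi> \<circ> \<gamma>) (at t))) \<in> borel_measurable borel"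
    "ennreal (norm ((\<phi> \<circ> \<gamma>) T - (\<phi> \<circ> \<gamma>) 0)) \<le> (\<integral>\<^sup>+ t. ennreal (indicator E t * norm (vector_derivative (\<phi> \<circ> \<gamma>) (at t))) \<partial>lborel)"
    by (rule dist_endpoints_le_nn_integral_speed[OF T(1) pw]) blast
  have "ennreal (C * norm (\<phi> (\<gamma> T) - \<phi> (\<gamma> 0))) = ennreal C * ennreal (norm ((\<phi> \<circ> \<gamma>) T - (\<phi> \<circ> \<gamma>) 0))"
    using C by (simp add: ennreal_mult)
  also have "\<dots> \<le> ennreal C * (\<integral>\<^sup>+ t. ennreal (indicator E t * norm (vector_derivative (\<phi> \<circ> \<gamma>) (at t))) \<partial>lborel)"
    by (rule mult_left_mono[OF E(4)]) simp
  also have "\<dots> = (\<integral>\<^sup>+ t. ennreal C * ennreal (indicator E t * norm (vector_derivative (\<phi> \<circ> \<gamma>) (at t))) \<partial>lborel)"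
    by (rule nn_integral_cmult[symmetric]) (use E(3) in simp)
  also have "\<dots> \<le> (\<integral>\<^sup>+ t. ennreal (riemannian_speed A h \<gamma> t) * indicator {0..1} t \<partial>lborel)"
  proof (rule nn_integral_mono)
    fix t
    show "ennreal C * ennreal (indicator E t * norm (vector_derivative (\<phi> \<circ> \<gamma>) (at t)))
      \<le> ennreal (riemannian_speed A h \<gamma> t) * indicator {0..1} t"
    proof (cases "t \<in> E")
      case True
      then have t: "0 < t" "t < T" using E(1) by auto
      then have \<gamma>S: "\<gamma> t \<in> S" using S by auto
      have "isCont \<gamma> t" using continuous_on_interior[OF path] t T(2) by simp
      from riemannian_speed_chart[where \<gamma> = \<gamma>, OF h c _ this E(2)[OF True]]
      have "riemannian_speed A h \<gamma> t =
        sqrt (h (U, \<phi>) (\<gamma> t) (vector_derivative (\<phi> \<circ> \<gamma>) (at t)) (vector_derivative (\<phi> \<circ> \<gamma>) (at t)))"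
        using \<gamma>S S(2) by blast
      then have "C * norm (vector_derivative (\<phi> \<circ> \<gamma>) (at t)) \<le> riemannian_speed A h \<gamma> t"
        using low[OF \<gamma>S] by simp
      then show ?thesis using True t T C by (simp add: ennreal_mult[symmetric] ennreal_leI)
    qed simp
  qed
  finally show ?thesis by (simp add: riemannian_length_def)
qed

text \<open>
  The quadratic forms attain a positive minimum on the compact product of \<open>L\<close> with the unit sphere,
  unless this product is empty, as for a model space of dimension zero.
\<close>

lemma riemannian_metric_lower_bound:
  assumes h: "riemannian_metric A h" and c: "(U, \<phi>) \<in> A" and L: "compact L" "L \<subseteq> \<phi> ` U"
  obtains C where "0 < C" "\<And>x v. x \<in> L \<Longrightarrow> C * norm v \<le> sqrt (h (U, \<phi>) (inv_into U \<phi> x) v v)"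
proof -
  obtain B :: "'e set" where B: "finite B" "\<And>x. (\<Sum>b\<in>B. (x \<bullet> b) *\<^sub>R b) = x"
    using finite_orthonormal_basis_exists by blast
  define H where "H x = h (U, \<phi>) (inv_into U \<phi> x)" for x
  have bil: "bilinear (H x)" if "x \<in> L" for x
    unfolding H_def by (rule riemannian_metricD(1)[OF h c chart_inverse_mem]) (use that L in blast)
  have posH: "0 < H x v v" if "x \<in> L" "v \<noteq> 0" for x v
    unfolding H_def by (rule riemannian_metricD(2)[OF h c chart_inverse_mem]) (use that L in blast)+
  have H_eq: "H x v v = (\<Sum>b\<in>B. \<Sum>b'\<in>B. (v \<bullet> b) * (v \<bullet> b') * H x b b')" if "x \<in> L" for x v
  proof -
    have lin: "linear (\<lambda>y. H x y w)" "linear (H x w)" for w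
      using bil[OF that] by (auto simp: bilinear_def)
    have "H x v v = (\<Sum>b\<in>B. (v \<bullet> b) *\<^sub>R H x b v)"
      by (rule linear_eq_sum_basis[OF lin(1) B(2)])
    also have "\<dots> = (\<Sum>b\<in>B. (v \<bullet> b) *\<^sub>R (\<Sum>b'\<in>B. (v \<bullet> b') *\<^sub>R H x b b'))"
      by (intro sum.cong refl arg_cong2[where f = scaleR] linear_eq_sum_basis[OF lin(2) B(2)])
    finally show ?thesis by (simp add: sum_distrib_left mult.assoc)
  qed
  have contH: "continuous_on L (\<lambda>x. H x b b')" for b b'
    unfolding H_def by (rule continuous_on_subset[OF smooth_on_continuous_on[OF riemannian_metricD(3)[OF h c]] L(2)])
  have cont: "continuous_on (L \<times> sphere 0 1) (\<lambda>z. H (fst z) (snd z) (snd z))"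
  proof (rule continuous_on_eq)
    show "continuous_on (L \<times> sphere 0 1) (\<lambda>z. \<Sum>b\<in>B. \<Sum>b'\<in>B. (snd z \<bullet> b) * (snd z \<bullet> b') * H (fst z) b b')"
      by (intro continuous_intros continuous_on_compose2[OF contH]) auto
  qed (use H_eq in auto)
  have zero: "H x 0 0 = 0" if "x \<in> L" for x
    using bilinear_lzero[OF bil[OF that]] by simp
  show thesis
  proof (cases "L \<times> sphere (0::'e) 1 = {}")
    case True
    have "1 * norm v \<le> sqrt (H x v v)" if x: "x \<in> L" for x v
    proof -
      have "sphere (0::'e) 1 = {}" using True x by blast
      have "v = 0"
      proof (rule ccontr)
        assume "v \<noteq> 0"
        then have "v /\<^sub>R norm v \<in> sphere 0 1" by simp
        with \<open>sphere (0::'e) 1 = {}\<close> show False by blast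
      qed
      then show ?thesis using zero[OF x] by simp
    qed
    then show thesis using that[of 1] by (simp add: H_def)
  next
    case False
    have sphere: "compact (sphere (0::'e) 1)"
      by (rule compact_diff[of "cball 0 1" "ball 0 1", unfolded cball_diff_eq_sphere]) auto
    obtain z where z: "z \<in> L \<times> sphere 0 1" "\<And>y. y \<in> L \<times> sphere 0 1 \<Longrightarrow> H (fst z) (snd z) (snd z) \<le> H (fst y) (snd y) (snd y)"
      using continuous_attains_inf[OF compact_Times[OF L(1) sphere] False cont] by blast
    define m where "m = H (fst z) (snd z) (snd z)"
    have m: "0 < m" unfolding m_def by (rule posH) (use z(1) in auto)
    have "sqrt m * norm v \<le> sqrt (H x v v)" if x: "x \<in> L" for x v
    proof (cases "v = 0")
      case True
      then show ?thesis using zero[OF x] by simp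
    next
      case False
      define w where "w = v /\<^sub>R norm v"
      have v: "v = norm v *\<^sub>R w" using False by (simp add: w_def)
      have "m \<le> H x w w" using z(2)[of "(x, w)"] x False by (simp add: m_def w_def)
      then have "m * (norm v)\<^sup>2 \<le> H x w w * (norm v)\<^sup>2" by (rule mult_right_mono) simp
      also have "\<dots> = H x (norm v *\<^sub>R w) (norm v *\<^sub>R w)"
        by (simp add: bilinear_lmul[OF bil[OF x]] bilinear_rmul[OF bil[OF x]] power2_eq_square)
      also have "\<dots> = H x v v" using v by simp
      finally have "sqrt (m * (norm v)\<^sup>2) \<le> sqrt (H x v v)" by (rule real_sqrt_le_mono)
      then show ?thesis by (simp add: real_sqrt_mult)
    qed
    then show thesis using that[of "sqrt m"] m by (simp add: H_def)
  qed
qed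

text \<open>
  A curve that leaves the ball of radius \<open>r\<close> has covered a coordinate distance of at least \<open>r / 2\<close> at
  the first exit time \<open>T\<close>, hence a length of at least \<open>C * (r / 2)\<close>. A shorter curve stays in the chart
  until its end, where its length bounds the coordinate distance of the endpoints.
\<close>

lemma riemannian_dist_controls_chart:
  assumes h: "riemannian_metric A h" and c: "(U, \<phi>) \<in> A" and r: "0 < r" "cball x r \<subseteq> \<phi> ` U"
  obtains C where "0 < C"
    "\<And>p q t. p \<in> inv_into U \<phi> ` ball x (r / 2) \<Longrightarrow> t < C * (r / 2) \<Longrightarrow> riemannian_dist A h p q < ennreal t \<Longrightarrow>
      q \<in> inv_into U \<phi> ` cball x r \<and> C * norm (\<phi> q - \<phi> p) \<le> t"
proof -
  define K where "K = inv_into U \<phi> ` cball x r"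
  define B where "B = inv_into U \<phi> ` ball x r"
  have rb: "ball x r \<subseteq> \<phi> ` U" using r(2) by (meson ball_subset_cball order_trans)
  have rb2: "ball x (r / 2) \<subseteq> \<phi> ` U" 
    by (rule order_trans[OF subset_ball rb]) (use r(1) in simp)
  have memK: "p \<in> K \<longleftrightarrow> p \<in> U \<and> \<phi> p \<in> cball x r" for p
    unfolding K_def by (rule mem_chart_preimage_iff[OF c r(2)])
  have memB: "p \<in> B \<longleftrightarrow> p \<in> U \<and> \<phi> p \<in> ball x r" for p
    unfolding B_def by (rule mem_chart_preimage_iff[OF c rb])
  have "compact K" unfolding K_def by (rule compact_chart_preimage[OF c compact_cball r(2)])
  then have K: "closed K" by (rule compact_imp_closed)
  have B: "open B" unfolding B_def by (rule open_chart_preimage[OF c open_ball rb])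
  have BK: "B \<subseteq> K" using memB memK by auto
  have KU: "K \<subseteq> U" using memK by blast
  obtain C where C: "0 < C" "\<And>y v. y \<in> cball x r \<Longrightarrow> C * norm v \<le> sqrt (h (U, \<phi>) (inv_into U \<phi> y) v v)"
    by (rule riemannian_metric_lower_bound[OF h c compact_cball r(2)]) blast
  have low: "C * norm v \<le> sqrt (h (U, \<phi>) q v v)" if "q \<in> K" for q v
    using C(2) that unfolding K_def by blast
  have "q \<in> K \<and> C * norm (\<phi> q - \<phi> p) \<le> t"
    if p: "p \<in> inv_into U \<phi> ` ball x (r / 2)" and t: "t < C * (r / 2)" and d: "riemannian_dist A h p q < ennreal t" for p q t
  proof -
    have pU: "p \<in> U" "norm (\<phi> p - x) < r / 2"
      using p mem_chart_preimage_iff[OF c rb2] by (auto simp: dist_norm norm_minus_commute)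
    obtain \<gamma> where \<gamma>: "piecewise_C1_curve A \<gamma>" "pathstart \<gamma> = p" "pathfinish \<gamma> = q"
      and len: "riemannian_length A h \<gamma> < ennreal t"
      using d unfolding riemannian_dist_def INF_less_iff by blast
    have path: "continuous_on {0..1} \<gamma>" using \<gamma>(1) by (simp add: piecewise_C1_curve_def path_def)
    have ends: "\<gamma> 0 = p" "\<gamma> 1 = q" using \<gamma>(2,3) by (simp_all add: pathstart_def pathfinish_def)
    have est: "C * norm (\<phi> (\<gamma> T) - \<phi> p) \<le> t" if T: "0 \<le> T" "T \<le> 1" "\<gamma> ` {0..T} \<subseteq> K" for T
    proof -
      have "ennreal (C * norm (\<phi> (\<gamma> T) - \<phi> (\<gamma> 0))) < ennreal t"
        using riemannian_length_ge_chart_dist[OF h c \<gamma>(1) T KU low] C(1) len by (meson le_less_trans less_imp_le)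
      then show ?thesis using C(1) ends by (simp add: ennreal_less_iff)
    qed
    have "\<gamma> ` {0..1} \<subseteq> B"
    proof (rule ccontr)
      assume "\<not> \<gamma> ` {0..1} \<subseteq> B"
      then have ne: "{0..1} \<inter> \<gamma> -` (- B) \<noteq> {}" by blast
      have cl: "closed ({0..1} \<inter> \<gamma> -` (- B))"
        using B by (intro continuous_closed_preimage path) auto
      then have "compact ({0..1} \<inter> \<gamma> -` (- B))"
        by (meson bounded_closed_interval bounded_subset compact_eq_bounded_closed inf_le1)
      then obtain T where T: "T \<in> {0..1} \<inter> \<gamma> -` (- B)" "\<And>s. s \<in> {0..1} \<inter> \<gamma> -` (- B) \<Longrightarrow> T \<le> s"
        using compact_attains_inf[OF _ ne] by blast
      have "p \<in> B" using pU r(1) memB by (auto simp: dist_norm norm_minus_commute)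
      then have "T \<noteq> 0" using T(1) ends by auto
      then have T0: "0 < T" "T \<le> 1" using T(1) by auto
      have before: "\<gamma> ` {0..<T} \<subseteq> K"
        using T(2) T0 BK by (force simp: not_le[symmetric])
      have "\<gamma> ` closure {0..<T} \<subseteq> K"
        by (rule image_closure_subset[OF _ K before]) (use T0 in \<open>auto intro: continuous_on_subset[OF path]\<close>)
      then have sub: "\<gamma> ` {0..T} \<subseteq> K" using T0 by simp
      from est[OF _ T0(2) sub] T0 have 1: "C * norm (\<phi> (\<gamma> T) - \<phi> p) \<le> t" by simp
      have "\<gamma> T \<in> U" using subsetD[OF order_trans[OF sub KU], of "\<gamma> T"] T0 by simp
      then have "r \<le> norm (\<phi> (\<gamma> T) - x)"
        using T(1) memB[of "\<gamma> T"] by (simp add: dist_norm norm_minus_commute not_less)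
      also have "\<dots> \<le> norm (\<phi> (\<gamma> T) - \<phi> p) + norm (\<phi> p - x)"
        using norm_triangle_ineq[of "\<phi> (\<gamma> T) - \<phi> p" "\<phi> p - x"] by simp
      finally have "r / 2 \<le> norm (\<phi> (\<gamma> T) - \<phi> p)" using pU(2) by linarith
      then have "C * (r / 2) \<le> C * norm (\<phi> (\<gamma> T) - \<phi> p)" using C(1) by (intro mult_left_mono) auto
      then show False using 1 t by linarith
    qed
    then have "\<gamma> ` {0..1} \<subseteq> K" using BK by blast
    then show ?thesis using est[of 1] ends by auto
  qed
  then show thesis using that[OF C(1)] unfolding K_def by blast
qed

text \<open>
  In a coordinate ball the mean value theorem applies, with a bound on the gradient from the
  moderateness of the first derivatives.
\<close>

lemma moderate_net_locally_lipschitz: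
  fixes u :: "real \<Rightarrow> 'a \<Rightarrow> 'k::real_normed_field"
  assumes u: "u \<in> moderate_nets A" and h: "riemannian_metric A h"
  obtains T \<delta> N where "open T" "p\<^sub>0 \<in> T" "0 < \<delta>"
    "\<forall>\<^sub>F \<epsilon> in at_right 0. \<forall>p\<in>T. \<forall>q t. t < \<delta> \<longrightarrow> riemannian_dist A h p q < ennreal t \<longrightarrow>
      norm (u \<epsilon> q - u \<epsilon> p) \<le> t / \<epsilon> ^ (N :: nat)"
proof -
  obtain U \<phi> where c: "(U, \<phi>) \<in> A" "p\<^sub>0 \<in> U" by (rule chart_exists)
  obtain r where r: "0 < r" "cball (\<phi> p\<^sub>0) r \<subseteq> \<phi> ` (U \<inter> U)"
    by (rule chart_cball[OF c(1) chart_open[OF c(1)] c(2) c(2)])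
  have rU: "cball (\<phi> p\<^sub>0) r \<subseteq> \<phi> ` U" using r(2) by simp
  obtain C where C: "0 < C"
    "\<And>p q t. p \<in> inv_into U \<phi> ` ball (\<phi> p\<^sub>0) (r / 2) \<Longrightarrow> t < C * (r / 2) \<Longrightarrow> riemannian_dist A h p q < ennreal t \<Longrightarrow>
      q \<in> inv_into U \<phi> ` cball (\<phi> p\<^sub>0) r \<and> C * norm (\<phi> q - \<phi> p) \<le> t"
    by (rule riemannian_dist_controls_chart[OF h c(1) r(1) rU]) blast
  obtain B :: "'e set" where B: "finite B" "\<And>x. (\<Sum>b\<in>B. (x \<bullet> b) *\<^sub>R b) = x"
    using finite_orthonormal_basis_exists by blast
  define g where "g \<epsilon> = u \<epsilon> \<circ> inv_into U \<phi>" for \<epsilon>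
  have g: "moderate_on (\<phi> ` U) g"
    unfolding g_def[abs_def] by (rule moderate_nets_imp_moderate_on[OF u c(1)])
  define s where "s \<epsilon> x = (\<Sum>b\<in>B. norm b * norm (\<D> (g \<epsilon>) x b))" for \<epsilon> x
  have "locally_moderate (\<phi> ` U) s"
    unfolding s_def[abs_def]
  proof (rule locally_moderate_sum)
    fix b
    have "locally_moderate (\<phi> ` U) (\<lambda>\<epsilon>. iter_deriv [b] (g \<epsilon>))" using g unfolding moderate_on_def by blast
    then show "locally_moderate (\<phi> ` U) (\<lambda>\<epsilon> x. norm b * norm (\<D> (g \<epsilon>) x b))"
      by (rule locally_moderate_bound[where C = "norm b"]) (simp_all add: abs_mult)
  qed
  then obtain N where N: "\<forall>\<^sub>F \<epsilon> in at_right 0. \<forall>x\<in>cball (\<phi> p\<^sub>0) r. norm (s \<epsilon> x) \<le> 1 / \<epsilon> ^ (N :: nat)"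
    by (rule locally_moderate_compact[OF _ compact_cball rU])
  define T where "T = inv_into U \<phi> ` ball (\<phi> p\<^sub>0) (r / 2)"
  have r2: "ball (\<phi> p\<^sub>0) (r / 2) \<subseteq> cball (\<phi> p\<^sub>0) r" using r(1) by auto
  then have r2U: "ball (\<phi> p\<^sub>0) (r / 2) \<subseteq> \<phi> ` U" using rU by blast
  have T: "open T" unfolding T_def by (rule open_chart_preimage[OF c(1) open_ball r2U])
  have T0: "p\<^sub>0 \<in> T" unfolding T_def mem_chart_preimage_iff[OF c(1) r2U] using c(2) r(1) by simp
  have "\<forall>\<^sub>F \<epsilon> in at_right 0. \<forall>p\<in>T. \<forall>q t. t < C * (r / 2) \<longrightarrow> riemannian_dist A h p q < ennreal t \<longrightarrow>
      norm (u \<epsilon> q - u \<epsilon> p) \<le> t / \<epsilon> ^ Suc N"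
    using N eventually_unit_interval eventually_const_le_inverse_power[of "1 / C" N]
  proof eventually_elim
    case (elim \<epsilon>)
    show ?case
    proof (intro ballI allI impI)
      fix p q t assume p: "p \<in> T" and t: "t < C * (r / 2)" "riemannian_dist A h p q < ennreal t"
      have q: "q \<in> inv_into U \<phi> ` cball (\<phi> p\<^sub>0) r" "C * norm (\<phi> q - \<phi> p) \<le> t"
        using C(2)[OF p[unfolded T_def] t] by blast+
      have t0: "0 \<le> t" using t(2) by (metis ennreal_neg less_le_not_le linorder_linear not_less_zero)
      have qU: "q \<in> U" "\<phi> q \<in> cball (\<phi> p\<^sub>0) r" using q(1) mem_chart_preimage_iff[OF c(1) rU] by blast+
      have pU: "p \<in> U" "\<phi> p \<in> cball (\<phi> p\<^sub>0) r"
        using p r2 unfolding T_def mem_chart_preimage_iff[OF c(1) r2U] by blast+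
      have "norm (g \<epsilon> (\<phi> q) - g \<epsilon> (\<phi> p)) \<le> (1 / \<epsilon> ^ N) * norm (\<phi> q - \<phi> p)"
      proof (rule differentiable_bound[OF convex_cball, where f' = "\<lambda>x. \<D> (g \<epsilon>) x"])
        fix x assume x: "x \<in> cball (\<phi> p\<^sub>0) r"
        have diff: "g \<epsilon> differentiable (at x)"
          using g x rU elim(2) smooth_on_differentiable unfolding moderate_on_def by blast
        then show "(g \<epsilon> has_derivative \<D> (g \<epsilon>) x) (at x within cball (\<phi> p\<^sub>0) r)"
          by (simp add: frechet_derivative_works has_derivative_at_withinI)
        show "onorm (\<D> (g \<epsilon>) x) \<le> 1 / \<epsilon> ^ N"
        proof (rule onorm_bound)
          show "0 \<le> 1 / \<epsilon> ^ N" using elim(2) by simp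
          fix v
          have "\<D> (g \<epsilon>) x v = (\<Sum>b\<in>B. (v \<bullet> b) *\<^sub>R \<D> (g \<epsilon>) x b)"
            by (rule linear_eq_sum_basis[OF linear_frechet_derivative[OF diff] B(2)])
          also have "norm \<dots> \<le> (\<Sum>b\<in>B. norm v * norm b * norm (\<D> (g \<epsilon>) x b))"
            by (intro order_trans[OF norm_sum] sum_mono) (auto intro!: mult_right_mono Cauchy_Schwarz_ineq2)
          also have "\<dots> = s \<epsilon> x * norm v"
            by (simp add: s_def sum_distrib_left sum_distrib_right mult_ac)
          also have "\<dots> \<le> (1 / \<epsilon> ^ N) * norm v"
            using elim(1) x by (intro mult_right_mono) (auto dest: bspec)
          finally show "norm (\<D> (g \<epsilon>) x v) \<le> (1 / \<epsilon> ^ N) * norm v" .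
        qed
      qed (use qU pU in auto)
      then have "norm (u \<epsilon> q - u \<epsilon> p) \<le> (1 / \<epsilon> ^ N) * norm (\<phi> q - \<phi> p)"
        using qU pU by (simp add: g_def chart_inverse[OF c(1)])
      \<comment> \<open>The constant \<open>1 / C\<close> costs one more power of \<open>1 / \<epsilon>\<close>.\<close>
      also have "\<dots> \<le> (1 / \<epsilon> ^ N) * (t / C)"
        using q(2) C(1) elim(2) by (intro mult_left_mono) (auto simp: field_simps)
      also have "\<dots> = (1 / C / \<epsilon> ^ N) * t" by simp
      also have "\<dots> \<le> (1 / \<epsilon> ^ Suc N) * t" by (rule mult_right_mono[OF elim(3) t0])
      finally show "norm (u \<epsilon> q - u \<epsilon> p) \<le> t / \<epsilon> ^ Suc N" by simp
    qed
  qed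
  moreover have "0 < C * (r / 2)" using C(1) r(1) by simp
  ultimately show thesis using that[OF T T0] by blast
qed

lemma moderate_net_lipschitz_compact:
  fixes u :: "real \<Rightarrow> 'a \<Rightarrow> 'k::real_normed_field"
  assumes u: "u \<in> moderate_nets A" and h: "riemannian_metric A h" and K: "compact K"
  obtains \<delta> N where "0 < \<delta>"
    "\<forall>\<^sub>F \<epsilon> in at_right 0. \<forall>p\<in>K. \<forall>q t. t < \<delta> \<longrightarrow> riemannian_dist A h p q < ennreal t \<longrightarrow>
      norm (u \<epsilon> q - u \<epsilon> p) \<le> t / \<epsilon> ^ (N :: nat)"
proof -
  define L where "L N \<delta> \<epsilon> p \<longleftrightarrow> (\<forall>q t. t < \<delta> \<longrightarrow> riemannian_dist A h p q < ennreal t \<longrightarrow>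
      norm (u \<epsilon> q - u \<epsilon> p) \<le> t / \<epsilon> ^ N)" for N :: nat and \<delta> \<epsilon> p
  have L_mono: "L N' \<delta>' \<epsilon> p" if "L N \<delta> \<epsilon> p" "N \<le> N'" "\<delta>' \<le> \<delta>" "\<epsilon> \<in> {0<..1}" for N N' \<delta> \<delta>' \<epsilon> p
    unfolding L_def
  proof (intro allI impI)
    fix q t assume t: "t < \<delta>'" "riemannian_dist A h p q < ennreal t"
    have t0: "0 \<le> t" using t(2) by (metis ennreal_neg less_le_not_le linorder_linear not_less_zero)
    have "norm (u \<epsilon> q - u \<epsilon> p) \<le> t / \<epsilon> ^ N" using that(1,3) t unfolding L_def by (meson less_le_trans)
    also have "\<dots> = t * (1 / \<epsilon> ^ N)" by simp
    also have "\<dots> \<le> t * (1 / \<epsilon> ^ N')" by (rule mult_left_mono[OF inverse_power_mono[OF that(4,2)] t0])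
    finally show "norm (u \<epsilon> q - u \<epsilon> p) \<le> t / \<epsilon> ^ N'" by simp
  qed
  define P where "P S \<longleftrightarrow> (\<exists>\<delta> N. 0 < \<delta> \<and> (\<forall>\<^sub>F \<epsilon> in at_right 0. \<forall>p\<in>S. L N \<delta> \<epsilon> p))" for S
  have "P K"
  proof (rule compact_locally_induct[OF K])
    fix p
    obtain T \<delta> N where "open T" "p \<in> T" "0 < \<delta>" "\<forall>\<^sub>F \<epsilon> in at_right 0. \<forall>p\<in>T. L N \<delta> \<epsilon> p"
      unfolding L_def by (rule moderate_net_locally_lipschitz[OF u h])
    then show "\<exists>T. open T \<and> p \<in> T \<and> P T"
      unfolding P_def by (intro exI[of _ T] exI[of _ \<delta>] exI[of _ N] conjI)
  next
    show "P {}" unfolding P_def by (intro exI[of _ 1]) simp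
  next
    fix S T assume "P S" "P T"
    then obtain \<delta> N \<delta>' N' where S: "0 < \<delta>" "\<forall>\<^sub>F \<epsilon> in at_right 0. \<forall>p\<in>S. L N \<delta> \<epsilon> p"
      and T: "0 < \<delta>'" "\<forall>\<^sub>F \<epsilon> in at_right 0. \<forall>p\<in>T. L N' \<delta>' \<epsilon> p"
      unfolding P_def by (elim exE conjE)
    have "\<forall>\<^sub>F \<epsilon> in at_right 0. \<forall>p\<in>S \<union> T. L (max N N') (min \<delta> \<delta>') \<epsilon> p"
      using S(2) T(2) eventually_unit_interval
    proof eventually_elim
      case (elim \<epsilon>)
      show ?case
      proof
        fix p assume "p \<in> S \<union> T"
        then consider "L N \<delta> \<epsilon> p" | "L N' \<delta>' \<epsilon> p" using elim by blast
        then show "L (max N N') (min \<delta> \<delta>') \<epsilon> p"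
          by cases (erule L_mono, use elim(3) in simp_all)+
      qed
    qed
    then show "P (S \<union> T)" unfolding P_def using S(1) T(1)
      by (intro exI[of _ "min \<delta> \<delta>'"] exI[of _ "max N N'"] conjI) simp_all
  next
    fix S T assume "P T" and sub: "S \<subseteq> T"
    then obtain \<delta> N where T: "0 < \<delta>" "\<forall>\<^sub>F \<epsilon> in at_right 0. \<forall>p\<in>T. L N \<delta> \<epsilon> p"
      unfolding P_def by (elim exE conjE)
    have "\<forall>\<^sub>F \<epsilon> in at_right 0. \<forall>p\<in>S. L N \<delta> \<epsilon> p" using T(2) by eventually_elim (use sub in blast)
    then show "P S" unfolding P_def using T(1) by (intro exI[of _ \<delta>] exI[of _ N] conjI)
  qed
  then show thesis unfolding P_def L_def by (elim exE conjE) (rule that)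
qed

lemma equivalent_nets_point_values:
  fixes u :: "real \<Rightarrow> 'a \<Rightarrow> 'k::real_normed_field"
  assumes u: "u \<in> moderate_nets A" and pq: "(p, q) \<in> equivalent_nets A"
  shows "(\<lambda>\<epsilon>. u \<epsilon> (q \<epsilon>) - u \<epsilon> (p \<epsilon>)) \<in> negligible_numbers"
proof -
  from pq obtain h where "p \<in> compactly_supported_nets" and h: "riemannian_metric A h"
    and d: "\<And>m::nat. \<exists>C. \<forall>\<^sub>F \<epsilon> in at_right 0. riemannian_dist A h (p \<epsilon>) (q \<epsilon>) \<le> ennreal (C * \<epsilon> ^ m)"
    unfolding equivalent_nets_def by blast
  then obtain K where K: "compact K" "\<forall>\<^sub>F \<epsilon> in at_right 0. p \<epsilon> \<in> K"
    unfolding compactly_supported_nets_def by blast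
  obtain \<delta> N where \<delta>: "0 < \<delta>"
    and lip: "\<forall>\<^sub>F \<epsilon> in at_right 0. \<forall>p\<in>K. \<forall>q t. t < \<delta> \<longrightarrow> riemannian_dist A h p q < ennreal t \<longrightarrow>
      norm (u \<epsilon> q - u \<epsilon> p) \<le> t / \<epsilon> ^ (N :: nat)"
    by (rule moderate_net_lipschitz_compact[OF u h K(1)])
  show ?thesis unfolding negligible_numbers_iff
  proof (rule negligible_onI)
    fix m
    \<comment> \<open>Of the exponent, \<open>N\<close> compensates the Lipschitz constant and one more power makes \<open>t\<close> smaller than \<open>\<delta>\<close>.\<close>
    obtain C where C: "\<forall>\<^sub>F \<epsilon> in at_right 0. riemannian_dist A h (p \<epsilon>) (q \<epsilon>) \<le> ennreal (C * \<epsilon> ^ Suc (m + N))"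
      using d by blast
    \<comment> \<open>Increasing \<open>C\<close> makes the estimate of the distance strict, as required for a curve to exist.\<close>
    define D where "D = \<bar>C\<bar> + 1"
    have D: "0 < D" "C < D" by (auto simp: D_def)
    have small: "\<forall>\<^sub>F \<epsilon> :: real in at_right 0. \<epsilon> < \<delta> / D"
      using \<delta> D unfolding eventually_at_right_field by (auto intro!: exI[of _ "\<delta> / D"])
    have "\<forall>\<^sub>F \<epsilon> in at_right 0. \<forall>x\<in>(UNIV :: unit set). norm (u \<epsilon> (q \<epsilon>) - u \<epsilon> (p \<epsilon>)) \<le> D * \<epsilon> ^ m"
      using C K(2) lip small eventually_unit_interval
    proof eventually_elim
      case (elim \<epsilon>)
      define t where "t = D * \<epsilon> ^ Suc (m + N)"
      have e: "0 < \<epsilon>" "\<epsilon> \<le> 1" using elim(5) by auto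
      have "C * \<epsilon> ^ Suc (m + N) < t"
        unfolding t_def using D e by (intro mult_strict_right_mono) auto
      moreover have "0 < t" unfolding t_def using D e by simp
      ultimately have "ennreal (C * \<epsilon> ^ Suc (m + N)) < ennreal t"
        by (simp add: ennreal_lessI)
      then have dt: "riemannian_dist A h (p \<epsilon>) (q \<epsilon>) < ennreal t" using elim(1) by (rule le_less_trans[rotated])
      have "\<epsilon> ^ Suc (m + N) \<le> \<epsilon> ^ 1" using e by (intro power_decreasing) auto
      then have "t \<le> D * \<epsilon>" unfolding t_def using D by (intro mult_left_mono) auto
      also have "\<dots> < \<delta>" using elim(4) D by (simp add: field_simps)
      finally have "norm (u \<epsilon> (q \<epsilon>) - u \<epsilon> (p \<epsilon>)) \<le> t / \<epsilon> ^ N" using elim(3) elim(2) dt by blast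
      also have "\<dots> = (D * \<epsilon> ^ m) * \<epsilon>" unfolding t_def using e by (simp add: power_add)
      also have "\<dots> \<le> (D * \<epsilon> ^ m) * 1" using D e by (intro mult_left_mono) auto
      finally show ?case by simp
    qed
    then show "\<exists>C. \<forall>\<^sub>F \<epsilon> in at_right 0. \<forall>x\<in>(UNIV :: unit set). norm (u \<epsilon> (q \<epsilon>) - u \<epsilon> (p \<epsilon>)) \<le> C * \<epsilon> ^ m"
      by (rule exI)
  qed
qed

lemma riemannian_dist_self:
  assumes h: "riemannian_metric A h" shows "riemannian_dist A h p p = 0"
proof -
  define \<gamma> :: "real \<Rightarrow> 'a" where "\<gamma> = (\<lambda>_. p)"
  have "piecewise_C1_curve A \<gamma>"
    unfolding piecewise_C1_curve_def \<gamma>_def path_def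
    by (auto simp: o_def piecewise_C1_differentiable_on_def C1_differentiable_on_def
        intro!: exI[of _ "{}"] exI[of _ "\<lambda>_. 0"])
  moreover have "riemannian_speed A h \<gamma> t = 0" for t
  proof -
    obtain U \<phi> where c: "(U, \<phi>) \<in> A" "p \<in> U" by (rule chart_exists)
    have "((\<phi> \<circ> \<gamma>) has_vector_derivative 0) (at t)" by (simp add: \<gamma>_def o_def)
    from riemannian_speed_chart[where \<gamma> = \<gamma>, OF h c(1) _ _ this] c(2)
    have "riemannian_speed A h \<gamma> t = sqrt (h (U, \<phi>) p 0 0)" by (simp add: \<gamma>_def)
    then show ?thesis using bilinear_lzero[OF riemannian_metricD(1)[OF h c]] by simp
  qed
  then have "riemannian_length A h \<gamma> = 0" by (simp add: riemannian_length_def)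
  ultimately have "riemannian_dist A h p p \<le> 0"
    unfolding riemannian_dist_def by (intro INF_lower2[of \<gamma>]) (auto simp: \<gamma>_def pathstart_def pathfinish_def)
  then show ?thesis by simp
qed

text \<open>
  If there were no Riemannian metric at all, then no net would be equivalent to itself, and all
  generalized points would be empty.
\<close>

lemma equivalent_nets_refl:
  assumes "paracompact_space (euclidean :: 'a topology)" "p \<in> compactly_supported_nets"
  shows "(p, p) \<in> equivalent_nets A"
proof -
  obtain h where "riemannian_metric A h" by (rule riemannian_metric_exists[OF assms(1)])
  then show ?thesis using assms(2) by (auto simp: equivalent_nets_def riemannian_dist_self)
qed

lemma negligible_net_point_value:
  assumes n: "n \<in> negligible_nets A" and q: "q \<in> compactly_supported_nets"
  shows "(\<lambda>\<epsilon>. n \<epsilon> (q \<epsilon>)) \<in> negligible_numbers"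
proof -
  obtain K where K: "compact K" "\<forall>\<^sub>F \<epsilon> in at_right 0. q \<epsilon> \<in> K"
    using q by (auto simp: compactly_supported_nets_def)
  then have n_small: "\<forall>\<^sub>F \<epsilon> in at_right 0. \<forall>p\<in>K. norm (n \<epsilon> p) \<le> \<epsilon> ^ m" for m
    using n by (simp add: negligible_nets_iff negligible_on_def)
  have "\<forall>\<^sub>F \<epsilon> in at_right 0. norm (n \<epsilon> (q \<epsilon>)) \<le> \<epsilon> ^ m" for m
    using n_small[of m] K(2) by eventually_elim blast
  then show ?thesis by (simp add: negligible_numbers_iff negligible_on_def)
qed

lemma moderate_net_point_value:
  assumes s: "s \<in> moderate_nets A" and q: "q \<in> compactly_supported_nets"
  shows "(\<lambda>\<epsilon>. s \<epsilon> (q \<epsilon>)) \<in> moderate_numbers"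
proof -
  obtain K where K: "compact K" "\<forall>\<^sub>F \<epsilon> in at_right 0. q \<epsilon> \<in> K"
    using q by (auto simp: compactly_supported_nets_def)
  obtain N :: nat where N: "bounded_by_power K s N"
    by (rule moderate_nets_compact_bound[OF s K(1)])
  have "\<forall>\<^sub>F \<epsilon> in at_right 0. norm (s \<epsilon> (q \<epsilon>)) \<le> 1 / \<epsilon> ^ N"
    using N K(2) by eventually_elim blast
  then show ?thesis unfolding moderate_numbers_iff by (rule exI)
qed

end

section \<open>Invertibility\<close>

context smooth_manifold
begin

text \<open>
  All cosets in the union that defines the point value coincide: passing to another representative
  of the function or of the point changes \<open>r \<epsilon> (q \<epsilon>)\<close> by a negligible number.
\<close>

lemma point_value_coset:
  fixes r :: "real \<Rightarrow> 'a \<Rightarrow> 'k::real_normed_field"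
  assumes par: "paracompact_space (euclidean :: 'a topology)"
    and r: "r \<in> moderate_nets A" and q: "q \<in> compactly_supported_nets"
  shows "point_value (negligible_nets A +>\<^bsub>moderate_ring A\<^esub> r) (equivalent_nets A `` {q}) =
    negligible_numbers +>\<^bsub>moderate_number_ring\<^esub> (\<lambda>\<epsilon>. r \<epsilon> (q \<epsilon>))"
proof -
  interpret nets: subring_ideal "moderate_nets A" "negligible_nets A :: (real \<Rightarrow> 'a \<Rightarrow> 'k) set"
    by (rule nets_subring_ideal)
  let ?C = "\<lambda>s q'. negligible_numbers +>\<^bsub>moderate_number_ring\<^esub> (\<lambda>\<epsilon>. s \<epsilon> (q' \<epsilon>))"
  have coset: "negligible_nets A +>\<^bsub>moderate_ring A\<^esub> r = {n + r | n. n \<in> negligible_nets A}"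
    unfolding moderate_ring_eq by (rule nets.coset_eq)
  have eq: "?C (n + r) q' = ?C r q" if n: "n \<in> negligible_nets A" and q': "(q, q') \<in> equivalent_nets A" for n q'
  proof -
    have "q' \<in> compactly_supported_nets" using q' by (auto simp: equivalent_nets_def)
    from numbers.ideal_add[OF negligible_net_point_value[OF n this] equivalent_nets_point_values[OF r q']]
    have "(\<lambda>\<epsilon>. (n + r) \<epsilon> (q' \<epsilon>)) - (\<lambda>\<epsilon>. r \<epsilon> (q \<epsilon>)) \<in> negligible_numbers"
      by (simp add: fun_diff_def plus_fun_def algebra_simps)
    then show ?thesis unfolding moderate_number_ring_eq numbers.coset_eq_iff .
  qed
  have "0 + r \<in> negligible_nets A +>\<^bsub>moderate_ring A\<^esub> r"
    unfolding coset using nets.ideal_zero by blast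
  moreover have "q \<in> equivalent_nets A `` {q}" using equivalent_nets_refl[OF par q] by simp
  ultimately show ?thesis unfolding point_value_def coset using eq by blast
qed

text \<open>
  The point \<open>q \<epsilon>\<close> is chosen in \<open>K\<close> such that \<open>\<bar>r \<epsilon>\<bar>\<close> is minimal there. An inverse \<open>y\<close> of the point
  value at \<open>q\<close> grows at most like \<open>\<epsilon>\<^sup>-\<^sup>N\<close>, so \<open>r \<epsilon> (q \<epsilon>)\<close> is at least of the order \<open>\<epsilon>\<^sup>N\<close>, and by
  minimality so is \<open>r \<epsilon>\<close> on all of \<open>K\<close>.
\<close>

lemma lower_bound_of_invertible_point_values:
  fixes r :: "real \<Rightarrow> 'a \<Rightarrow> 'k::real_normed_field"
  assumes r: "r \<in> moderate_nets A"
    and inv: "\<And>q. q \<in> compactly_supported_nets \<Longrightarrow>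
      \<exists>y\<in>moderate_numbers. (\<lambda>\<epsilon>. r \<epsilon> (q \<epsilon>) * y \<epsilon> - 1) \<in> negligible_numbers"
    and K: "compact K"
  obtains m where "\<forall>\<^sub>F \<epsilon> in at_right 0. \<forall>p\<in>K. \<epsilon> ^ (m :: nat) \<le> norm (r \<epsilon> p)"
proof (cases "K = {}")
  case True
  then show thesis using that[of 0] by simp
next
  case False
  have "\<exists>p\<in>K. \<forall>p'\<in>K. norm (r \<epsilon> p) \<le> norm (r \<epsilon> p')" if "\<epsilon> \<in> {0<..1}" for \<epsilon>
    by (intro continuous_attains_inf[OF K False] continuous_on_norm
        continuous_on_subset[OF smooth_function_continuous[OF moderate_nets_smooth[OF r that]] subset_UNIV])
  then have "\<forall>\<epsilon>\<in>{0<..1}. \<exists>p. p \<in> K \<and> (\<forall>p'\<in>K. norm (r \<epsilon> p) \<le> norm (r \<epsilon> p'))" by blast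
  from bchoice[OF this] obtain q
    where q: "\<And>\<epsilon>. \<epsilon> \<in> {0<..1} \<Longrightarrow> q \<epsilon> \<in> K \<and> (\<forall>p'\<in>K. norm (r \<epsilon> (q \<epsilon>)) \<le> norm (r \<epsilon> p'))"
    by blast
  have "\<forall>\<^sub>F \<epsilon> in at_right 0. q \<epsilon> \<in> K"
    using eventually_unit_interval by eventually_elim (use q in blast)
  then have "q \<in> compactly_supported_nets" using K by (auto simp: compactly_supported_nets_def)
  from inv[OF this] obtain y where y: "y \<in> moderate_numbers"
    "(\<lambda>\<epsilon>. r \<epsilon> (q \<epsilon>) * y \<epsilon> - 1) \<in> negligible_numbers" by blast
  obtain N :: nat where N: "\<forall>\<^sub>F \<epsilon> in at_right 0. norm (y \<epsilon>) \<le> 1 / \<epsilon> ^ N"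
    using y(1) unfolding moderate_numbers_iff by (rule exE)
  have near: "\<forall>\<^sub>F \<epsilon> in at_right 0. norm (r \<epsilon> (q \<epsilon>) * y \<epsilon> - 1) \<le> \<epsilon> ^ 1"
    using y(2)[unfolded negligible_numbers_iff negligible_on_def, THEN spec, of 1] by simp
  have half: "\<forall>\<^sub>F \<epsilon> :: real in at_right 0. \<epsilon> < 1 / 2"
    unfolding eventually_at_right_field by (auto intro!: exI[of _ "1 / 2"])
  have "\<forall>\<^sub>F \<epsilon> in at_right 0. \<forall>p\<in>K. \<epsilon> ^ Suc N \<le> norm (r \<epsilon> p)"
    using N near half eventually_unit_interval
  proof eventually_elim
    case (elim \<epsilon>)
    have e: "0 < \<epsilon>" using elim(4) by simp
    have "1 = norm (r \<epsilon> (q \<epsilon>) * y \<epsilon> - (r \<epsilon> (q \<epsilon>) * y \<epsilon> - 1))" by simp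
    also have "\<dots> \<le> norm (r \<epsilon> (q \<epsilon>) * y \<epsilon>) + norm (r \<epsilon> (q \<epsilon>) * y \<epsilon> - 1)" by (rule norm_triangle_ineq4)
    finally have "1 / 2 \<le> norm (r \<epsilon> (q \<epsilon>)) * norm (y \<epsilon>)" using elim(2,3) by (simp add: norm_mult)
    also have "\<dots> \<le> norm (r \<epsilon> (q \<epsilon>)) * (1 / \<epsilon> ^ N)" by (rule mult_left_mono[OF elim(1)]) simp
    finally have "(1 / 2) * \<epsilon> ^ N \<le> norm (r \<epsilon> (q \<epsilon>))" using e by (simp add: field_simps)
    moreover have "\<epsilon> * \<epsilon> ^ N \<le> (1 / 2) * \<epsilon> ^ N" using elim(3) e by (intro mult_right_mono) auto
    ultimately have "\<epsilon> ^ Suc N \<le> norm (r \<epsilon> (q \<epsilon>))" by simp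
    then show ?case using q[OF elim(4)] by (meson order_trans)
  qed
  then show thesis by (rule that)
qed

text \<open>
  The lower bounds hold for small \<open>\<epsilon>\<close> only, whereas \<open>w \<epsilon>\<close> has to be free of zeros for each \<open>\<epsilon>\<close>, since the
  members of a moderate net are smooth on the whole manifold.
\<close>

lemma moderate_nets_inverse:
  fixes w :: "real \<Rightarrow> 'a \<Rightarrow> 'k::real_normed_field"
  assumes w: "w \<in> moderate_nets A" and nz: "\<And>\<epsilon> p. \<epsilon> \<in> {0<..1} \<Longrightarrow> w \<epsilon> p \<noteq> 0"
    and low: "\<And>K. compact K \<Longrightarrow> \<exists>m::nat. \<forall>\<^sub>F \<epsilon> in at_right 0. \<forall>p\<in>K. \<epsilon> ^ m \<le> norm (w \<epsilon> p)"
  shows "(\<lambda>\<epsilon> p. inverse (w \<epsilon> p)) \<in> moderate_nets A"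
proof (rule moderate_on_imp_moderate_nets)
  fix U \<phi> assume c: "(U, \<phi>) \<in> A"
  have "locally_moderate (\<phi> ` U) (\<lambda>\<epsilon> x. inverse ((w \<epsilon> \<circ> inv_into U \<phi>) x))"
    unfolding locally_moderate_def
  proof (intro ballI, goal_cases)
    case (1 x)
    then obtain p where p: "p \<in> U" "x = \<phi> p" by blast
    obtain \<rho> where \<rho>: "0 < \<rho>" "cball (\<phi> p) \<rho> \<subseteq> \<phi> ` (U \<inter> U)"
      by (rule chart_cball[OF c chart_open[OF c] p(1) p(1)])
    have "compact (inv_into U \<phi> ` cball x \<rho>)"
      by (rule compact_chart_preimage[OF c]) (use \<rho>(2) p(2) in auto)
    from low[OF this] obtain m :: nat
      where m: "\<forall>\<^sub>F \<epsilon> in at_right 0. \<forall>q\<in>inv_into U \<phi> ` cball x \<rho>. \<epsilon> ^ m \<le> norm (w \<epsilon> q)" by blast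
    have "\<forall>\<^sub>F \<epsilon> in at_right 0. \<forall>y\<in>ball x \<rho> \<inter> \<phi> ` U. norm (inverse ((w \<epsilon> \<circ> inv_into U \<phi>) y)) \<le> 1 / \<epsilon> ^ m"
      using m eventually_unit_interval
    proof eventually_elim
      case (elim \<epsilon>)
      show ?case
      proof
        fix y assume "y \<in> ball x \<rho> \<inter> \<phi> ` U"
        then have "inv_into U \<phi> y \<in> inv_into U \<phi> ` cball x \<rho>" by auto
        then have "\<epsilon> ^ m \<le> norm (w \<epsilon> (inv_into U \<phi> y))" using elim(1) by blast
        moreover have "0 < \<epsilon> ^ m" using elim(2) by simp
        ultimately show "norm (inverse ((w \<epsilon> \<circ> inv_into U \<phi>) y)) \<le> 1 / \<epsilon> ^ m"
          by (simp add: inverse_eq_divide norm_divide frac_le)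
      qed
    qed
    then show ?case
      using \<rho>(1) by (intro exI[of _ "ball x \<rho>"] exI[of _ m] conjI) simp_all
  qed
  then have "moderate_on (\<phi> ` U) (\<lambda>\<epsilon> x. inverse ((w \<epsilon> \<circ> inv_into U \<phi>) x))"
    by (rule moderate_on_inverse[OF chart_image_open[OF c] moderate_nets_imp_moderate_on[OF w c], rotated])
      (simp add: nz)
  then show "moderate_on (\<phi> ` U) (\<lambda>\<epsilon>. (\<lambda>p. inverse (w \<epsilon> p)) \<circ> inv_into U \<phi>)" by (simp add: o_def)
qed

lemma eventually_flat_le_power: "\<forall>\<^sub>F \<epsilon> in at_right 0. flat 0 \<epsilon> \<le> \<epsilon> ^ n"
proof -
  have "(flat n \<longlongrightarrow> 0) (at_right 0)" using flat_tendsto_0 by (rule filterlim_at_split[THEN iffD1, THEN conjunct2])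
  then have "\<forall>\<^sub>F \<epsilon> in at_right 0. flat n \<epsilon> < 1" by (rule order_tendstoD) simp
  then show ?thesis
    using eventually_unit_interval
  proof eventually_elim
    case (elim \<epsilon>)
    then have "flat 0 \<epsilon> = flat n \<epsilon> * \<epsilon> ^ n" by (simp add: flat_def field_simps)
    also have "\<dots> \<le> 1 * \<epsilon> ^ n" using elim by (intro mult_right_mono) auto
    finally show ?case by simp
  qed
qed

lemma flat_bounds: "0 < \<epsilon> \<Longrightarrow> 0 < flat 0 \<epsilon>" "flat 0 \<epsilon> \<le> 1"
  by (auto simp: flat_def)

text \<open>
  For a fixed \<open>\<epsilon>\<close> the function \<open>r \<epsilon>\<close> may vanish outside a given compact set. Adding the negligible
  number \<open>flat 0 \<epsilon> > 0\<close> to \<open>\<bar>r \<epsilon>\<bar>\<^sup>2\<close> makes the inverse globally defined; it replaces a gluing of local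
  inverses. The map \<open>cj\<close> is the conjugation of the scalars, which is the identity for real ones.
\<close>

lemma inverse_net_exists:
  fixes r :: "real \<Rightarrow> 'a \<Rightarrow> 'k::real_normed_field"
  assumes cj: "bounded_linear cj" "\<And>z :: 'k. z * cj z = of_real ((norm z)\<^sup>2)"
    and r: "r \<in> moderate_nets A"
    and low: "\<And>K. compact K \<Longrightarrow> \<exists>m::nat. \<forall>\<^sub>F \<epsilon> in at_right 0. \<forall>p\<in>K. \<epsilon> ^ m \<le> norm (r \<epsilon> p)"
  obtains v where "v \<in> moderate_nets A" "(\<lambda>\<epsilon> p. r \<epsilon> p * v \<epsilon> p - 1) \<in> negligible_nets A"
proof -
  define d where "d \<epsilon> p = (norm (r \<epsilon> p))\<^sup>2 + flat 0 \<epsilon>" for \<epsilon> p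
  define w :: "real \<Rightarrow> 'a \<Rightarrow> 'k" where "w \<epsilon> p = of_real (d \<epsilon> p)" for \<epsilon> p
  have d_pos: "0 < d \<epsilon> p" if "\<epsilon> \<in> {0<..1}" for \<epsilon> p
    using flat_bounds(1)[of \<epsilon>] that by (simp add: d_def add_nonneg_pos)
  have cjr: "(\<lambda>\<epsilon> p. cj (r \<epsilon> p)) \<in> moderate_nets A"
    by (rule moderate_nets_bounded_linear[OF cj(1) r])
  have "locally_moderate UNIV (\<lambda>\<epsilon> (_::real). of_real (flat 0 \<epsilon>) :: 'k)"
    using flat_bounds(2) by (intro locally_moderate_bound[OF locally_moderate_continuous[of UNIV "\<lambda>_. 1 :: real"], where C = 1])
      (auto simp: flat_def)
  then have "(\<lambda>\<epsilon> p. of_real (flat 0 \<epsilon>) :: 'k) \<in> moderate_nets A"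
    by (rule moderate_nets_const)
  from moderate_nets_add[OF moderate_nets_mult[OF r cjr] this]
  have w: "w \<in> moderate_nets A"
    by (simp add: w_def[abs_def] d_def cj(2))
  have loww: "\<exists>m::nat. \<forall>\<^sub>F \<epsilon> in at_right 0. \<forall>p\<in>K. \<epsilon> ^ m \<le> d \<epsilon> p" if K: "compact K" for K
  proof -
    obtain m :: nat where m: "\<forall>\<^sub>F \<epsilon> in at_right 0. \<forall>p\<in>K. \<epsilon> ^ m \<le> norm (r \<epsilon> p)" using low[OF K] by blast
    have "\<forall>\<^sub>F \<epsilon> in at_right 0. \<forall>p\<in>K. \<epsilon> ^ (m * 2) \<le> d \<epsilon> p"
      using m eventually_unit_interval
    proof eventually_elim
      case (elim \<epsilon>)
      show ?case
      proof
        fix p assume "p \<in> K"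
        then have "(\<epsilon> ^ m)\<^sup>2 \<le> (norm (r \<epsilon> p))\<^sup>2" using elim by (intro power_mono) auto
        moreover have "0 < flat 0 \<epsilon>" using flat_bounds(1)[of \<epsilon>] elim(2) by simp
        ultimately show "\<epsilon> ^ (m * 2) \<le> d \<epsilon> p" unfolding d_def power_mult by linarith
      qed
    qed
    then show ?thesis by (rule exI)
  qed
  define v where "v \<epsilon> p = cj (r \<epsilon> p) * inverse (w \<epsilon> p)" for \<epsilon> p
  have "(\<lambda>\<epsilon> p. inverse (w \<epsilon> p)) \<in> moderate_nets A"
  proof (rule moderate_nets_inverse[OF w])
    show "w \<epsilon> p \<noteq> 0" if "\<epsilon> \<in> {0<..1}" for \<epsilon> p
      using d_pos[OF that, of p] by (simp add: w_def)
    fix K :: "'a set" assume "compact K"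
    from loww[OF this] obtain m :: nat where m: "\<forall>\<^sub>F \<epsilon> in at_right 0. \<forall>p\<in>K. \<epsilon> ^ m \<le> d \<epsilon> p" by blast
    have "\<forall>\<^sub>F \<epsilon> in at_right 0. \<forall>p\<in>K. \<epsilon> ^ m \<le> norm (w \<epsilon> p)"
      using m by eventually_elim (auto simp: w_def intro: order_trans[OF _ abs_ge_self])
    then show "\<exists>m::nat. \<forall>\<^sub>F \<epsilon> in at_right 0. \<forall>p\<in>K. \<epsilon> ^ m \<le> norm (w \<epsilon> p)" by (rule exI)
  qed
  from moderate_nets_mult[OF cjr this] have v: "v \<in> moderate_nets A" by (simp add: v_def[abs_def])
  have diff: "norm (r \<epsilon> p * v \<epsilon> p - 1) = flat 0 \<epsilon> / d \<epsilon> p" if e: "\<epsilon> \<in> {0<..1}" for \<epsilon> p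
  proof -
    have "r \<epsilon> p * v \<epsilon> p - 1 = of_real ((norm (r \<epsilon> p))\<^sup>2 / d \<epsilon> p - 1)"
      by (simp add: v_def w_def mult.assoc[symmetric] cj(2) divide_inverse)
    also have "(norm (r \<epsilon> p))\<^sup>2 / d \<epsilon> p - 1 = - (flat 0 \<epsilon> / d \<epsilon> p)"
      using d_pos[OF e, of p] by (simp add: field_simps d_def)
    finally show ?thesis
      using d_pos[OF e, of p] flat_bounds(1)[of \<epsilon>] e by (simp add: norm_divide)
  qed
  have "negligible_on K (\<lambda>\<epsilon> p. r \<epsilon> p * v \<epsilon> p - 1)" if K: "compact K" for K
    unfolding negligible_on_def
  proof
    fix k
    obtain m :: nat where m: "\<forall>\<^sub>F \<epsilon> in at_right 0. \<forall>p\<in>K. \<epsilon> ^ m \<le> d \<epsilon> p" using loww[OF K] by blast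
    show "\<forall>\<^sub>F \<epsilon> in at_right 0. \<forall>p\<in>K. norm (r \<epsilon> p * v \<epsilon> p - 1) \<le> \<epsilon> ^ k"
      \<comment> \<open>The additional exponent \<open>m\<close> compensates the division by \<open>d\<close>.\<close>
      using m eventually_flat_le_power[of "k + m"] eventually_unit_interval
    proof eventually_elim
      case (elim \<epsilon>)
      have e: "0 < \<epsilon>" using elim(3) by simp
      show ?case
      proof
        fix p assume p: "p \<in> K"
        have "flat 0 \<epsilon> / d \<epsilon> p \<le> \<epsilon> ^ (k + m) / \<epsilon> ^ m"
          using elim p e flat_bounds(1)[OF e] by (intro frac_le) auto
        then show "norm (r \<epsilon> p * v \<epsilon> p - 1) \<le> \<epsilon> ^ k"
          using diff[OF elim(3), of p] e by (simp add: power_add)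
      qed
    qed
  qed
  moreover have "(\<lambda>\<epsilon> p. r \<epsilon> p * v \<epsilon> p - 1) \<in> moderate_nets A"
    using moderate_nets_add[OF moderate_nets_mult[OF r v] moderate_nets_const[of "\<lambda>_. - 1"]]
    by (simp add: locally_moderate_continuous)
  ultimately have "(\<lambda>\<epsilon> p. r \<epsilon> p * v \<epsilon> p - 1) \<in> negligible_nets A" by (simp add: negligible_nets_iff)
  with v show thesis by (rule that)
qed

text \<open>
  Stated for a field of scalars with a conjugation, so that the real and the complex case are
  instances.
\<close>

lemma Units_generalized_functions_iff:
  fixes cj :: "'k::real_normed_field \<Rightarrow> 'k"
  assumes par: "paracompact_space (euclidean :: 'a topology)"
    and cj: "bounded_linear cj" "\<And>z. z * cj z = of_real ((norm z)\<^sup>2)"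
    and u: "u \<in> carrier (generalized_functions A :: (real \<Rightarrow> 'a \<Rightarrow> 'k) set ring)"
  shows "u \<in> Units (generalized_functions A) \<longleftrightarrow>
    (\<forall>P\<in>generalized_points A. point_value u P \<in> Units generalized_numbers)"
proof -
  interpret nets: subring_ideal "moderate_nets A" "negligible_nets A :: (real \<Rightarrow> 'a \<Rightarrow> 'k) set"
    by (rule nets_subring_ideal)
  obtain r where r: "r \<in> moderate_nets A" and u_eq: "u = negligible_nets A +>\<^bsub>moderate_ring A\<^esub> r"
    using u unfolding generalized_functions_def moderate_ring_eq nets.carrier_Quot by blast
  have units: "u \<in> Units (generalized_functions A) \<longleftrightarrow> (\<exists>s\<in>moderate_nets A. (\<lambda>\<epsilon> p. r \<epsilon> p * s \<epsilon> p - 1) \<in> negligible_nets A)"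
    unfolding u_eq generalized_functions_def moderate_ring_eq nets.coset_mem_Units_iff[OF r]
    by (simp add: fun_diff_def times_fun_def one_fun_def)
  have pt_value: "point_value u (equivalent_nets A `` {q}) \<in> Units generalized_numbers \<longleftrightarrow>
      (\<exists>y\<in>moderate_numbers. (\<lambda>\<epsilon>. r \<epsilon> (q \<epsilon>) * y \<epsilon> - 1) \<in> negligible_numbers)"
    if q: "q \<in> compactly_supported_nets" for q
    unfolding u_eq point_value_coset[OF par r q] generalized_numbers_def moderate_number_ring_eq
      numbers.coset_mem_Units_iff[OF moderate_net_point_value[OF r q]]
    by (simp add: fun_diff_def times_fun_def one_fun_def)
  have points: "(\<forall>P\<in>generalized_points A. point_value u P \<in> Units generalized_numbers) \<longleftrightarrow>
      (\<forall>q\<in>compactly_supported_nets. \<exists>y\<in>moderate_numbers. (\<lambda>\<epsilon>. r \<epsilon> (q \<epsilon>) * y \<epsilon> - 1) \<in> negligible_numbers)"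
    unfolding generalized_points_def quotient_def using pt_value by simp
  show ?thesis unfolding units points
  proof
    assume "\<exists>s\<in>moderate_nets A. (\<lambda>\<epsilon> p. r \<epsilon> p * s \<epsilon> p - 1) \<in> negligible_nets A"
    then obtain s where s: "s \<in> moderate_nets A" "(\<lambda>\<epsilon> p. r \<epsilon> p * s \<epsilon> p - 1) \<in> negligible_nets A" by blast
    show "\<forall>q\<in>compactly_supported_nets. \<exists>y\<in>moderate_numbers. (\<lambda>\<epsilon>. r \<epsilon> (q \<epsilon>) * y \<epsilon> - 1) \<in> negligible_numbers"
    proof
      fix q :: "real \<Rightarrow> 'a" assume "q \<in> compactly_supported_nets"
      then show "\<exists>y\<in>moderate_numbers. (\<lambda>\<epsilon>. r \<epsilon> (q \<epsilon>) * y \<epsilon> - 1) \<in> negligible_numbers"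
        using moderate_net_point_value[OF s(1)] negligible_net_point_value[OF s(2)]
        by (intro bexI[of _ "\<lambda>\<epsilon>. s \<epsilon> (q \<epsilon>)"])
    qed
  next
    assume inv: "\<forall>q\<in>compactly_supported_nets. \<exists>y\<in>moderate_numbers. (\<lambda>\<epsilon>. r \<epsilon> (q \<epsilon>) * y \<epsilon> - 1) \<in> negligible_numbers"
    have "\<exists>m::nat. \<forall>\<^sub>F \<epsilon> in at_right 0. \<forall>p\<in>K. \<epsilon> ^ m \<le> norm (r \<epsilon> p)" if K: "compact K" for K
      by (rule lower_bound_of_invertible_point_values[OF r _ K]) (use inv in blast)+
    then obtain v where "v \<in> moderate_nets A" "(\<lambda>\<epsilon> p. r \<epsilon> p * v \<epsilon> p - 1) \<in> negligible_nets A"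
      by (rule inverse_net_exists[OF cj r])
    then show "\<exists>s\<in>moderate_nets A. (\<lambda>\<epsilon> p. r \<epsilon> p * s \<epsilon> p - 1) \<in> negligible_nets A" by blast
  qed
qed

end

theorem proposition2p5:
  fixes A :: "('a::t2_space, 'e::{real_inner,heine_borel}) chart set"
  assumes "smooth_atlas A"
    and "paracompact_space (euclidean :: 'a topology)"
  shows
    "(\<forall>u \<in> carrier (generalized_functions A :: (real \<Rightarrow> 'a \<Rightarrow> real) set ring).
        u \<in> Units (generalized_functions A) \<longleftrightarrow>
        (\<forall>p \<in> generalized_points A. point_value u p \<in> Units generalized_numbers)) \<and>
     (\<forall>u \<in> carrier (generalized_functions A :: (real \<Rightarrow> 'a \<Rightarrow> complex) set ring).
        u \<in> Units (generalized_functions A) \<longleftrightarrow>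
        (\<forall>p \<in> generalized_points A. point_value u p \<in> Units generalized_numbers))"
proof -
  interpret smooth_manifold A by standard (rule assms(1))
  have "bounded_linear (\<lambda>z :: real. z)" "\<And>z :: real. z * z = of_real ((norm z)\<^sup>2)"
    by (simp_all add: bounded_linear_ident power2_eq_square)
  note real_case = Units_generalized_functions_iff[OF assms(2) this]
  have "bounded_linear cnj" "\<And>z. z * cnj z = of_real ((norm z)\<^sup>2)"
    by (rule bounded_linear_cnj, rule complex_norm_square[symmetric])
  note complex_case = Units_generalized_functions_iff[OF assms(2) this]
  show ?thesis using real_case complex_case by blast
qed

end
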